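(* Let $G$ be a sharply 2-transitive group of characteristic $0$. There exists a simple sharply 2-transitive group $\Gamma$ that contains $G$ as a subgroup, that has the same cardinality as $G$, and such that every element of $\Gamma$ is a translation or a product of two translations (and hence every element of $\Gamma$ is a product of four involutions).
   Context: An action of a group $G$ on a set $X$ with $|X|\geq 2$ is called sharply 2-transitive if for any two pairs $(x_1,x_2)$ and $(y_1,y_2)$ of elements of $X$ with $x_1\neq x_2$ and $y_1\neq y_2$ there exists a unique $g\in G$ such that $g\cdot x_1=y_1$ and $g\cdot x_2=y_2$. A group is called sharply 2-transitive if it acts sharply 2-transitively on some set $X$ with $|X|\geq 2$. An involution is an element of order $2$. A sharply 2-transitive group is of characteristic $0$ if every pair of distinct involutions generates an infinite dihedral group and every involution has a fixed point in $X$. For a group $G$, $I_G$ denotes the set of involutions of $G$; a translation of $G$ is a non-trivial product of two involutions, i.e. an element of $T_G=\{ab : a,b\in I_G\}\setminus\{1\}$. *)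

theory Defs
  imports "HOL-Algebra.Group_Action" "HOL-Algebra.Elementary_Groups"
    "HOL-Algebra.Multiplicative_Group" "HOL-Library.Equipollence"
begin

locale sharply_2_transitive = group_action G S \<phi>
  for G (structure) and S and \<phi> +
  assumes two_points: "\<exists>x\<in>S. \<exists>y\<in>S. x \<noteq> y"
    and sharp: "\<lbrakk>x1 \<in> S; x2 \<in> S; y1 \<in> S; y2 \<in> S; x1 \<noteq> x2; y1 \<noteq> y2\<rbrakk>
      \<Longrightarrow> \<exists>!g. g \<in> carrier G \<and> \<phi> g x1 = y1 \<and> \<phi> g x2 = y2"

text \<open>The set acted upon may be taken in the carrier type of the group, because a transitive
  \<open>G\<close>-set injects into \<open>G\<close>; see \<open>sharply_2_transitive_groupI\<close> below.\<close>

definition sharply_2_transitive_group :: "('a, 'm) monoid_scheme \<Rightarrow> bool" where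
  "sharply_2_transitive_group G \<longleftrightarrow> (\<exists>(S :: 'a set) \<phi>. sharply_2_transitive G S \<phi>)"

definition involutions :: "('a, 'm) monoid_scheme \<Rightarrow> 'a set" where
  "involutions G = {a \<in> carrier G. group.ord G a = 2}"

definition translation_set :: "('a, 'm) monoid_scheme \<Rightarrow> 'a set" where
  "translation_set G =
    {a \<otimes>\<^bsub>G\<^esub> b | a b. a \<in> involutions G \<and> b \<in> involutions G} - {\<one>\<^bsub>G\<^esub>}"

text \<open>The semidirect product of \<open>\<int>\<close> by \<open>{1, -1}\<close> acting by sign;
  \<open>(m, s)\<close> stands for the map \<open>n \<mapsto> m + s * n\<close> on \<open>\<int>\<close>.\<close>

definition infinite_dihedral_group :: "(int \<times> int) monoid" where
  "infinite_dihedral_group =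
    \<lparr>carrier = UNIV \<times> {1, -1},
     mult = (\<lambda>(m, s) (n, t). (m + s * n, s * t)),
     one = (0, 1)\<rparr>"

lemma group_infinite_dihedral_group: "group infinite_dihedral_group"
proof (rule groupI)
  fix x assume "x \<in> carrier infinite_dihedral_group"
  then show "\<exists>y\<in>carrier infinite_dihedral_group.
      y \<otimes>\<^bsub>infinite_dihedral_group\<^esub> x = \<one>\<^bsub>infinite_dihedral_group\<^esub>"
    by (intro bexI[of _ "(- snd x * fst x, snd x)"]) (auto simp: infinite_dihedral_group_def)
qed (auto simp: infinite_dihedral_group_def algebra_simps)

locale sharply_2_transitive_char_0 = sharply_2_transitive +
  assumes infinite_dihedral:
      "\<lbrakk>a \<in> involutions G; b \<in> involutions G; a \<noteq> b\<rbrakk>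
        \<Longrightarrow> subgroup_generated G {a, b} \<cong> infinite_dihedral_group"
    and involution_fixed_point: "a \<in> involutions G \<Longrightarrow> \<exists>x\<in>S. \<phi> a x = x"

text \<open>The library's locale \<open>simple_group\<close> demands \<open>order G > 1\<close>. As \<open>order\<close> is \<open>0\<close> on
  infinite groups, it only covers finite ones and cannot be used here.\<close>

definition simple :: "('a, 'm) monoid_scheme \<Rightarrow> bool" where
  "simple G \<longleftrightarrow> group G \<and> carrier G \<noteq> {\<one>\<^bsub>G\<^esub>} \<and>
    (\<forall>H. H \<lhd> G \<longrightarrow> H = carrier G \<or> H = {\<one>\<^bsub>G\<^esub>})"

lemma sharply_2_transitive_groupI:
  fixes G :: "('a, 'm) monoid_scheme" and S :: "'x set"
  assumes "sharply_2_transitive G S \<phi>"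
  shows "sharply_2_transitive_group G"
proof -
  interpret sharply_2_transitive G S \<phi> by fact
  interpret G: group G using group_hom by (simp add: group_hom_def)
  obtain p q where p: "p \<in> S" "q \<in> S" "p \<noteq> q" using two_points by blast
  have ex: "\<exists>g. g \<in> carrier G \<and> \<phi> g p = x" if "x \<in> S" for x
  proof -
    obtain y where "y \<in> S" "y \<noteq> x" using p by blast
    then show ?thesis using sharp[OF p(1,2) that _ p(3)] by metis
  qed
  define f where "f x = (SOME g. g \<in> carrier G \<and> \<phi> g p = x)" for x
  have f: "\<phi> (f x) p = x" if "x \<in> S" for x
    using someI_ex[OF ex[OF that]] by (simp add: f_def)
  have inj: "inj_on f S" by (rule inj_onI) (metis f)
  define Y where "Y = f ` S"
  define e where "e = inv_into S f"
  have eX: "e y \<in> S" and fe: "f (e y) = y" if "y \<in> Y" for y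
    using that by (auto simp: Y_def e_def inv_into_into f_inv_into_f)
  have ef: "e (f x) = x" if "x \<in> S" for x
    using that inj by (simp add: e_def)
  have fY: "f x \<in> Y" if "x \<in> S" for x using that by (simp add: Y_def)
  define \<psi> where "\<psi> g = (\<lambda>y\<in>Y. f (\<phi> g (e y)))" for g
  have act: "\<phi> g x \<in> S" if "g \<in> carrier G" "x \<in> S" for g x
    using that by (rule element_image) simp
  have comp: "\<phi> (g \<otimes>\<^bsub>G\<^esub> h) x = \<phi> g (\<phi> h x)"
    if "g \<in> carrier G" "h \<in> carrier G" "x \<in> S" for g h x
    using that by (rule composition_rule[rotated])
  have one: "\<phi> \<one>\<^bsub>G\<^esub> x = x" if "x \<in> S" for x
    using that id_eq_one by (metis restrict_apply')
  have \<psi>Y: "\<psi> g y \<in> Y" if "g \<in> carrier G" "y \<in> Y" for g y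
    using that by (simp add: \<psi>_def act eX fY)
  have \<psi>comp: "\<psi> (g \<otimes>\<^bsub>G\<^esub> h) y = \<psi> g (\<psi> h y)"
    if "g \<in> carrier G" "h \<in> carrier G" "y \<in> Y" for g h y
    using that by (simp add: \<psi>_def act eX fY ef comp)
  have \<psi>one: "\<psi> \<one>\<^bsub>G\<^esub> y = y" if "y \<in> Y" for y
    using that by (simp add: \<psi>_def one eX fe)
  have \<psi>bij: "\<psi> g \<in> Bij Y" if g: "g \<in> carrier G" for g
  proof -
    have "bij_betw (\<psi> g) Y Y"
    proof (rule bij_betw_byWitness[where f' = "\<psi> (inv\<^bsub>G\<^esub> g)"])
      show "\<forall>y\<in>Y. \<psi> (inv\<^bsub>G\<^esub> g) (\<psi> g y) = y"
        using g by (simp add: \<psi>comp[symmetric] \<psi>one)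
      show "\<forall>y\<in>Y. \<psi> g (\<psi> (inv\<^bsub>G\<^esub> g) y) = y"
        using g by (simp add: \<psi>comp[symmetric] \<psi>one)
    qed (use g \<psi>Y in auto)
    then show ?thesis by (simp add: Bij_def \<psi>_def)
  qed
  have "\<psi> \<in> hom G (BijGroup Y)"
  proof (rule homI)
    fix g h assume g: "g \<in> carrier G" and h: "h \<in> carrier G"
    have "\<psi> (g \<otimes>\<^bsub>G\<^esub> h) = compose Y (\<psi> g) (\<psi> h)"
    proof (rule extensionalityI[of _ Y])
      show "\<psi> (g \<otimes>\<^bsub>G\<^esub> h) \<in> extensional Y" by (simp add: \<psi>_def)
      show "\<psi> (g \<otimes>\<^bsub>G\<^esub> h) y = compose Y (\<psi> g) (\<psi> h) y" if "y \<in> Y" for y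
        using that g h by (simp add: compose_def \<psi>comp)
    qed simp
    then show "\<psi> (g \<otimes>\<^bsub>G\<^esub> h) = \<psi> g \<otimes>\<^bsub>BijGroup Y\<^esub> \<psi> h"
      using g h by (simp add: BijGroup_def \<psi>bij)
  qed (simp add: BijGroup_def \<psi>bij)
  then have action: "group_action G Y \<psi>"
    by (simp add: group_action_def group_hom_def group_hom_axioms_def group_BijGroup)
  have iff: "\<psi> g x = y \<longleftrightarrow> \<phi> g (e x) = e y" if "g \<in> carrier G" "x \<in> Y" "y \<in> Y" for g x y
    using that by (metis \<psi>_def act eX ef fe restrict_apply')
  have "sharply_2_transitive G Y \<psi>"
  proof (intro sharply_2_transitive.intro sharply_2_transitive_axioms.intro action)
    show "\<exists>x\<in>Y. \<exists>y\<in>Y. x \<noteq> y"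
      using p fY inj by (metis inj_on_def)
    fix x1 x2 y1 y2
    assume Y: "x1 \<in> Y" "x2 \<in> Y" "y1 \<in> Y" "y2 \<in> Y" and ne: "x1 \<noteq> x2" "y1 \<noteq> y2"
    then have "e x1 \<noteq> e x2" "e y1 \<noteq> e y2" by (metis fe)+
    then have "\<exists>!g. g \<in> carrier G \<and> \<phi> g (e x1) = e y1 \<and> \<phi> g (e x2) = e y2"
      using Y by (intro sharp eX)
    then show "\<exists>!g. g \<in> carrier G \<and> \<psi> g x1 = y1 \<and> \<psi> g x2 = y2"
      using Y iff by (metis (no_types, lifting))
  qed
  then show ?thesis unfolding sharply_2_transitive_group_def by blast
qed

end

theory Submission
  imports Defs
begin

text \<open>
  A sharply 2-transitive group of characteristic 0 acts on its point set exactly as it acts on its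
  involutions by conjugation, because every involution has one fixed point and is determined by it
  (\<open>involution_eqI\<close>). Conversely, a group with at least two involutions acts sharply 2-transitively
  on them if any two pairs of distinct involutions are conjugate and no non-trivial element
  commutes with two of them. If moreover every element is a product of four involutions, the group
  is simple: a non-trivial normal subgroup contains a commutator \<open>n r n\<inverse> r\<close> with an involution \<open>r\<close>,
  which is a translation; all translations are conjugate, and every element is a product of two
  products of two involutions (\<open>simple_from_involutions\<close>). Such a group is built around \<open>G\<close>.

  Fix distinct involutions \<open>i\<close>, \<open>j\<close> of \<open>G\<close>. The construction stays within the class of
  \<^emph>\<open>admissible\<close> groups. There a product of two distinct involutions has infinite order, \<open>{i, j}\<close> has
  trivial centraliser, and a pair of distinct involutions is either conjugate to \<open>(i, j)\<close> or lies in
  an infinite dihedral group that is malnormal up to elements of finite order; the first alternative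
  holds for the pairs in the dihedral group \<open>dih i j\<close> generated by \<open>i\<close> and \<open>j\<close>. Three kinds of
  HNN extensions, where a stable letter may also be adjoined as an involution, preserve the class:

  \<^item> Add a free involution \<open>e\<^sub>h\<close> for every \<open>h\<close> with \<open>h\<^sup>2 \<noteq> 1\<close>. The elements \<open>e\<^sub>h h\<close> then generate
    infinite cyclic groups that are malnormal and pairwise not conjugate (\<open>malnormal_uc\<close>).

  \<^item> Add for each \<open>w = e\<^sub>h h\<close> an involution inverting \<open>w\<close>. Now \<open>w\<close> is a product of two involutions.
    Every \<open>g\<close> in the old group can be written as \<open>h k\<close> with \<open>k \<in> {i, j}\<close> and \<open>h \<noteq> 1\<close>. If \<open>h\<^sup>2 \<noteq> 1\<close>,
    then \<open>g = e\<^sub>h (e\<^sub>h h) k\<close> has become a product of four involutions; otherwise \<open>g = h k k k\<close> was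
    one before.

  \<^item> Add a letter conjugating \<open>dih i j\<close> to each malnormal infinite dihedral group, one for every
    conjugacy class. All pairs of distinct involutions of the old group become conjugate.

  The union of a chain of groups obtained by repeating these steps countably often has all the
  properties required, and its cardinality does not exceed that of the infinite group \<open>G\<close>.

  The class is preserved because of the action on the Bass-Serre tree. Two involutions have a common
  fixed vertex, or preserve a common edge, or their product translates along an axis
  (\<open>involutions_trichotomy\<close>). In the first case the pair is conjugate into the old group, in the
  second it lies in an edge stabiliser extended by an inversion, and in the third case the elements
  virtually commuting with the product up to inversion form a malnormal infinite dihedral group
  (\<open>hyperbolic_pair_in_malnormal_dih\<close>).
\<close>

section \<open>Groups as a type class\<close>

text \<open>Subgroups are sets in a type of this class. Products and inverses then simplify without side
  conditions about carriers, and groups of different origin live in different types.\<close>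

class grp = monoid_mult + inverse +
  assumes grp_left_inverse: "inverse x * x = 1"
begin

lemma grp_cancel_left [simp]: "inverse x * (x * y) = y"
  by (simp add: mult.assoc[symmetric] grp_left_inverse)

lemma grp_right_inverse: "x * inverse x = 1"
  by (metis grp_cancel_left grp_left_inverse mult_1_right)

lemma grp_cancel_right [simp]: "x * (inverse x * y) = y"
  by (simp add: mult.assoc[symmetric] grp_right_inverse)

lemma grp_left_cancel [simp]: "x * y = x * z \<longleftrightarrow> y = z"
  by (metis grp_cancel_left)

lemma grp_right_cancel [simp]: "y * x = z * x \<longleftrightarrow> y = z"
  by (metis grp_right_inverse mult.assoc mult_1_right)

lemma grp_inverse_unique: "x * y = 1 \<Longrightarrow> inverse x = y"
  by (metis grp_cancel_left mult_1_right)

lemma grp_inverse_inverse [simp]: "inverse (inverse x) = x"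
  by (simp add: grp_inverse_unique grp_left_inverse)

lemma grp_inverse_one [simp]: "inverse 1 = 1"
  by (simp add: grp_inverse_unique)

lemma grp_inverse_mult: "inverse (x * y) = inverse y * inverse x"
  by (rule grp_inverse_unique) (simp add: mult.assoc grp_right_inverse)

lemma grp_inverse_eq_iff [simp]: "inverse x = inverse y \<longleftrightarrow> x = y"
  by (metis grp_inverse_inverse)

lemma grp_inverse_eq_one [simp]: "inverse x = 1 \<longleftrightarrow> x = 1"
  by (metis grp_inverse_inverse grp_inverse_one)

lemma grp_eq_iff: "x = y \<longleftrightarrow> inverse x * y = 1"
  by (metis grp_cancel_right grp_left_inverse mult_1_right)

end

lemmas grp_simps = mult.assoc grp_inverse_mult grp_left_inverse grp_right_inverse

lemma inverse_power: "inverse (x ^ n) = inverse x ^ n" for x :: "'g::grp"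
proof (induction n)
  case (Suc n)
  then show ?case
    by (metis grp_inverse_mult power_Suc power_Suc2)
qed simp

lemma powi_of_nat: "x powi int n = x ^ n" for x :: "'g::grp"
  by (simp add: power_int_def)

lemma powi_minus_of_nat: "x powi (- int n) = inverse x ^ n" for x :: "'g::grp"
  by (cases "n = 0") (auto simp: power_int_def)

lemma powi_0 [simp]: "x powi 0 = 1" for x :: "'g::grp"
  by (simp add: power_int_def)

lemma powi_1 [simp]: "x powi 1 = x" for x :: "'g::grp"
  by (simp add: power_int_def)

lemma powi_succ: "x powi (k + 1) = x powi k * x" for x :: "'g::grp"
proof (cases k rule: int_cases2)
  case (nonneg n)
  then show ?thesis
    using powi_of_nat[of x "Suc n"] powi_of_nat[of x n] by (simp add: power_Suc2 add.commute del: power_Suc)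
next
  case (nonpos n)
  show ?thesis
  proof (cases n)
    case 0
    with nonpos show ?thesis by simp
  next
    case (Suc m)
    have "x powi (k + 1) = inverse x ^ m"
      using nonpos Suc powi_minus_of_nat[of x m] by simp
    moreover have "x powi k = inverse x ^ m * inverse x"
      using nonpos Suc powi_minus_of_nat[of x n] by (simp add: power_Suc2 del: power_Suc)
    ultimately show ?thesis
      by (simp add: grp_simps)
  qed
qed

lemma powi_pred: "x powi (k - 1) = x powi k * inverse x" for x :: "'g::grp"
  using powi_succ[of x "k - 1"] by (simp add: grp_simps)

lemma powi_add: "x powi (k + l) = x powi k * x powi l" for x :: "'g::grp"
proof (induction l rule: int_induct[of _ 0])
  case (step1 i)
  then show ?case
    using powi_succ[of x "k + i"] by (simp add: powi_succ add.assoc[symmetric] mult.assoc)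
next
  case (step2 i)
  have "x powi (k + (i - 1)) = x powi (k + i - 1)"
    by (simp add: algebra_simps)
  then show ?case
    using step2 by (simp add: powi_pred mult.assoc)
qed simp

lemma powi_minus: "x powi (- k) = inverse (x powi k)" for x :: "'g::grp"
  by (metis add.right_inverse grp_inverse_unique powi_0 powi_add)

lemma powi_diff: "x powi (k - l) = x powi k * inverse (x powi l)" for x :: "'g::grp"
  using powi_add[of x k "- l"] by (simp add: powi_minus)

lemma powi_commute: "x powi k * x powi l = x powi l * x powi k" for x :: "'g::grp"
  by (metis add.commute powi_add)

lemma powi_mult: "(x powi k) powi l = x powi (k * l)" for x :: "'g::grp"
proof (induction l rule: int_induct[of _ 0])
  case (step1 i)
  then show ?case by (simp add: powi_succ powi_add distrib_left)
next
  case (step2 i)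
  then show ?case by (simp add: powi_pred powi_diff right_diff_distrib)
qed simp

lemma powi_conj: "(g * x * inverse g) powi k = g * x powi k * inverse g" for x g :: "'g::grp"
proof (induction k rule: int_induct[of _ 0])
  case (step1 i)
  then show ?case by (simp add: powi_succ grp_simps)
next
  case (step2 i)
  then show ?case by (simp add: powi_pred grp_simps)
qed (simp add: grp_simps)

lemma one_powi [simp]: "1 powi k = (1 :: 'g::grp)"
proof (induction k rule: int_induct[of _ 0])
  case (step1 i)
  then show ?case by (simp add: powi_succ)
next
  case (step2 i)
  then show ?case by (simp add: powi_pred)
qed simp

lemma inverse_powi: "inverse x powi k = x powi (- k)" for x :: "'g::grp"
proof (induction k rule: int_induct[of _ 0])
  case (step1 i)
  then show ?case using powi_pred[of x "- i"] by (simp add: powi_succ)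
next
  case (step2 i)
  then show ?case using powi_succ[of x "- i"] by (simp add: powi_pred)
qed simp

lemma commute_powi:
  fixes x y :: "'g::grp"
  assumes "x * y = y * x"
  shows "x * y powi k = y powi k * x"
proof -
  have "x * y * inverse x = y"
    using assms by (simp add: grp_simps)
  then have "x * y powi k * inverse x = y powi k"
    using powi_conj[of x y k] by simp
  then show ?thesis
    by (metis grp_cancel_left grp_cancel_right grp_inverse_inverse mult.assoc mult_1_right grp_right_inverse)
qed


definition subgrp :: "'g::grp set \<Rightarrow> bool" where
  "subgrp S \<longleftrightarrow> 1 \<in> S \<and> (\<forall>x\<in>S. \<forall>y\<in>S. x * y \<in> S) \<and> (\<forall>x\<in>S. inverse x \<in> S)"

lemma subgrpD [simp]:
  assumes "subgrp S"
  shows subgrp_one: "1 \<in> S"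
    and subgrp_mult: "x \<in> S \<Longrightarrow> y \<in> S \<Longrightarrow> x * y \<in> S"
    and subgrp_inverse: "x \<in> S \<Longrightarrow> inverse x \<in> S"
  using assms by (auto simp: subgrp_def)

lemma subgrp_mult_right_iff: "subgrp S \<Longrightarrow> b \<in> S \<Longrightarrow> g * b \<in> S \<longleftrightarrow> g \<in> S"
  using subgrp_mult[of S "g * b" "inverse b"] by (auto simp: grp_simps)

lemma subgrp_mult_left_iff: "subgrp S \<Longrightarrow> b \<in> S \<Longrightarrow> b * g \<in> S \<longleftrightarrow> g \<in> S"
  using subgrp_mult[of S "inverse b" "b * g"] by (auto simp: grp_simps)

lemma subgrp_power [simp]: "subgrp S \<Longrightarrow> x \<in> S \<Longrightarrow> x ^ n \<in> S"
  by (induction n) auto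

lemma subgrp_powi [simp]: "subgrp S \<Longrightarrow> x \<in> S \<Longrightarrow> x powi k \<in> S"
  by (simp add: power_int_def)

definition gen :: "'g::grp set \<Rightarrow> 'g set" where
  "gen A = \<Inter>{S. subgrp S \<and> A \<subseteq> S}"

lemma subgrp_gen [simp]: "subgrp (gen A)"
  unfolding gen_def subgrp_def by blast

lemma gen_superset: "A \<subseteq> gen A"
  by (auto simp: gen_def)

lemma gen_least: "subgrp S \<Longrightarrow> A \<subseteq> S \<Longrightarrow> gen A \<subseteq> S"
  by (auto simp: gen_def)

definition hom_on :: "'g::grp set \<Rightarrow> ('g \<Rightarrow> 'h::grp) \<Rightarrow> bool" where
  "hom_on S f \<longleftrightarrow> (\<forall>x\<in>S. \<forall>y\<in>S. f (x * y) = f x * f y)"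

lemma hom_on_mult: "hom_on S f \<Longrightarrow> x \<in> S \<Longrightarrow> y \<in> S \<Longrightarrow> f (x * y) = f x * f y"
  by (simp add: hom_on_def)

lemma hom_on_one: "hom_on S f \<Longrightarrow> subgrp S \<Longrightarrow> f 1 = 1"
  using hom_on_mult[of S f 1 1] grp_left_cancel[of "f 1" "f 1" 1] by simp

lemma hom_on_inverse: "hom_on S f \<Longrightarrow> subgrp S \<Longrightarrow> x \<in> S \<Longrightarrow> f (inverse x) = inverse (f x)"
  using hom_on_mult[of S f x "inverse x"] hom_on_one[of S f] grp_inverse_unique[of "f x" "f (inverse x)"]
  by (simp add: grp_right_inverse)

lemma hom_on_power: "hom_on S f \<Longrightarrow> subgrp S \<Longrightarrow> x \<in> S \<Longrightarrow> f (x ^ n) = f x ^ n"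
  by (induction n) (simp_all add: hom_on_one hom_on_mult)

lemma hom_on_powi: "hom_on S f \<Longrightarrow> subgrp S \<Longrightarrow> x \<in> S \<Longrightarrow> f (x powi k) = f x powi k"
  by (simp add: power_int_def hom_on_power hom_on_inverse)

lemma subgrp_image: "hom_on S f \<Longrightarrow> subgrp S \<Longrightarrow> subgrp (f ` S)"
proof -
  assume f: "hom_on S f" and S: "subgrp S"
  show ?thesis
    unfolding subgrp_def
  proof (intro conjI ballI)
    show "1 \<in> f ` S"
      using hom_on_one[OF f S] S by (metis imageI subgrp_one)
    fix x assume "x \<in> f ` S"
    then obtain a where a: "a \<in> S" "x = f a" by blast
    then show "inverse x \<in> f ` S"
      using hom_on_inverse[OF f S a(1)] S by (metis imageI subgrp_inverse)
    fix y assume "y \<in> f ` S"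
    then obtain b where b: "b \<in> S" "y = f b" by blast
    then show "x * y \<in> f ` S"
      using a hom_on_mult[OF f a(1) b(1)] S by (metis imageI subgrp_mult)
  qed
qed

section \<open>Involutions and dihedral groups\<close>

definition Invs :: "'g::grp set \<Rightarrow> 'g set" where
  "Invs S = {r \<in> S. r \<noteq> 1 \<and> r * r = 1}"

definition inf_ord :: "'g::grp \<Rightarrow> bool" where
  "inf_ord x \<longleftrightarrow> (\<forall>n>0. x ^ n \<noteq> 1)"

lemma inf_ord_powi_eq_one:
  assumes "inf_ord x"
  shows "x powi k = 1 \<longleftrightarrow> k = 0"
proof -
  have "k = 0" if k: "x powi k = 1"
  proof (rule ccontr)
    assume "k \<noteq> 0"
    then have n: "nat \<bar>k\<bar> > 0" by simp
    have "x powi \<bar>k\<bar> = 1"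
      using k by (cases "k \<ge> 0") (auto simp: powi_minus)
    then have "x ^ nat \<bar>k\<bar> = 1"
      using powi_of_nat[of x "nat \<bar>k\<bar>"] by simp
    with assms n show False by (auto simp: inf_ord_def)
  qed
  then show ?thesis by auto
qed

lemma inf_ord_powi_inj:
  assumes "inf_ord x"
  shows "x powi k = x powi l \<longleftrightarrow> k = l"
proof -
  have "x powi k = x powi l \<longleftrightarrow> x powi (k - l) = 1"
    by (metis diff_add_cancel grp_right_cancel mult_1_left powi_add)
  then show ?thesis
    using inf_ord_powi_eq_one[OF assms] by simp
qed

lemma inf_ord_powi: "inf_ord x \<Longrightarrow> k \<noteq> 0 \<Longrightarrow> inf_ord (x powi k)"
proof -
  assume "inf_ord x" "k \<noteq> 0"
  then have "x powi (k * int n) \<noteq> 1" if "n > 0" for n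
    using that by (simp add: inf_ord_powi_eq_one)
  then show ?thesis
    by (simp only: inf_ord_def powi_of_nat[symmetric] powi_mult) blast
qed

lemma inf_ord_ne: "inf_ord x \<Longrightarrow> x \<noteq> 1" "inf_ord x \<Longrightarrow> x * x \<noteq> 1"
proof -
  show "inf_ord x \<Longrightarrow> x \<noteq> 1" by (auto simp: inf_ord_def)
  show "inf_ord x \<Longrightarrow> x * x \<noteq> 1" by (metis inf_ord_def power2_eq_square zero_less_numeral)
qed

lemma inf_ord_conj: "inf_ord (g * x * inverse g) \<longleftrightarrow> inf_ord x"
proof -
  have "(g * x * inverse g) ^ n = g * x ^ n * inverse g" for n
    by (metis powi_conj powi_of_nat)
  moreover have "g * y * inverse g = 1 \<longleftrightarrow> y = 1" for y
    by (metis grp_cancel_left grp_cancel_right grp_right_inverse mult.assoc mult_1_right)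
  ultimately show ?thesis by (simp add: inf_ord_def)
qed

lemma InvsD:
  assumes "r \<in> Invs S"
  shows "r \<in> S" "r \<noteq> 1" "r * r = 1" "inverse r = r" "r * (r * x) = x"
proof -
  show r: "r \<in> S" "r \<noteq> 1" "r * r = 1"
    using assms by (simp_all add: Invs_def)
  show "inverse r = r" by (rule grp_inverse_unique[OF r(3)])
  show "r * (r * x) = x" by (metis r(3) mult.assoc mult_1_left)
qed

lemma conj_eq_one: "g * x * inverse g = 1 \<longleftrightarrow> x = 1" for g :: "'g::grp"
  by (metis grp_cancel_left grp_cancel_right grp_right_inverse mult.assoc mult_1_right)

lemma conj_mult: "g * x * inverse g * (g * y * inverse g) = g * (x * y) * inverse g" for g :: "'g::grp"
  by (simp add: grp_simps)

lemma Invs_conj: "subgrp S \<Longrightarrow> g \<in> S \<Longrightarrow> r \<in> Invs S \<Longrightarrow> g * r * inverse g \<in> Invs S"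
  by (simp add: Invs_def conj_mult conj_eq_one grp_right_inverse)

text \<open>For involutions \<open>r\<close> and \<open>s\<close> this is the group generated by them:
  the powers of the rotation \<open>r s\<close>, followed by the reflections.\<close>

definition dih :: "'g::grp \<Rightarrow> 'g \<Rightarrow> 'g set" where
  "dih r s = range (\<lambda>k. (r * s) powi k) \<union> range (\<lambda>k. (r * s) powi k * r)"

lemma dihI [simp]: "(r * s) powi k \<in> dih r s" "(r * s) powi k * r \<in> dih r s"
  by (auto simp: dih_def)

lemma dihE:
  assumes "x \<in> dih r s"
  obtains k where "x = (r * s) powi k" | k where "x = (r * s) powi k * r"
  using assms by (auto simp: dih_def)

text \<open>A reflection inverts every rotation.\<close>

lemma dihedral_flip:
  fixes p r :: "'g::grp"
  assumes "r * r = 1" "r * p * r = inverse p"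
  shows "r * p powi k = p powi (- k) * r"
proof -
  have ir: "inverse r = r" using assms(1) by (rule grp_inverse_unique)
  have "r * p powi k * r = p powi (- k)"
    using powi_conj[of r p k] assms(2) by (simp add: ir inverse_powi)
  then show ?thesis
    by (metis assms(1) mult.assoc mult_1_right)
qed

context
  fixes r s :: "'g::grp"
  assumes r: "r * r = 1" and s: "s * s = 1"
begin

lemma rot_flip: "r * (r * s) * r = inverse (r * s)"
  by (metis grp_inverse_mult grp_inverse_unique mult.assoc mult_1_left r s)

lemma flip_powi: "r * (r * s) powi k = (r * s) powi (- k) * r"
  by (rule dihedral_flip[OF r rot_flip])

lemma dih_mult:
  shows "(r * s) powi k * ((r * s) powi l * r) = (r * s) powi (k + l) * r"
    and "(r * s) powi k * r * (r * s) powi l = (r * s) powi (k - l) * r"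
    and "(r * s) powi k * r * ((r * s) powi l * r) = (r * s) powi (k - l)"
proof -
  let ?p = "r * s"
  show 1: "?p powi k * (?p powi l * r) = ?p powi (k + l) * r" for k l
    by (simp only: powi_add mult.assoc)
  show 2: "?p powi k * r * ?p powi l = ?p powi (k - l) * r"
  proof -
    have "?p powi k * r * ?p powi l = ?p powi k * (r * ?p powi l)" by (simp only: mult.assoc)
    also have "\<dots> = ?p powi k * (?p powi (- l) * r)" by (simp only: flip_powi)
    finally show ?thesis by (simp only: 1) simp
  qed
  have "?p powi k * r * (?p powi l * r) = ?p powi k * r * ?p powi l * r" by (simp only: mult.assoc)
  also have "\<dots> = ?p powi (k - l) * (r * r)" by (simp only: 2) (simp only: mult.assoc)
  finally show "?p powi k * r * (?p powi l * r) = ?p powi (k - l)" by (simp add: r)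
qed

lemma subgrp_dih: "subgrp (dih r s)"
  unfolding subgrp_def
proof (intro conjI ballI)
  show "1 \<in> dih r s" using dihI(1)[of r s 0] by simp
  fix x assume x: "x \<in> dih r s"
  show "inverse x \<in> dih r s"
  proof (rule dihE[OF x])
    fix k assume "x = (r * s) powi k"
    then show ?thesis by (metis dihI(1) powi_minus)
  next
    fix k assume "x = (r * s) powi k * r"
    then have "inverse x = x"
      using dih_mult(3)[of k k] grp_inverse_unique[of x x] by simp
    then show ?thesis using x by simp
  qed
  fix y assume y: "y \<in> dih r s"
  show "x * y \<in> dih r s"
    by (rule dihE[OF x]; rule dihE[OF y]; hypsubst)
      (simp_all only: dih_mult dihI powi_add[symmetric])
qed

lemma dih_gens: "r \<in> dih r s" "s \<in> dih r s"
proof -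
  show "r \<in> dih r s" using dihI(2)[of r s 0] by simp
  have "s = r * (r * s) powi 1" by (metis powi_1 mult.assoc mult_1_left r)
  then show "s \<in> dih r s" by (metis dihI(2) flip_powi)
qed

lemma dih_least:
  assumes "subgrp S" "r \<in> S" "s \<in> S"
  shows "dih r s \<subseteq> S"
  using assms by (auto elim!: dihE)

lemma dih_reflection_square: "(r * s) powi k * r * ((r * s) powi k * r) = 1"
  by (simp add: dih_mult)

text \<open>Reflections have order two, so an element of infinite order is a rotation.\<close>

lemma dih_inf_ordE:
  assumes "x \<in> dih r s" "inf_ord x"
  obtains k where "k \<noteq> 0" "x = (r * s) powi k"
  using assms(1)
proof (rule dihE)
  fix k assume x: "x = (r * s) powi k"
  then have "k \<noteq> 0" using inf_ord_ne(1)[OF assms(2)] by auto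
  then show thesis using x that by blast
next
  fix k assume "x = (r * s) powi k * r"
  then show thesis
    using dih_reflection_square[of k] inf_ord_ne(2)[OF assms(2)] by simp
qed

text \<open>Rotations commute with each other and reflections invert them.\<close>

lemma dih_conj_inf_ord:
  assumes "x \<in> dih r s" "inf_ord x" "y \<in> dih r s"
  shows "y * x * inverse y = x \<or> y * x * inverse y = inverse x"
proof -
  obtain k where k: "x = (r * s) powi k" using dih_inf_ordE assms by metis
  show ?thesis
  proof (rule dihE[OF assms(3)])
    fix l assume "y = (r * s) powi l"
    then have "y * x * inverse y = x"
      by (simp add: k powi_commute[of _ l k]) (simp add: mult.assoc grp_right_inverse)
    then show ?thesis ..
  next
    fix l assume y: "y = (r * s) powi l * r"
    have "y * x * inverse y = (r * s) powi l * (r * (r * s) powi k) * inverse y"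
      by (simp add: y k mult.assoc)
    also have "\<dots> = (r * s) powi (-k) * ((r * s) powi l * r) * inverse y"
      by (metis flip_powi mult.assoc powi_commute)
    also have "\<dots> = inverse x"
      by (simp add: y[symmetric] k powi_minus) (simp add: mult.assoc grp_right_inverse)
    finally show ?thesis ..
  qed
qed

end

text \<open>The isomorphism of infinite dihedral groups that sends \<open>r\<close> to \<open>r'\<close>
  and \<open>s\<close> to \<open>s'\<close>. It is read off the normal form of an element, which is
  unique if \<open>r s\<close> has infinite order.\<close>

definition dih_map :: "'g::grp \<Rightarrow> 'g \<Rightarrow> 'g \<Rightarrow> 'g \<Rightarrow> 'g \<Rightarrow> 'g" where
  "dih_map r s r' s' x =
    (if \<exists>k. x = (r * s) powi k then (r' * s') powi (THE k. x = (r * s) powi k)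
     else (r' * s') powi (THE k. x = (r * s) powi k * r) * r')"

lemma dih_map_simps:
  assumes "r * r = 1" "r \<noteq> 1" "inf_ord (r * s)"
  shows "dih_map r s r' s' ((r * s) powi k) = (r' * s') powi k"
    and "dih_map r s r' s' ((r * s) powi k * r) = (r' * s') powi k * r'"
proof -
  have ne: "(r * s) powi k * r \<noteq> (r * s) powi l" for k l
  proof
    assume "(r * s) powi k * r = (r * s) powi l"
    then have r: "r = (r * s) powi (l - k)"
      by (metis add_uminus_conv_diff add.commute grp_cancel_left powi_add powi_minus)
    then have "(r * s) powi (l - k + (l - k)) = 1" using assms(1) by (metis powi_add)
    then have "l - k = 0" using inf_ord_powi_eq_one[OF assms(3)] by simp
    then have "r = 1" using r by simp
    then show False using assms(2) by blast
  qed
  show "dih_map r s r' s' ((r * s) powi k) = (r' * s') powi k"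
    by (auto simp: dih_map_def inf_ord_powi_inj[OF assms(3)])
  show "dih_map r s r' s' ((r * s) powi k * r) = (r' * s') powi k * r'"
    by (auto simp: dih_map_def ne inf_ord_powi_inj[OF assms(3)])
qed

lemma dih_map_props:
  assumes rs: "r * r = 1" "s * s = 1" "r \<noteq> 1" "inf_ord (r * s)"
    and rs': "r' * r' = 1" "s' * s' = 1" "r' \<noteq> 1" "inf_ord (r' * s')"
  shows "hom_on (dih r s) (dih_map r s r' s')"
    and "x \<in> dih r s \<Longrightarrow> dih_map r s r' s' x \<in> dih r' s'"
    and "x \<in> dih r s \<Longrightarrow> dih_map r' s' r s (dih_map r s r' s' x) = x"
proof -
  note f = dih_map_simps[OF rs(1,3,4), of r' s'] and g = dih_map_simps[OF rs'(1,3,4), of r s]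
  note m = dih_mult[OF rs(1,2)] dih_mult[OF rs'(1,2)] powi_add[symmetric]
  show "hom_on (dih r s) (dih_map r s r' s')"
    unfolding hom_on_def
    by (intro ballI; elim dihE; hypsubst) (simp_all only: m f)
  show "x \<in> dih r s \<Longrightarrow> dih_map r s r' s' x \<in> dih r' s'"
    by (elim dihE; hypsubst) (simp_all only: f dihI)
  show "x \<in> dih r s \<Longrightarrow> dih_map r' s' r s (dih_map r s r' s' x) = x"
    by (elim dihE; hypsubst) (simp_all only: f g)
qed

text \<open>Malnormality is asked for elements of infinite order only: distinct conjugates of a dihedral
  group may share a reflection.\<close>

definition malnormal_in :: "'g::grp set \<Rightarrow> 'g set \<Rightarrow> bool" where
  "malnormal_in S D \<longleftrightarrow> (\<forall>x\<in>S. \<forall>y\<in>D. inf_ord y \<longrightarrow> x * y * inverse x \<in> D \<longrightarrow> x \<in> D)"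

lemma dih_conj: "dih (g * r * inverse g) (g * s * inverse g) = (\<lambda>x. g * x * inverse g) ` dih r s"
proof -
  have e: "g * r * inverse g * (g * s * inverse g) = g * (r * s) * inverse g"
    by (simp add: grp_simps)
  show ?thesis
    unfolding dih_def e powi_conj image_Un image_image
    by (simp add: grp_simps)
qed

lemma malnormal_conj:
  assumes "subgrp S" "g \<in> S" "malnormal_in S D"
  shows "malnormal_in S ((\<lambda>x. g * x * inverse g) ` D)"
  unfolding malnormal_in_def
proof (intro ballI impI)
  fix x y assume x: "x \<in> S" and y: "y \<in> (\<lambda>x. g * x * inverse g) ` D" "inf_ord y"
    and xy: "x * y * inverse x \<in> (\<lambda>x. g * x * inverse g) ` D"
  obtain y' where y': "y' \<in> D" "y = g * y' * inverse g" using y by blast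
  have i: "inf_ord y'" using y y' inf_ord_conj by auto
  define x' where "x' = inverse g * x * g"
  have x'S: "x' \<in> S" using assms(1,2) x by (simp add: x'_def)
  obtain z where z: "z \<in> D" "x * y * inverse x = g * z * inverse g" using xy by blast
  have "z = inverse g * (g * z * inverse g) * g" by (simp add: grp_simps)
  also have "\<dots> = x' * y' * inverse x'" unfolding z(2)[symmetric] by (simp add: y' x'_def grp_simps)
  finally have "x' * y' * inverse x' \<in> D" using z by simp
  then have "x' \<in> D"
    using assms(3)[unfolded malnormal_in_def, rule_format, of x' y'] y'(1) i x'S by blast
  then show "x \<in> (\<lambda>x. g * x * inverse g) ` D"
    by (intro image_eqI[of _ _ x']) (simp_all add: x'_def grp_simps)
qed

section \<open>Groups acting on trees\<close>

text \<open>The elements of \<open>H\<close> stand for the vertices of a tree, where elements of the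
  same coset of \<open>G\<close> stand for the same vertex and \<open>d\<close> is the distance. So
  \<open>d\<close> is only a pseudometric, but no cosets have to be handled: \<open>y\<close> fixes the
  vertex \<open>x\<close> if \<open>d x (y * x) = 0\<close>. The four-point inequality
  characterises subspaces of trees. With \<open>parity\<close> and \<open>step\<close> it says that
  \<open>d\<close> is the path distance on the vertices of a simplicial tree.\<close>

locale tree_group =
  fixes H G :: "'g::grp set" and d :: "'g \<Rightarrow> 'g \<Rightarrow> int"
  assumes H [simp]: "subgrp H" and G [simp]: "subgrp G" and GH: "G \<subseteq> H"
    and d_nonneg: "x \<in> H \<Longrightarrow> y \<in> H \<Longrightarrow> 0 \<le> d x y"
    and d_sym: "x \<in> H \<Longrightarrow> y \<in> H \<Longrightarrow> d x y = d y x"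
    and d_left: "h \<in> H \<Longrightarrow> x \<in> H \<Longrightarrow> y \<in> H \<Longrightarrow> d (h * x) (h * y) = d x y"
    and d_zero: "x \<in> H \<Longrightarrow> y \<in> H \<Longrightarrow> d x y = 0 \<longleftrightarrow> inverse x * y \<in> G"
    and four: "\<lbrakk>x \<in> H; y \<in> H; z \<in> H; w \<in> H\<rbrakk>
      \<Longrightarrow> d x y + d z w \<le> max (d x z + d y w) (d x w + d y z)"
    and parity: "\<lbrakk>x \<in> H; y \<in> H; z \<in> H\<rbrakk> \<Longrightarrow> even (d x y + d y z + d x z)"
    and step: "x \<in> H \<Longrightarrow> y \<in> H \<Longrightarrow> d x y > 0 \<Longrightarrow> \<exists>z\<in>H. d x z = 1 \<and> d z y = d x y - 1"
begin

lemma G_in_H [simp]: "x \<in> G \<Longrightarrow> x \<in> H"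
  using GH by blast

lemma d_refl [simp]: "x \<in> H \<Longrightarrow> d x x = 0"
  by (simp add: d_zero grp_left_inverse)

lemma triangle: "x \<in> H \<Longrightarrow> y \<in> H \<Longrightarrow> z \<in> H \<Longrightarrow> d x z \<le> d x y + d y z"
  using four[of x z y y] d_sym[of z y] by simp

lemma d_left_inverse: "h \<in> H \<Longrightarrow> x \<in> H \<Longrightarrow> y \<in> H \<Longrightarrow> d (h * x) y = d x (inverse h * y)"
  using d_left[of h x "inverse h * y"] by simp

lemma d_zero_eq:
  assumes "x \<in> H" "y \<in> H" "z \<in> H" "d x y = 0"
  shows "d x z = d y z" "d z x = d z y"
  using triangle[of x y z] triangle[of y x z] d_sym[of x y] d_sym[of x z] d_sym[of y z] assms by auto

text \<open>In a tree, two points at the same distance from \<open>a\<close> on geodesics from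
  \<open>a\<close> to \<open>b\<close> coincide.\<close>

lemma same_position:
  assumes "a \<in> H" "b \<in> H" "y \<in> H" "z \<in> H"
    and "d a y + d y b = d a b" "d a z + d z b = d a b" "d a y = d a z"
  shows "d y z = 0"
  using four[of y z a b] assms d_sym[of a y] d_sym[of a z] d_sym[of y b] d_sym[of z b] d_nonneg[of y z]
  by auto

text \<open>If \<open>y\<close> fixes \<open>a\<close> and \<open>b\<close>, then \<open>z\<close> and
  \<open>y z\<close> have the same position between them.\<close>

lemma fixes_geodesic:
  assumes "y \<in> H" "a \<in> H" "b \<in> H" "z \<in> H"
    and "d a (y * a) = 0" "d b (y * b) = 0" "d a z + d z b = d a b"
  shows "d z (y * z) = 0"
proof (rule same_position[of a b])
  have "d a (y * z) = d a z"
    using d_zero_eq(1)[of a "y * a" "y * z"] d_left[of y a z] assms by simp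
  moreover have "d (y * z) b = d z b"
    using d_zero_eq(2)[of b "y * b" "y * z"] d_left[of y z b] assms by simp
  ultimately show "d a z = d a (y * z)" "d a (y * z) + d (y * z) b = d a b"
    using assms by simp_all
qed (use assms in simp_all)

text \<open>The element \<open>p\<close> is hyperbolic with translation length \<open>L\<close>, and
  \<open>v\<close> lies on its axis: going from \<open>v\<close> to \<open>p v\<close> and on to
  \<open>p (p v)\<close> does not backtrack.\<close>

definition hyp :: "'g \<Rightarrow> 'g \<Rightarrow> int \<Rightarrow> bool" where
  "hyp p v L \<longleftrightarrow> p \<in> H \<and> v \<in> H \<and> L \<ge> 1 \<and> d v (p * v) = L \<and> d v (p * (p * v)) = 2 * L"

text \<open>A path in a tree that does not backtrack locally is a geodesic, so absence of backtracking
  at \<open>p v\<close> is inherited by all further powers. The four-point inequality for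
  \<open>v\<close> and three consecutive points of the orbit gives the induction step.\<close>

lemma hyp_power:
  assumes "hyp p v L"
  shows "d v (p ^ n * v) = int n * L \<and> d v (p ^ Suc n * v) = int (Suc n) * L"
proof (induction n)
  case 0
  then show ?case using assms by (simp add: hyp_def)
next
  case (Suc n)
  have h: "p \<in> H" "v \<in> H" "L \<ge> 1" "d v (p * v) = L" "d v (p * (p * v)) = 2 * L"
    using assms by (auto simp: hyp_def)
  have e: "p ^ Suc n * v = p ^ n * (p * v)" "p ^ Suc (Suc n) * v = p ^ n * (p * (p * v))"
    "p ^ Suc (Suc n) * v = p ^ Suc n * (p * v)"
    by (simp_all only: power_Suc2 mult.assoc)
  have 1: "d (p ^ n * v) (p ^ Suc (Suc n) * v) = 2 * L"
    unfolding e(2) using d_left[of "p ^ n" v "p * (p * v)"] h by simp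
  have 2: "d (p ^ Suc n * v) (p ^ Suc (Suc n) * v) = L"
    unfolding e(3) using d_left[of "p ^ Suc n" v "p * v"] h by simp
  have 3: "d (p ^ Suc n * v) (p ^ n * v) = L"
    unfolding e(1) using d_left[of "p ^ n" "p * v" v] d_sym[of v "p * v"] h by simp
  have m: "p ^ k * v \<in> H" for k using h by simp
  have "d v (p ^ Suc (Suc n) * v) \<ge> int (Suc n) * L + L"
    using four[OF h(2) m[of "Suc n"] m[of n] m[of "Suc (Suc n)"]] 1 2 3 Suc h(3)
    by (auto simp: algebra_simps max_def split: if_splits)
  moreover have "d v (p ^ Suc (Suc n) * v) \<le> int (Suc n) * L + L"
    using triangle[OF h(2) m[of "Suc n"] m[of "Suc (Suc n)"]] 2 Suc by linarith
  ultimately show ?case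
    using Suc by (simp add: algebra_simps)
qed

lemma hyp_dist:
  assumes "hyp p v L"
  shows "d (p powi k * v) (p powi l * v) = \<bar>k - l\<bar> * L"
proof -
  have h: "p \<in> H" "v \<in> H" using assms by (auto simp: hyp_def)
  have *: "d (p powi k * v) (p powi l * v) = (l - k) * L" if "k \<le> l" for k l
  proof -
    have "p powi l * v = p powi k * (p ^ nat (l - k) * v)"
      using powi_add[of p k "l - k"] powi_of_nat[of p "nat (l - k)"] that by (simp add: mult.assoc)
    then show ?thesis
      using d_left[of "p powi k" v "p ^ nat (l - k) * v"] hyp_power[OF assms, of "nat (l - k)"] that h
      by simp
  qed
  show ?thesis
    using *[of k l] *[of l k] d_sym[of "p powi k * v" "p powi l * v"] h by (cases "k \<le> l") auto
qed

lemma hyp_inf_ord: "hyp p v L \<Longrightarrow> inf_ord p"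
  using hyp_power[of p v L] by (auto simp: inf_ord_def hyp_def) (metis (no_types) d_refl mult_1_left mult_eq_0_iff of_nat_0_eq_iff less_irrefl not_one_le_zero)

lemma hyp_inverse: "hyp p v L \<Longrightarrow> hyp (inverse p) v L"
  using hyp_dist[of p v L 0 "-1"] hyp_dist[of p v L 0 "-2"] powi_minus[of p 1] powi_minus[of p 2] powi_succ[of p 1]
  by (auto simp: hyp_def grp_simps)

text \<open>The element may swap the two ends. This occurs for letters that are involutions: they invert
  an edge without fixing any vertex of it.\<close>

definition preserves_edge :: "'g \<Rightarrow> 'g \<Rightarrow> 'g \<Rightarrow> bool" where
  "preserves_edge r x y \<longleftrightarrow> d x (r * x) = 0 \<and> d y (r * y) = 0 \<or> d x (r * y) = 0 \<and> d y (r * x) = 0"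

text \<open>The next lemmas compare the segments from a vertex \<open>x\<close> to its images under two
  involutions. An involution fixes the midpoint of such a segment. Moving \<open>x\<close> one step
  along it hence shortens it by two, unless it is a single inverted edge.\<close>

lemma involutions_step:
  assumes r: "r \<in> H" "r * r = 1" and x: "x \<in> H" and y: "y \<in> H" "d x y = 1" "d y (r * x) = d x (r * x) - 1"
  shows "d y (r * y) \<le> (if d x (r * x) \<ge> 2 then d x (r * x) - 2 else 1)"
proof -
  have rr: "r * (r * z) = z" for z using r by (metis mult.assoc mult_1_left)
  have 1: "d (r * x) (r * y) = 1" using d_left[OF r(1) x y(1)] y by simp
  have 2: "d (r * y) x = d x (r * x) - 1"
    using d_left[of r "r * y" x] y r x by (simp add: rr)
  show ?thesis
    using four[of x "r * x" y "r * y"] 1 2 y r x d_sym[of "r * x" y] d_sym[of "r * y" x] d_nonneg[of y "r * x"]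
    by (auto simp: max_def split: if_splits)
qed

lemma parity_gap: "even (a + b + c) \<Longrightarrow> c < a + b \<Longrightarrow> c \<le> a + b - 2" for a b c :: int
  by presburger

text \<open>If both segments start with the same edge, a step along this edge shortens the longer ones; if
  both segments have length one, they are the same inverted edge.\<close>

lemma involutions_overlap:
  assumes r: "r \<in> H" "r * r = 1" and s: "s \<in> H" "s * s = 1" and x: "x \<in> H"
    and ab: "d x (r * x) \<ge> 1" "d x (s * x) \<ge> 1" "d (r * x) (s * x) < d x (r * x) + d x (s * x)"
  shows "\<exists>y\<in>H. d y (r * y) + d y (s * y) < d x (r * x) + d x (s * x) \<or>
      d x y = 1 \<and> preserves_edge r x y \<and> preserves_edge s x y"
proof -
  have rr: "r * (r * z) = z" "s * (s * z) = z" for z using r s by (metis mult.assoc mult_1_left)+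
  have e: "d (r * x) (s * x) \<le> d x (r * x) + d x (s * x) - 2"
    using parity[of "r * x" x "s * x"] r s x ab(3) d_sym[of x "r * x"] by (intro parity_gap) auto
  obtain y where y: "y \<in> H" "d x y = 1" "d y (r * x) = d x (r * x) - 1"
    using step[of x "r * x"] x r ab by auto
  have ys: "d y (s * x) = d x (s * x) - 1"
    using four[of x "r * x" y "s * x"] triangle[of x y "s * x"] e y x r s
      d_sym[of x "r * x"] d_sym[of y "r * x"] d_sym[of "r * x" "s * x"]
    by (auto simp: max_def split: if_splits)
  note 1 = involutions_step[OF r x y] involutions_step[OF s x y(1,2) ys]
  show ?thesis
  proof (cases "d x (r * x) \<ge> 2 \<or> d x (s * x) \<ge> 2")
    case True
    then show ?thesis using 1 y(1) ab by (intro bexI[of _ y]) (auto split: if_splits)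
  next
    case False
    then have "d y (r * x) = 0" "d y (s * x) = 0" using y ys ab by auto
    moreover have "d x (r * y) = 0" "d x (s * y) = 0"
      using calculation d_left[of r "r * y" x] d_left[of s "s * y" x] r s x y
        d_sym[of x "r * y"] d_sym[of x "s * y"] by (simp_all add: rr)
    ultimately show ?thesis using y by (auto simp: preserves_edge_def)
  qed
qed

text \<open>If the segments only meet in \<open>x\<close>, the segments between
  \<open>s (r x)\<close>, \<open>s x\<close>, \<open>x\<close>, \<open>r x\<close> and
  \<open>r (s x)\<close> form a path without backtracking, which shows that \<open>r s\<close>
  translates by the sum of both displacements.\<close>

lemma involutions_disjoint:
  assumes r: "r \<in> H" "r * r = 1" and s: "s \<in> H" "s * s = 1" and x: "x \<in> H"
    and ab: "d x (r * x) \<ge> 1" "d x (s * x) \<ge> 1" "d (r * x) (s * x) \<ge> d x (r * x) + d x (s * x)"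
  shows "hyp (r * s) x (d x (r * x) + d x (s * x))"
proof -
  have rr: "r * (r * z) = z" "s * (s * z) = z" for z using r s by (metis mult.assoc mult_1_left)+
  define a b where "a = d x (r * x)" and "b = d x (s * x)"
  have m: "r * x \<in> H" "s * x \<in> H" "r * (s * x) \<in> H" "s * (r * x) \<in> H" using r s x by auto
  note S = d_sym[OF x m(1)] d_sym[OF x m(2)] d_sym[OF x m(3)] d_sym[OF x m(4)] d_sym[OF m(1) m(2)]
    d_sym[OF m(1) m(3)] d_sym[OF m(2) m(4)]  d_sym[OF m(2) m(3)]
  have e: "d (r * x) (s * x) = a + b"
    using ab triangle[OF m(1) x m(2)] S unfolding a_def b_def by linarith
  have 1: "d x (r * (s * x)) = a + b" "d (r * x) (r * (s * x)) = b" "d (s * x) (s * (r * x)) = a"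
    "d x (s * (r * x)) = a + b"
    using d_left[of r "r * x" "s * x"] d_left[of r x "s * x"] d_left[of s x "r * x"]
      d_left[of s "s * x" "r * x"] e r s x S
    by (simp_all add: rr a_def b_def)
  have 2: "d (s * x) (r * (s * x)) = a + 2 * b"
    using four[OF m(2) m(1) x m(3)] triangle[OF m(2) x m(3)] 1 e ab S unfolding a_def b_def
    by (auto simp: max_def split: if_splits)
  have 3: "d (s * (r * x)) (r * (s * x)) = 2 * a + 2 * b"
    using four[OF m(4) x m(2) m(3)] triangle[OF m(4) m(2) m(3)] 1 2 e ab S unfolding a_def b_def
    by (auto simp: max_def split: if_splits)
  have "d x (r * (s * (r * (s * x)))) = d (s * (r * x)) (r * (s * x))"
    using d_left[of s "s * x" "r * (s * (r * (s * x)))"] d_left[of r "r * x" "r * (s * (r * (s * x)))"]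
      d_left[of "r * s" "s * (r * x)" "r * (s * x)"] r s x by (simp add: rr mult.assoc)
  then show ?thesis
    using 1 3 ab r s x unfolding hyp_def by (simp add: mult.assoc a_def b_def)
qed

text \<open>If \<open>r\<close> fixes \<open>x\<close>, consider the first edge towards
  \<open>s x\<close>. Either \<open>r\<close> fixes it, and a step along it brings \<open>x\<close>
  closer to its image under \<open>s\<close> unless \<open>s\<close> inverts this edge, or
  \<open>r\<close> moves it, and then the segments from \<open>x\<close> to \<open>s x\<close> and to
  \<open>r (s x)\<close> leave in different directions.\<close>

lemma involutions_one_fixed:
  assumes r: "r \<in> H" "r * r = 1" and s: "s \<in> H" "s * s = 1" and x: "x \<in> H"
    and ab: "d x (r * x) = 0" "d x (s * x) \<ge> 1"
  shows "(\<exists>y\<in>H. d y (r * y) + d y (s * y) < d x (s * x) \<or>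
      d x y = 1 \<and> preserves_edge r x y \<and> preserves_edge s x y) \<or> hyp (r * s) x (d x (s * x))"
proof -
  have rr: "r * (r * z) = z" "s * (s * z) = z" for z using r s by (metis mult.assoc mult_1_left)+
  define b where "b = d x (s * x)"
  obtain y where y: "y \<in> H" "d x y = 1" "d y (s * x) = b - 1"
    using step[of x "s * x"] x s ab by (auto simp: b_def)
  have m: "r * x \<in> H" "s * x \<in> H" "r * (s * x) \<in> H" "s * (r * x) \<in> H" "r * y \<in> H" "s * y \<in> H"
    using r s x y by auto
  have xry: "d x (r * y) = 1"
    using d_zero_eq(1)[OF x m(1) m(5) ab(1)] d_left[of r x y] r x y by simp
  show ?thesis
  proof (cases "d y (r * y) = 0")
    case True
    have st: "d y (s * y) \<le> (if b \<ge> 2 then b - 2 else 1)"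
      using involutions_step[OF s x y(1,2)] y(3) by (auto simp: b_def split: if_splits)
    show ?thesis
    proof (cases "b \<ge> 2")
      case True
      then show ?thesis
        using \<open>d y (r * y) = 0\<close> st y(1) by (intro disjI1 bexI[of _ y]) (auto simp: b_def)
    next
      case False
      then have "d y (s * x) = 0" using y ab by (auto simp: b_def)
      moreover have "d x (s * y) = 0"
        using calculation d_left[of s "s * y" x] s x y d_sym[of x "s * y"] by (simp add: rr)
      ultimately show ?thesis using True y ab(1) by (auto simp: preserves_edge_def)
    qed
  next
    case False
    then have y2: "d y (r * y) \<ge> 2"
      using parity[OF y(1) x m(5)] d_nonneg[OF y(1) m(5)] xry y d_sym[OF x y(1)]
      by (cases "d y (r * y) = 1") auto
    have 1: "d x (r * (s * x)) = b" "d (r * y) (r * (s * x)) = b - 1"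
      using d_zero_eq(1)[OF x m(1) m(3) ab(1)] d_left[of r x "s * x"] d_left[of r y "s * x"] r s x y
      by (simp_all add: b_def)
    have 2: "d (s * x) (r * (s * x)) = 2 * b"
    proof (rule ccontr)
      assume ne: "d (s * x) (r * (s * x)) \<noteq> 2 * b"
      have le: "d (s * x) (r * (s * x)) \<le> b + b - 2"
        using triangle[OF m(2) x m(3)] parity[OF m(2) x m(3)] d_sym[OF x m(2)] 1 ne
        by (intro parity_gap) (auto simp: b_def)
      then have "d y (r * (s * x)) \<le> b - 1"
        using four[OF y(1) m(3) x m(2)] 1 y d_sym[OF x y(1)] d_sym[OF x m(3)] d_sym[OF x m(2)]
          d_sym[OF m(2) m(3)] d_sym[OF y(1) m(2)]
        by (auto simp: max_def b_def split: if_splits)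
      then show False
        using four[OF y(1) m(5) x m(3)] 1 y y2 xry d_sym[OF x y(1)] d_sym[OF x m(5)]
        by (auto simp: max_def split: if_splits)
    qed
    have "d x (r * (s * (r * (s * x)))) = d (s * (r * x)) (r * (s * x))"
      using d_left[of "r * s" "s * (r * x)" "r * (s * x)"] r s x by (simp add: rr mult.assoc)
    also have "\<dots> = d (s * x) (r * (s * x))"
      using d_zero_eq(2)[OF x m(1), of "s * (r * (s * x))"] d_left[of s "r * x" "s * (r * (s * x))"]
        d_left[of s x "s * (r * (s * x))"] d_zero_eq(1)[OF x m(1), of "s * (r * (s * x))"] r s x ab
      by (simp add: rr)
    finally show ?thesis
      using 1 2 ab r s x unfolding hyp_def by (simp add: mult.assoc b_def)
  qed
qed

text \<open>Two involutions without common fixed point in the tree, midpoints of edges included, have a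
  product translating along an axis. This is seen at a vertex \<open>x\<close> that minimises the sum of
  the displacements: there none of the improving steps above exists.\<close>

lemma involutions_trichotomy:
  assumes r: "r \<in> H" "r * r = 1" and s: "s \<in> H" "s * s = 1"
  shows "(\<exists>x\<in>H. d x (r * x) = 0 \<and> d x (s * x) = 0) \<or>
    (\<exists>x\<in>H. \<exists>y\<in>H. d x y = 1 \<and> preserves_edge r x y \<and> preserves_edge s x y) \<or>
    (\<exists>x L. hyp (r * s) x L)"
proof -
  define f where "f x = nat (d x (r * x) + d x (s * x))" for x
  define x where "x = arg_min_on f H"
  have "arg_min f (\<lambda>x. x \<in> H) \<in> H" "\<And>y. y \<in> H \<Longrightarrow> f (arg_min f (\<lambda>x. x \<in> H)) \<le> f y"
    using arg_min_nat_lemma[of "\<lambda>x. x \<in> H" 1 f] by auto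
  then have x: "x \<in> H" and min: "\<And>y. y \<in> H \<Longrightarrow> f x \<le> f y"
    by (auto simp: x_def arg_min_on_def)
  have min: "\<not> (d y (r * y) + d y (s * y) < d x (r * x) + d x (s * x))" if "y \<in> H" for y
    using min[OF that] d_nonneg[of y "r * y"] d_nonneg[of y "s * y"] that r s by (auto simp: f_def)
  have nn: "d x (r * x) \<ge> 0" "d x (s * x) \<ge> 0" using d_nonneg r s x by auto
  consider "d x (r * x) = 0" "d x (s * x) = 0" | "d x (r * x) = 0" "d x (s * x) \<ge> 1"
    | "d x (s * x) = 0" "d x (r * x) \<ge> 1" | "d x (r * x) \<ge> 1" "d x (s * x) \<ge> 1"
    using nn by linarith
  then show ?thesis
  proof cases
    case 1
    then show ?thesis using x by blast
  next
    case 2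
    then show ?thesis using involutions_one_fixed[OF r s x] min x by auto
  next
    case 3
    have "inverse (s * r) = r * s" using r s by (simp add: grp_inverse_mult grp_inverse_unique)
    then have "hyp (s * r) x L \<Longrightarrow> hyp (r * s) x L" for L using hyp_inverse by fastforce
    moreover have "(\<exists>y\<in>H. d x y = 1 \<and> preserves_edge s x y \<and> preserves_edge r x y) \<or> hyp (s * r) x (d x (r * x))"
      using 3 involutions_one_fixed[OF s r x] min by (auto simp: add.commute)
    ultimately show ?thesis using x by blast
  next
    case 4
    then show ?thesis
      using involutions_overlap[OF r s x] involutions_disjoint[OF r s x] min x
      by (cases "d (r * x) (s * x) < d x (r * x) + d x (s * x)") auto
  qed
qed

section \<open>The stabiliser of an axis\<close>

text \<open>Distances are integers, so limits along a ray are attained.\<close>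

lemma decreasing_int_stabilises:
  fixes f :: "nat \<Rightarrow> int"
  assumes "\<And>n. f (Suc n) \<le> f n" "\<And>n. f n \<ge> b"
  shows "\<exists>c N. \<forall>n\<ge>N. f n = c"
proof -
  define g where "g n = nat (f n - b)" for n
  obtain N where N: "\<And>n. g N \<le> g n"
    using arg_min_nat_lemma[of "\<lambda>_. True" 0 g] by auto
  have "f n \<le> f N" if "n \<ge> N" for n
    using that by (induction n rule: dec_induct) (use assms(1) order_trans in blast)+
  moreover have "f N \<le> f n" for n
    using N[of n] assms(2)[of n] assms(2)[of N] by (auto simp: g_def)
  ultimately show ?thesis by (metis order_antisym)
qed

text \<open>The sequence decreases by the triangle inequality and is bounded below by minus the distance
  from \<open>v\<close> to \<open>y\<close>.\<close>

lemma busemann_exists: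
  assumes h: "hyp p v L" and y: "y \<in> H"
  shows "\<exists>c N. \<forall>n\<ge>N. d (p powi (- int n) * v) y - int n * L = c"
proof (rule decreasing_int_stabilises)
  have pv: "p \<in> H" "v \<in> H" using h by (auto simp: hyp_def)
  fix n
  have a: "d (p powi (- int (Suc n)) * v) (p powi (- int n) * v) = L"
    using hyp_dist[OF h, of "- int (Suc n)" "- int n"] by simp
  have m: "p powi (- int (Suc n)) * v \<in> H" "p powi (- int n) * v \<in> H" using pv by auto
  show "d (p powi (- int (Suc n)) * v) y - int (Suc n) * L \<le> d (p powi (- int n) * v) y - int n * L"
    using triangle[OF m y] a by (simp add: algebra_simps)
  have "d (p powi (- int n) * v) v = int n * L"
    using hyp_dist[OF h, of "- int n" 0] by simp
  then show "- d v y \<le> d (p powi (- int n) * v) y - int n * L"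
    using triangle[OF m(2) y pv(2)] d_sym[OF y pv(2)] by simp
qed

text \<open>The Busemann function of the repelling end of the axis of \<open>p\<close>, normalised to
  vanish at \<open>v\<close>. It is the eventual value of the sequence.\<close>

definition busemann :: "'g \<Rightarrow> 'g \<Rightarrow> int \<Rightarrow> 'g \<Rightarrow> int" where
  "busemann p v L y = (SOME c. \<exists>N. \<forall>n\<ge>N. d (p powi (- int n) * v) y - int n * L = c)"

lemma busemann:
  assumes "hyp p v L" "y \<in> H"
  obtains N where "\<And>n. n \<ge> N \<Longrightarrow> d (p powi (- int n) * v) y = int n * L + busemann p v L y"
proof -
  have "\<exists>N. \<forall>n\<ge>N. d (p powi (- int n) * v) y - int n * L = busemann p v L y"
    unfolding busemann_def by (rule someI_ex[OF busemann_exists[OF assms]])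
  then show thesis using that by (metis diff_add_cancel add.commute)
qed

lemma busemann_base: "hyp p v L \<Longrightarrow> busemann p v L (p powi k * v) = k * L"
proof -
  assume h: "hyp p v L"
  then have pv: "p \<in> H" "v \<in> H" by (auto simp: hyp_def)
  obtain N where N: "\<And>n. n \<ge> N \<Longrightarrow> d (p powi (- int n) * v) (p powi k * v) = int n * L + busemann p v L (p powi k * v)"
    using busemann[OF h, of "p powi k * v"] pv by auto
  define n where "n = N + nat \<bar>k\<bar>"
  have "\<bar>- int n - k\<bar> = int n + k" by (simp add: n_def)
  then show ?thesis
    using hyp_dist[OF h, of "- int n" k] N[of n] unfolding n_def
    by (simp add: algebra_simps del: of_nat_add)
qed

text \<open>The elements that commute with a positive power of \<open>p\<close>. For hyperbolic
  \<open>p\<close> they preserve the axis of \<open>p\<close> and its direction.\<close>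

definition virt_comm :: "'g \<Rightarrow> 'g set" where
  "virt_comm p = {x \<in> H. \<exists>n>0. x * p powi int n = p powi int n * x}"

lemma virt_commI: "x \<in> H \<Longrightarrow> n > 0 \<Longrightarrow> x * p powi int n = p powi int n * x \<Longrightarrow> x \<in> virt_comm p"
  by (auto simp: virt_comm_def)

lemma commute_powi_mult: "x * p powi k = p powi k * x \<Longrightarrow> x * p powi (k * l) = p powi (k * l) * x" for x p :: "'a::grp"
  using commute_powi[of x "p powi k" l] by (simp add: powi_mult)

lemma subgrp_virt_comm:
  assumes "p \<in> H"
  shows "subgrp (virt_comm p)"
  unfolding subgrp_def
proof (intro conjI ballI)
  show "1 \<in> virt_comm p" by (rule virt_commI[of _ 1]) simp_all
  fix x assume x: "x \<in> virt_comm p"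
  then obtain n where n: "n > 0" "x * p powi int n = p powi int n * x" "x \<in> H" by (auto simp: virt_comm_def)
  have "inverse x * p powi int n = inverse x * (p powi int n * x) * inverse x"
    by (simp add: grp_simps)
  also have "\<dots> = p powi int n * inverse x"
    unfolding n(2)[symmetric] by (simp add: grp_simps)
  finally show "inverse x \<in> virt_comm p" using n by (intro virt_commI[of _ n]) auto
  fix y assume y: "y \<in> virt_comm p"
  then obtain m where m: "m > 0" "y * p powi int m = p powi int m * y" "y \<in> H" by (auto simp: virt_comm_def)
  have 1: "x * p powi int (n * m) = p powi int (n * m) * x"
    using commute_powi_mult[OF n(2), of "int m"] by simp
  have 2: "y * p powi int (n * m) = p powi int (n * m) * y"
    using commute_powi_mult[OF m(2), of "int n"] by (simp add: mult.commute[of n m])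
  have "x * y * p powi int (n * m) = p powi int (n * m) * (x * y)"
    by (metis 1 2 mult.assoc)
  then show "x * y \<in> virt_comm p" using n m by (intro virt_commI[of _ "n * m"]) auto
qed

text \<open>An element virtually commuting with \<open>p\<close> fixes the ends of the axis, so it
  changes Busemann functions by a constant. Indeed, if \<open>u\<close> is far out on the ray, then
  \<open>x u\<close> is at bounded distance from \<open>u\<close>. In the four-point inequality for
  \<open>u\<close>, \<open>x u\<close>, \<open>x y\<close>, \<open>x z\<close> the sum involving this
  distance is too small to matter, and the other two sums agree.\<close>

lemma busemann_shift:
  assumes h: "hyp p v L" and x: "x \<in> virt_comm p" and y: "y \<in> H" and z: "z \<in> H"
  shows "busemann p v L (x * y) - busemann p v L (x * z) = busemann p v L y - busemann p v L z"
proof -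
  have pv: "p \<in> H" "v \<in> H" "L \<ge> 1" using h by (auto simp: hyp_def)
  have xH: "x \<in> H" using x by (simp add: virt_comm_def)
  obtain k where k: "k > 0" "x * p powi int k = p powi int k * x" using x by (auto simp: virt_comm_def)
  obtain N1 where N1: "\<And>n. n \<ge> N1 \<Longrightarrow> d (p powi (- int n) * v) (x * y) = int n * L + busemann p v L (x * y)"
    using busemann[OF h, of "x * y"] xH y by auto
  obtain N2 where N2: "\<And>n. n \<ge> N2 \<Longrightarrow> d (p powi (- int n) * v) (x * z) = int n * L + busemann p v L (x * z)"
    using busemann[OF h, of "x * z"] xH z by auto
  obtain N3 where N3: "\<And>n. n \<ge> N3 \<Longrightarrow> d (p powi (- int n) * v) y = int n * L + busemann p v L y"
    using busemann[OF h y] by auto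
  obtain N4 where N4: "\<And>n. n \<ge> N4 \<Longrightarrow> d (p powi (- int n) * v) z = int n * L + busemann p v L z"
    using busemann[OF h z] by auto
  \<comment> \<open>The power \<open>n\<close> is beyond all thresholds, and \<open>p powi n\<close> commutes with \<open>x\<close> as \<open>k\<close> divides \<open>n\<close>.\<close>
  define K where "K = N1 + N2 + N3 + N4 + nat (d (x * v) v + d y z + \<bar>busemann p v L (x * y)\<bar> + \<bar>busemann p v L z\<bar>
      + \<bar>busemann p v L (x * z)\<bar> + \<bar>busemann p v L y\<bar>) + 1"
  define n where "n = k * K"
  have nK: "n \<ge> K" using k by (simp add: n_def)
  define u where "u = p powi (- int n) * v"
  have uH: "u \<in> H" using pv by (simp add: u_def)
  have comm: "x * p powi (- int n) = p powi (- int n) * x"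
    using commute_powi_mult[OF k(2), of "- int K"] by (simp add: n_def)
  have "x * u = p powi (- int n) * (x * v)"
    unfolding u_def by (metis comm mult.assoc)
  then have xu: "d (x * u) u = d (x * v) v"
    unfolding u_def using d_left[of "p powi (- int n)" "x * v" v] pv xH by simp
  have D: "d u (x * y) = int n * L + busemann p v L (x * y)" "d u (x * z) = int n * L + busemann p v L (x * z)"
    "d (x * u) (x * y) = int n * L + busemann p v L y" "d (x * u) (x * z) = int n * L + busemann p v L z"
    using N1[of n] N2[of n] N3[of n] N4[of n] nK d_left[of x u y] d_left[of x u z] uH xH y z
    by (simp_all add: K_def u_def)
  have "int n * L \<ge> int n" using pv by (simp add: mult_le_cancel_left1)
  then have big: "int n * L > d (x * v) v + d y z + \<bar>busemann p v L (x * y)\<bar> + \<bar>busemann p v L z\<bar>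
      + \<bar>busemann p v L (x * z)\<bar> + \<bar>busemann p v L y\<bar>"
    using nK unfolding K_def by linarith
  have nn: "d (x * v) v \<ge> 0" "d y z \<ge> 0" using d_nonneg pv xH y z by auto
  have e: "d (x * y) (x * z) = d y z" using d_left xH y z by simp
  have m: "x * u \<in> H" "x * y \<in> H" "x * z \<in> H" using xH uH y z by auto
  have "d u (x * u) + d (x * y) (x * z) < d u (x * y) + d (x * u) (x * z)"
    "d u (x * u) + d (x * y) (x * z) < d u (x * z) + d (x * u) (x * y)"
    using D xu e big nn d_sym[OF uH m(1)] by linarith+
  then have "d u (x * y) + d (x * u) (x * z) = d u (x * z) + d (x * u) (x * y)"
    using four[OF uH m(2) m(1) m(3)] four[OF uH m(3) m(1) m(2)]
      d_sym[OF m(1) m(2)] d_sym[OF m(1) m(3)] d_sym[OF m(2) m(3)]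
    unfolding max_def by (auto split: if_splits)
  then show ?thesis using D by linarith
qed

text \<open>By \<open>busemann_shift\<close> this is a homomorphism from \<open>virt_comm p\<close> to
  the integers: the signed translation length along the axis of \<open>p\<close>.\<close>

definition shift :: "'g \<Rightarrow> 'g \<Rightarrow> int \<Rightarrow> 'g \<Rightarrow> int" where
  "shift p v L x = busemann p v L (x * v)"

lemma shift_mult:
  assumes "hyp p v L" "x \<in> virt_comm p" "y \<in> virt_comm p"
  shows "shift p v L (x * y) = shift p v L x + shift p v L y"
proof -
  have "y * v \<in> H" "v \<in> H" using assms by (auto simp: hyp_def virt_comm_def)
  then show ?thesis
    using busemann_shift[OF assms(1,2), of "y * v" v] busemann_base[OF assms(1), of 0]
    by (simp add: shift_def mult.assoc)
qed

lemma shift_one: "hyp p v L \<Longrightarrow> shift p v L 1 = 0"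
  using busemann_base[of p v L 0] by (simp add: shift_def)

lemma shift_inverse:
  assumes "hyp p v L" "x \<in> virt_comm p"
  shows "shift p v L (inverse x) = - shift p v L x"
proof -
  have "inverse x \<in> virt_comm p"
    using subgrp_inverse[OF subgrp_virt_comm assms(2)] assms(1) by (simp add: hyp_def)
  then show ?thesis
    using shift_mult[OF assms(1,2), of "inverse x"] shift_one[OF assms(1)] by (simp add: grp_right_inverse)
qed

lemma shift_powi:
  assumes h: "hyp p v L" and x: "x \<in> virt_comm p"
  shows "shift p v L (x powi k) = k * shift p v L x"
proof -
  have S: "subgrp (virt_comm p)" using h subgrp_virt_comm by (simp add: hyp_def)
  note S' = subgrp_powi[OF S x] subgrp_inverse[OF S x]
  show ?thesis
  proof (induction k rule: int_induct[of _ 0])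
    case base
    then show ?case using shift_one[OF h] by simp
  next
    case (step1 i)
    then show ?case using shift_mult[OF h S'(1) x] by (simp add: powi_succ distrib_right)
  next
    case (step2 i)
    then show ?case using shift_mult[OF h S'] shift_inverse[OF h x] by (simp add: powi_pred left_diff_distrib)
  qed
qed

lemma virt_comm_inverse: "virt_comm (inverse p) = virt_comm p"
proof -
  have *: "x * inverse y = inverse y * x" if "x * y = y * x" for x y :: 'g
    using commute_powi[OF that, of "-1"] by (simp add: powi_minus)
  have "x * inverse y = inverse y * x \<longleftrightarrow> x * y = y * x" for x y :: 'g
    using *[of x y] *[of x "inverse y"] by auto
  then show ?thesis by (simp add: virt_comm_def flip: inverse_power)
qed

text \<open>If \<open>x\<close> moved \<open>v\<close> without shifting along the axis, then seen from
  the other end both \<open>x\<close> and its inverse would shift by the positive distance from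
  \<open>v\<close> to \<open>x v\<close>.\<close>

lemma shift_zero_fixes_base:
  assumes h: "hyp p v L" and x: "x \<in> virt_comm p" and 0: "shift p v L x = 0"
  shows "d v (x * v) = 0"
proof (rule ccontr)
  assume ne: "d v (x * v) \<noteq> 0"
  have pv: "p \<in> H" "v \<in> H" "L \<ge> 1" using h by (auto simp: hyp_def)
  have xH: "x \<in> H" using x by (simp add: virt_comm_def)
  have h': "hyp (inverse p) v L" by (rule hyp_inverse[OF h])
  have *: "shift (inverse p) v L y = d v (y * v)"
    if y: "y \<in> H" "shift p v L y = 0" and pos: "d v (y * v) > 0" for y
  proof -
    have m: "y * v \<in> H" using y pv by simp
    obtain N1 where N1: "\<And>n. n \<ge> N1 \<Longrightarrow> d (p powi (- int n) * v) (y * v) = int n * L"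
      using busemann[OF h m] y(2) by (auto simp: shift_def)
    obtain N2 where N2: "\<And>n. n \<ge> N2 \<Longrightarrow> d (p powi (int n) * v) (y * v) = int n * L + shift (inverse p) v L y"
      using busemann[OF h' m] by (auto simp: shift_def inverse_powi)
    define n where "n = N1 + N2 + nat (d v (y * v))"
    define a b where "a = p powi (- int n) * v" and "b = p powi int n * v"
    have ab: "a \<in> H" "b \<in> H" using pv by (auto simp: a_def b_def)
    have D: "d a (y * v) = int n * L" "d b (y * v) = int n * L + shift (inverse p) v L y"
      using N1[of n] N2[of n] by (auto simp: n_def a_def b_def)
    have E: "d a b = 2 * (int n * L)" "d a v = int n * L" "d v b = int n * L"
      using hyp_dist[OF h, of "- int n" "int n"] hyp_dist[OF h, of "- int n" 0] hyp_dist[OF h, of 0 "int n"]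
      by (auto simp: a_def b_def)
    show ?thesis
      using four[OF pv(2) m ab] four[OF pv(2) ab(2) m ab(1)] D E pos
        d_sym[OF pv(2) ab(1)] d_sym[OF m ab(1)] d_sym[OF m ab(2)] triangle[OF ab(2) pv(2) m]
        d_sym[OF pv(2) ab(2)] d_sym[OF ab]
      by (auto simp: max_def split: if_splits)
  qed
  have pos: "d v (x * v) > 0" using ne d_nonneg[of v "x * v"] pv xH by auto
  have e: "d v (inverse x * v) = d v (x * v)"
    using d_left_inverse[of x v v] d_sym[of v "x * v"] xH pv by simp
  have x': "inverse x \<in> H" "shift p v L (inverse x) = 0"
    using xH shift_inverse[OF h x] 0 by auto
  have "shift (inverse p) v L x > 0" "shift (inverse p) v L (inverse x) > 0"
    using *[OF xH 0 pos] *[OF x'] e pos by auto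
  moreover have "x \<in> virt_comm (inverse p)" using x by (simp add: virt_comm_inverse)
  ultimately show False using shift_inverse[OF h', of x] by simp
qed

lemma p_virt_comm: "p \<in> H \<Longrightarrow> p \<in> virt_comm p"
  by (rule virt_commI[of _ 1]) simp_all

lemma shift_self: "hyp p v L \<Longrightarrow> shift p v L p = L"
  using busemann_base[of p v L 1] by (simp add: shift_def)

text \<open>Conjugating by \<open>p powi 3\<close> shows that \<open>x\<close> fixes a second vertex
  of the axis, far away from \<open>v\<close>.\<close>

lemma shift_zero_square:
  assumes h: "hyp p v L" and x: "x \<in> virt_comm p" and 0: "shift p v L x = 0"
    and fix3: "\<And>y a b. y \<in> H \<Longrightarrow> a \<in> H \<Longrightarrow> b \<in> H \<Longrightarrow> d a (y * a) = 0 \<Longrightarrow> d b (y * b) = 0 \<Longrightarrow> d a b \<ge> 3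
      \<Longrightarrow> y * y = 1"
  shows "x * x = 1"
proof -
  have pv: "p \<in> H" "v \<in> H" "L \<ge> 1" using h by (auto simp: hyp_def)
  have S: "subgrp (virt_comm p)" using subgrp_virt_comm pv by simp
  have xH: "x \<in> H" using x by (simp add: virt_comm_def)
  have p: "p \<in> virt_comm p" by (rule p_virt_comm[OF pv(1)])
  have q: "p powi 3 \<in> virt_comm p" using subgrp_powi[OF S p] .
  define y where "y = inverse (p powi 3) * x * p powi 3"
  have y: "y \<in> virt_comm p" unfolding y_def using S q x by (intro subgrp_mult subgrp_inverse)
  have "shift p v L y = 0"
    unfolding y_def using shift_mult[OF h] shift_inverse[OF h q] subgrp_mult[OF S] subgrp_inverse[OF S] q x 0
    by simp
  then have "d v (y * v) = 0" by (rule shift_zero_fixes_base[OF h y])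
  moreover have "p powi 3 * (y * v) = x * (p powi 3 * v)" by (simp add: y_def mult.assoc)
  moreover have "y * v \<in> H" using y pv by (simp add: virt_comm_def)
  ultimately have 1: "d (p powi 3 * v) (x * (p powi 3 * v)) = 0"
    using d_left[of "p powi 3" v "y * v"] pv by simp
  have 2: "d v (p powi 3 * v) \<ge> 3" using hyp_dist[OF h, of 0 3] pv by simp
  show ?thesis
    by (rule fix3[OF xH pv(2) _ shift_zero_fixes_base[OF h x 0] 1 2]) (use pv in simp)
qed

end

context tree_group
begin

text \<open>Conjugate elements have the same translation length, since the displacement at
  \<open>v\<close> and at another vertex differ by a bounded amount while the displacements of powers
  grow linearly.\<close>

lemma conj_power_length:
  assumes h: "hyp p v L" and h': "hyp q v L" and x: "x \<in> H" and e: "x * p powi m * inverse x = q powi l"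
  shows "\<bar>m\<bar> = \<bar>l\<bar>"
proof -
  have pv: "p \<in> H" "v \<in> H" "L \<ge> 1" using h by (auto simp: hyp_def)
  define w where "w = inverse x * v"
  define C where "C = d v w"
  have w: "w \<in> H" using x pv by (simp add: w_def)
  have C: "C \<ge> 0" using d_nonneg pv w by (simp add: C_def)
  \<comment> \<open>Displacements at \<open>v\<close> and \<open>w\<close> differ by at most \<open>2 * C\<close>, which the \<open>n\<close>-th powers exceed.\<close>
  define n where "n = 2 * C + 1"
  have xn: "x * p powi (m * n) * inverse x = q powi (l * n)"
    using powi_conj[of x "p powi m" n] e by (simp add: powi_mult)
  have "d v (q powi (l * n) * v) = d (x * w) (x * (p powi (m * n) * w))"
    by (simp add: w_def xn[symmetric] mult.assoc)
  also have "\<dots> = d w (p powi (m * n) * w)" using d_left x w pv by simp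
  finally have 1: "d w (p powi (m * n) * w) = \<bar>l * n\<bar> * L"
    using hyp_dist[OF h', of 0 "l * n"] by simp
  have 2: "d v (p powi (m * n) * v) = \<bar>m * n\<bar> * L"
    using hyp_dist[OF h, of 0 "m * n"] by simp
  have 3: "d (p powi (m * n) * v) (p powi (m * n) * w) = C"
    using d_left[of "p powi (m * n)" v w] pv w by (simp add: C_def)
  have mm: "p powi (m * n) * v \<in> H" "p powi (m * n) * w \<in> H" using pv w by auto
  have "\<bar>\<bar>m * n\<bar> * L - \<bar>l * n\<bar> * L\<bar> \<le> 2 * C"
    using triangle[OF w mm(1) mm(2)] triangle[OF w pv(2) mm(1)] triangle[OF pv(2) mm(2) mm(1)]
      triangle[OF pv(2) w mm(2)] 1 2 3 d_sym[OF pv(2) w] d_sym[OF mm] C_def by linarith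
  moreover have "\<bar>\<bar>m * n\<bar> * L - \<bar>l * n\<bar> * L\<bar> = \<bar>\<bar>m\<bar> - \<bar>l\<bar>\<bar> * (n * L)"
  proof -
    have "\<bar>m * n\<bar> * L - \<bar>l * n\<bar> * L = (\<bar>m\<bar> - \<bar>l\<bar>) * (n * L)"
      using C by (simp add: abs_mult n_def left_diff_distrib mult.assoc)
    then show ?thesis using C pv by (simp add: abs_mult n_def)
  qed
  ultimately have *: "\<bar>\<bar>m\<bar> - \<bar>l\<bar>\<bar> * (n * L) \<le> 2 * C" by simp
  have "n * L \<ge> n" using C pv by (simp add: n_def mult_le_cancel_left1)
  show ?thesis
  proof (rule ccontr)
    assume "\<bar>m\<bar> \<noteq> \<bar>l\<bar>"
    then have "\<bar>\<bar>m\<bar> - \<bar>l\<bar>\<bar> \<ge> 1" by linarith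
    then have "\<bar>\<bar>m\<bar> - \<bar>l\<bar>\<bar> * (n * L) \<ge> n * L"
      using mult_right_mono[of 1 "\<bar>\<bar>m\<bar> - \<bar>l\<bar>\<bar>" "n * L"] C pv by (simp add: n_def)
    with * \<open>n * L \<ge> n\<close> show False by (simp add: n_def)
  qed
qed

text \<open>The shift embeds \<open>virt_comm p\<close> into the integers, so
  \<open>virt_comm p\<close> is generated by one element \<open>q\<close>, which the involution
  \<open>r\<close> inverts. The group generated by \<open>r\<close> and \<open>q\<close> is the
  stabiliser of the axis of \<open>p\<close>. It is malnormal because an element conjugating a power of
  \<open>q\<close> into it preserves this axis.\<close>

lemma hyperbolic_pair_in_malnormal_dih:
  assumes r: "r \<in> Invs H" and s: "s \<in> Invs H" and h: "hyp (r * s) v L"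
    and fix3: "\<And>y a b. y \<in> H \<Longrightarrow> a \<in> H \<Longrightarrow> b \<in> H \<Longrightarrow> d a (y * a) = 0 \<Longrightarrow> d b (y * b) = 0 \<Longrightarrow> d a b \<ge> 3
      \<Longrightarrow> y * y = 1"
    and inf: "\<And>a b. a \<in> Invs H \<Longrightarrow> b \<in> Invs H \<Longrightarrow> a \<noteq> b \<Longrightarrow> inf_ord (a * b)"
  shows "\<exists>t\<in>Invs H. t \<noteq> r \<and> s \<in> dih r t \<and> malnormal_in H (dih r t)"
proof -
  define p where "p = r * s"
  define V where "V = virt_comm p"
  define sh where "sh = shift p v L"
  note rI = InvsD[OF r] and sI = InvsD[OF s]
  have h: "hyp p v L" using h by (simp add: p_def)
  have pv: "p \<in> H" "v \<in> H" "L \<ge> 1" using h by (auto simp: hyp_def)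
  have pinf: "inf_ord p" by (rule hyp_inf_ord[OF h])
  have V: "subgrp V" unfolding V_def by (rule subgrp_virt_comm[OF pv(1)])
  have VH: "x \<in> H" if "x \<in> V" for x using that by (simp add: V_def virt_comm_def)
  note Vs [simp] = subgrp_one[OF V] subgrp_mult[OF V] subgrp_inverse[OF V] subgrp_powi[OF V]
  have pV: "p \<in> V" unfolding V_def by (rule p_virt_comm[OF pv(1)])
  have sh_mult: "sh (x * y) = sh x + sh y" if "x \<in> V" "y \<in> V" for x y
    using shift_mult[OF h] that by (simp add: sh_def V_def)
  have sh_inv: "sh (inverse x) = - sh x" if "x \<in> V" for x
    using shift_inverse[OF h] that by (simp add: sh_def V_def)
  have sh_powi: "sh (x powi k) = k * sh x" if "x \<in> V" for x k
    using shift_powi[OF h] that by (simp add: sh_def V_def)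
  have sh_p: "sh p = L" using shift_self[OF h] by (simp add: sh_def)
  have sh_1: "sh 1 = 0" using shift_one[OF h] by (simp add: sh_def)
  have rp: "r * p * inverse r = inverse p"
    using rot_flip[OF rI(3) sI(3)] rI(4) by (simp add: p_def)
  have rpk: "r * p powi k * inverse r = p powi (- k)" for k
    using powi_conj[of r p k] by (simp add: rp inverse_powi)
  have rV: "r * x * inverse r \<in> V" if x: "x \<in> V" for x
  proof -
    obtain n where n: "n > 0" "x * p powi int n = p powi int n * x" "x \<in> H"
      using x by (auto simp: V_def virt_comm_def)
    have "r * x * inverse r * p powi (- int n) = r * (x * p powi int n) * inverse r"
      unfolding rpk[symmetric] by (simp add: grp_simps)
    also have "\<dots> = p powi (- int n) * (r * x * inverse r)"
      unfolding rpk[symmetric] n(2) by (simp add: grp_simps)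
    finally have "r * x * inverse r * p powi (- int n * - 1) = p powi (- int n * - 1) * (r * x * inverse r)"
      by (rule commute_powi_mult)
    then show ?thesis using n rI(1) unfolding V_def by (intro virt_commI[of _ n]) auto
  qed
  text \<open>The non-trivial elements of the kernel of the shift are involutions with pairwise products of
    order at most two. So there is at most one of them, and it commutes with \<open>r\<close>.\<close>
  have triv: "x = 1" if x: "x \<in> V" "sh x = 0" for x
  proof (rule ccontr)
    assume x1: "x \<noteq> 1"
    have sq: "y * y = 1" if "y \<in> V" "sh y = 0" for y
      using shift_zero_square[OF h _ _ fix3] that by (simp add: V_def sh_def)
    have inv: "y \<in> Invs H" if "y \<in> V" "sh y = 0" "y \<noteq> 1" for y
      using sq VH that by (simp add: Invs_def)
    have uniq: "y = x" if y: "y \<in> V" "sh y = 0" "y \<noteq> 1" for y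
    proof (rule ccontr)
      assume "y \<noteq> x"
      then have "inf_ord (y * x)" using inf inv[OF y] inv[OF x x1] by blast
      moreover have "y * x * (y * x) = 1" using sq[of "y * x"] x y sh_mult by simp
      ultimately show False using inf_ord_ne by blast
    qed
    have "p * x * inverse p = x"
      using uniq[of "p * x * inverse p"] x x1 pV by (simp add: sh_mult sh_inv conj_eq_one)
    have "sh (r * x * inverse r) + sh (r * x * inverse r) = sh (r * x * inverse r * (r * x * inverse r))"
      using sh_mult rV[OF x(1)] by simp
    also have "\<dots> = 0" unfolding conj_mult sq[OF x] by (simp add: grp_right_inverse sh_1)
    finally have "r * x * inverse r = x"
      using uniq[of "r * x * inverse r"] rV[OF x(1)] x1 by (simp add: conj_eq_one)
    then have rx: "r * x = x * r" by (metis grp_cancel_left mult.assoc mult_1_right grp_left_inverse)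
    have "r \<noteq> x"
    proof
      assume "r = x"
      then have "p * r * inverse p = r" using \<open>p * x * inverse p = x\<close> by simp
      then have "p * r = r * p" by (metis grp_left_inverse mult.assoc mult_1_right)
      then have "inverse p = p" using rp by (metis grp_right_inverse mult.assoc mult_1_right)
      then show False using inf_ord_ne(2)[OF pinf] by (metis grp_right_inverse)
    qed
    then have "inf_ord (r * x)" using inf r inv[OF x x1] by blast
    moreover have "r * x * (r * x) = 1"
    proof -
      have "r * x * (r * x) = r * (r * x) * x" by (metis rx mult.assoc)
      then show ?thesis using sq[OF x] rI by (simp add: mult.assoc)
    qed
    ultimately show False using inf_ord_ne(2) by blast
  qed
  have inj: "x = y" if "x \<in> V" "y \<in> V" "sh x = sh y" for x y
    using triv[of "inverse x * y"] that sh_mult sh_inv by (simp add: grp_eq_iff[of x y])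
  \<comment> \<open>An element \<open>q\<close> of least positive shift generates \<open>V\<close>.\<close>
  define n where "n = (LEAST n. n > 0 \<and> (\<exists>x\<in>V. sh x = int n))"
  have ex: "\<exists>n. n > 0 \<and> (\<exists>x\<in>V. sh x = int n)"
    using pV sh_p pv(3) by (intro exI[of _ "nat L"]) auto
  from LeastI_ex[OF this] obtain q where q: "n > 0" "q \<in> V" "sh q = int n" by (auto simp: n_def)
  have least: "m \<ge> n" if "m > 0" "x \<in> V" "sh x = int m" for m x
    unfolding n_def using that by (intro Least_le) blast
  have cyc: "\<exists>k. x = q powi k" if x: "x \<in> V" for x
  proof -
    define k where "k = sh x div int n"
    have "sh (x * q powi (- k)) = sh x mod int n"
      using x q sh_mult sh_powi by (simp add: k_def minus_div_mult_eq_mod)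
    moreover have "\<not> (sh x mod int n > 0)"
    proof
      assume pos: "sh x mod int n > 0"
      then have "n \<le> nat (sh x mod int n)"
        using least[of "nat (sh x mod int n)" "x * q powi (- k)"] calculation x q by simp
      moreover have "sh x mod int n < int n" using q(1) by simp
      ultimately show False using pos by linarith
    qed
    moreover have "sh x mod int n \<ge> 0" using q by simp
    ultimately have "x * q powi (- k) = 1" using triv[of "x * q powi (- k)"] x q by simp
    then have "x = q powi k" by (simp add: powi_minus) (metis grp_cancel_left grp_inverse_inverse grp_inverse_unique mult.assoc mult_1_right grp_left_inverse)
    then show ?thesis ..
  qed
  obtain k where k: "p = q powi k" using cyc[OF pV] by blast
  have kn: "k * int n = L" using sh_powi[OF q(2), of k] q(3) sh_p k by simp
  have rq: "r * q * inverse r = inverse q"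
  proof (rule inj)
    have "(r * q * inverse r) powi k = inverse p" by (simp add: powi_conj k[symmetric] rp)
    then have "k * sh (r * q * inverse r) = - L"
      using sh_powi[OF rV[OF q(2)], of k] sh_inv[OF pV] sh_p by simp
    then have "k * sh (r * q * inverse r) = k * - int n" using kn by simp
    moreover have "k \<noteq> 0" using kn pv by auto
    ultimately show "sh (r * q * inverse r) = sh (inverse q)"
      using sh_inv[OF q(2)] q(3) by (simp only: mult_cancel_left) simp
  qed (use rV q in simp_all)
  have q1: "q \<noteq> 1" using q sh_1 by auto
  have qr: "q \<noteq> r"
  proof
    assume "q = r"
    then have "sh r + sh r = 0" using sh_mult[of r r] q rI sh_1 by simp
    then show False using q \<open>q = r\<close> by simp
  qed
  define t where "t = r * q"
  have rt: "r * t = q" using rI by (simp add: t_def)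
  have "t * t = 1"
  proof -
    have "t * t = r * q * inverse r * q" by (simp add: t_def rI mult.assoc)
    then show ?thesis by (simp add: rq grp_left_inverse)
  qed
  moreover have "t \<noteq> 1" using qr rI by (metis rt mult_1_right)
  ultimately have t: "t \<in> Invs H" using rI q VH by (simp add: Invs_def t_def)
  have tr: "t \<noteq> r" using rt q1 rI by auto
  note tI = InvsD[OF t]
  have D: "subgrp (dih r t)" by (rule subgrp_dih[OF rI(3) tI(3)])
  have rD: "r \<in> dih r t" by (rule dih_gens(1)[OF rI(3) tI(3)])
  have qD: "q powi i \<in> dih r t" for i using dihI(1)[of r t i] by (simp add: rt)
  have "s = r * q powi k" using rI by (simp add: k[symmetric] p_def)
  then have sD: "s \<in> dih r t" using subgrp_mult[OF D rD qD] by simp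
  have "malnormal_in H (dih r t)"
    unfolding malnormal_in_def
  proof (intro ballI impI)
    fix x y assume x: "x \<in> H" and y: "y \<in> dih r t" "inf_ord y" and xy: "x * y * inverse x \<in> dih r t"
    obtain m where m: "m \<noteq> 0" "y = q powi m" using dih_inf_ordE[OF rI(3) tI(3) y] rt by metis
    have "inf_ord (x * y * inverse x)" using y by (simp add: inf_ord_conj)
    then obtain l where l: "l \<noteq> 0" "x * y * inverse x = q powi l"
      using dih_inf_ordE[OF rI(3) tI(3) xy] rt by metis
    have xp: "x * p powi m * inverse x = p powi l"
      using powi_conj[of x "q powi m" k] l m by (simp add: k powi_mult mult.commute)
    have "\<bar>m\<bar> = \<bar>l\<bar>" by (rule conj_power_length[OF h h x xp])
    \<comment> \<open>Depending on the sign, \<open>x\<close> or \<open>r * x\<close> virtually commutes with \<open>p\<close>.\<close>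
    then consider "l = m" | "l = - m" by linarith
    then show "x \<in> dih r t"
    proof cases
      case 1
      have "x * p powi m = p powi m * x"
        using arg_cong[OF xp[unfolded 1], of "\<lambda>z. z * x"] by (simp add: grp_simps)
      then have "x * p powi (m * sgn m) = p powi (m * sgn m) * x" by (rule commute_powi_mult)
      then have "x \<in> V" using m x unfolding V_def
        by (intro virt_commI[of _ "nat \<bar>m\<bar>"]) (simp_all only: abs_sgn[symmetric] mult.commute int_nat_eq abs_ge_zero if_True zero_less_nat_eq zero_less_abs_iff simp_thms)
      then show ?thesis using cyc qD by metis
    next
      case 2
      have e: "x * p powi m = p powi (- m) * x"
        using arg_cong[OF xp[unfolded 2], of "\<lambda>z. z * x"] by (simp add: grp_simps)
      have "r * x * p powi m = r * p powi (- m) * inverse r * (r * x)"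
        by (simp add: mult.assoc e)
      then have "r * x * p powi m = p powi m * (r * x)" by (simp add: rpk)
      then have "r * x * p powi (m * sgn m) = p powi (m * sgn m) * (r * x)" by (rule commute_powi_mult)
      then have "r * x \<in> V" using m x rI unfolding V_def
        by (intro virt_commI[of _ "nat \<bar>m\<bar>"]) (simp_all only: subgrp_mult H abs_sgn[symmetric] mult.commute int_nat_eq abs_ge_zero if_True zero_less_nat_eq zero_less_abs_iff simp_thms)
      then obtain i where "r * x = q powi i" using cyc by blast
      then have "x = r * q powi i" using rI by metis
      then show ?thesis using subgrp_mult[OF D rD qD] by simp
    qed
  qed
  then show ?thesis using t tr sD by blast
qed

end

section \<open>Permutation groups\<close>

text \<open>The group of all permutations of a type. It contains copies of all groups of at most the
  cardinality of the type, which keeps the iteration below within a single type.\<close>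

typedef 'a sym = "{f :: 'a \<Rightarrow> 'a. bij f}"
  morphisms sapp Sym
  by (rule exI[of _ id]) simp

setup_lifting type_definition_sym

instantiation sym :: (type) grp
begin

lift_definition one_sym :: "'a sym" is id by simp
lift_definition times_sym :: "'a sym \<Rightarrow> 'a sym \<Rightarrow> 'a sym" is "(\<circ>)" by (rule bij_comp)
lift_definition inverse_sym :: "'a sym \<Rightarrow> 'a sym" is "inv_into UNIV" by (rule bij_imp_bij_inv)
definition divide_sym :: "'a sym \<Rightarrow> 'a sym \<Rightarrow> 'a sym" where "divide_sym f g = f * inverse g"

instance
proof
  fix f g h :: "'a sym"
  show "f * g * h = f * (g * h)" by transfer (simp add: comp_assoc)
  show "1 * f = f" "f * 1 = f" by (transfer, simp)+
  show "inverse f * f = 1" by transfer (simp add: bij_is_inj)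
qed

end

lemma sapp_mult [simp]: "sapp (f * g) x = sapp f (sapp g x)"
  by transfer simp

lemma sapp_one [simp]: "sapp 1 x = x"
  by transfer simp

lemma sapp_inverse [simp]: "sapp (inverse f) (sapp f x) = x" "sapp f (sapp (inverse f) x) = x"
proof -
  show "sapp (inverse f) (sapp f x) = x" by (simp flip: sapp_mult add: grp_left_inverse del: sapp_mult)
  show "sapp f (sapp (inverse f) x) = x" by (simp flip: sapp_mult add: grp_right_inverse del: sapp_mult)
qed

lemma sym_eqI: "(\<And>x. sapp f x = sapp g x) \<Longrightarrow> f = g"
  by (metis ext sapp_inject)

definition ext_sym :: "'a set \<Rightarrow> ('a \<Rightarrow> 'a) \<Rightarrow> 'a sym" where
  "ext_sym A f = Sym (\<lambda>x. if x \<in> A then f x else x)"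

lemma sapp_ext_sym:
  assumes "bij_betw f A A"
  shows "sapp (ext_sym A f) x = (if x \<in> A then f x else x)"
proof -
  have "bij_betw (\<lambda>x. if x \<in> A then f x else x) (A \<union> - A) (A \<union> - A)"
    by (rule bij_betw_disjoint_Un) (use assms in \<open>auto simp: bij_betw_def inj_on_def\<close>)
  then show ?thesis by (simp add: ext_sym_def Sym_inverse)
qed

text
  \<open>Cayley's theorem. The group acts on an injective image of its carrier, so the type of the points can be prescribed.\<close>

lemma cayley:
  fixes K :: "('k, 'm) monoid_scheme"
  assumes "group K" "carrier K \<lesssim> (UNIV :: 'a set)"
  obtains \<psi> :: "'k \<Rightarrow> 'a sym" where "inj_on \<psi> (carrier K)"
    "\<And>x y. x \<in> carrier K \<Longrightarrow> y \<in> carrier K \<Longrightarrow> \<psi> (x \<otimes>\<^bsub>K\<^esub> y) = \<psi> x * \<psi> y"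
proof -
  interpret group K by fact
  obtain j :: "'k \<Rightarrow> 'a" where j: "inj_on j (carrier K)" using assms(2) by (auto simp: lepoll_def)
  define A where "A = j ` carrier K"
  define f where "f g a = j (g \<otimes>\<^bsub>K\<^esub> inv_into (carrier K) j a)" for g a
  have f: "f g (j x) = j (g \<otimes>\<^bsub>K\<^esub> x)" if "x \<in> carrier K" for g x
    using that j by (simp add: f_def)
  have b: "bij_betw (f g) A A" if g: "g \<in> carrier K" for g
  proof (rule bij_betw_byWitness[where f' = "f (inv\<^bsub>K\<^esub> g)"])
    show "\<forall>a\<in>A. f (inv\<^bsub>K\<^esub> g) (f g a) = a" "\<forall>a\<in>A. f g (f (inv\<^bsub>K\<^esub> g) a) = a"
      using g by (auto simp: A_def f m_assoc[symmetric])
  qed (use g in \<open>auto simp: A_def f\<close>)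
  define \<psi> where "\<psi> g = ext_sym A (f g)" for g
  have a: "sapp (\<psi> g) x = (if x \<in> A then f g x else x)" if "g \<in> carrier K" for g x
    unfolding \<psi>_def by (rule sapp_ext_sym[OF b[OF that]])
  show thesis
  proof
    show "inj_on \<psi> (carrier K)"
    proof (rule inj_onI)
      fix x y assume xy: "x \<in> carrier K" "y \<in> carrier K" "\<psi> x = \<psi> y"
      have "j z = sapp (\<psi> z) (j \<one>\<^bsub>K\<^esub>)" if "z \<in> carrier K" for z
        using that by (simp add: a A_def f)
      then have "j x = j y" using xy by metis
      then show "x = y" using j xy by (simp add: inj_on_eq_iff)
    qed
    show "\<psi> (x \<otimes>\<^bsub>K\<^esub> y) = \<psi> x * \<psi> y" if "x \<in> carrier K" "y \<in> carrier K" for x y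
      by (rule sym_eqI) (use that in \<open>auto simp: a A_def f m_assoc inj_on_eq_iff[OF j]\<close>)
  qed
qed

section \<open>The tree of finite lists\<close>

fun lcp :: "'b list \<Rightarrow> 'b list \<Rightarrow> nat" where
  "lcp (a # p) (b # q) = (if a = b then Suc (lcp p q) else 0)"
| "lcp _ _ = 0"

text \<open>The distance in the tree whose vertices are lists and whose edges add a last entry.\<close>

definition list_dist :: "'b list \<Rightarrow> 'b list \<Rightarrow> int" where
  "list_dist p q = int (length p) + int (length q) - 2 * int (lcp p q)"

lemma lcp_sym: "lcp p q = lcp q p"
  by (induction p q rule: lcp.induct) auto

lemma lcp_le: "lcp p q \<le> length p"
  by (induction p q rule: lcp.induct) auto

lemma lcp_ultra: "lcp p q \<ge> min (lcp p r) (lcp r q)"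
proof (induction p q arbitrary: r rule: lcp.induct)
  case (1 a p b q)
  then show ?case by (cases r) auto
next
  case ("2_2" p)
  then show ?case by (cases p; cases r) auto
qed auto

lemma list_dist_zero: "list_dist p q = 0 \<longleftrightarrow> p = q"
proof (induction p q rule: lcp.induct)
  case (1 a p b q)
  then show ?case using lcp_le[of p q] lcp_le[of q p] lcp_sym[of p q] by (auto simp: list_dist_def)
qed (auto simp: list_dist_def)

text \<open>The common prefix lengths of lists satisfy the ultrametric inequality; among the three sums of
  opposite prefix lengths of four lists, the two smallest ones agree.\<close>

lemma ultrametric_four:
  fixes xy xz xw yz yw zw :: nat
  assumes "xy \<ge> min xz yz" "xz \<ge> min xy yz" "yz \<ge> min xy xz"
    "xy \<ge> min xw yw" "xw \<ge> min xy yw" "yw \<ge> min xy xw"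
    "xz \<ge> min xw zw" "xw \<ge> min xz zw" "zw \<ge> min xz xw"
    "yz \<ge> min yw zw" "yw \<ge> min yz zw" "zw \<ge> min yz yw"
  shows "xy + zw \<ge> min (xz + yw) (xw + yz)"
  using assms by (smt (verit, ccfv_SIG) min_def add_le_mono add.commute linorder_le_cases order_trans)

lemma list_dist_four: "list_dist x y + list_dist z w \<le> max (list_dist x z + list_dist y w) (list_dist x w + list_dist y z)"
proof -
  have "min (lcp x z + lcp y w) (lcp x w + lcp y z) \<le> lcp x y + lcp z w"
    by (rule ultrametric_four; metis lcp_ultra lcp_sym)
  then show ?thesis unfolding list_dist_def by (auto simp: min_def max_def split: if_splits)
qed

section \<open>HNN extensions and letters of order two\<close>

definition starts :: "'b \<Rightarrow> 'b list \<Rightarrow> bool" where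
  "starts a p \<longleftrightarrow> (\<exists>q. p = a # q)"

lemma starts_simps [simp]: "\<not> starts a []" "starts a (b # p) \<longleftrightarrow> a = b"
  by (auto simp: starts_def)

text \<open>Input for an HNN extension of \<open>G\<close> with stable letters \<open>t x\<close> for
  \<open>x \<in> \<Lambda>\<close>, where \<open>bar\<close> pairs each letter with its inverse. The
  relations are \<open>b t x = t x \<theta> x b\<close> for \<open>b \<in> B x\<close> and
  \<open>t (bar x) = inverse (t x)\<close>. A letter with \<open>bar x = x\<close> is adjoined
  as an involution; such letters invert edges of the tree.\<close>

locale hnn_data =
  fixes G :: "'g::grp set" and \<Lambda> :: "'l set" and bar :: "'l \<Rightarrow> 'l"
    and B :: "'l \<Rightarrow> 'g set" and \<theta> :: "'l \<Rightarrow> 'g \<Rightarrow> 'g"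
  assumes G [simp]: "subgrp G"
    and bar [simp]: "x \<in> \<Lambda> \<Longrightarrow> bar x \<in> \<Lambda>" "x \<in> \<Lambda> \<Longrightarrow> bar (bar x) = x"
    and B [simp]: "x \<in> \<Lambda> \<Longrightarrow> subgrp (B x)" and B_subset: "x \<in> \<Lambda> \<Longrightarrow> B x \<subseteq> G"
    and \<theta>_in: "x \<in> \<Lambda> \<Longrightarrow> b \<in> B x \<Longrightarrow> \<theta> x b \<in> B (bar x)"
    and \<theta>_inverse: "x \<in> \<Lambda> \<Longrightarrow> b \<in> B x \<Longrightarrow> \<theta> (bar x) (\<theta> x b) = b"
    and \<theta>_hom: "x \<in> \<Lambda> \<Longrightarrow> hom_on (B x) (\<theta> x)"
begin

lemma B_in_G [simp]: "x \<in> \<Lambda> \<Longrightarrow> b \<in> B x \<Longrightarrow> b \<in> G"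
  using B_subset by blast

text \<open>A representative of the coset \<open>g B x\<close>. The coset \<open>B x\<close> itself
  is represented by \<open>1\<close>, so that backtracking can be recognised syntactically in normal
  forms.\<close>

definition rep :: "'l \<Rightarrow> 'g \<Rightarrow> 'g" where
  "rep x g = (if g \<in> B x then 1 else SOME h. h \<in> (*) g ` B x)"

lemma rep_coset: 
  assumes "x \<in> \<Lambda>"
  shows "\<exists>b\<in>B x. rep x g = g * b"
proof (cases "g \<in> B x")
  case True
  then show ?thesis using assms
    by (intro bexI[of _ "inverse g"]) (auto simp: rep_def grp_right_inverse)
next
  case False
  have "g * 1 \<in> (*) g ` B x" using assms by (intro imageI) simp
  then have "(SOME h. h \<in> (*) g ` B x) \<in> (*) g ` B x" by (rule someI)
  then show ?thesis using False by (auto simp: rep_def)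
qed

lemma rep_in [simp]: "x \<in> \<Lambda> \<Longrightarrow> g \<in> G \<Longrightarrow> rep x g \<in> G"
  using rep_coset[of x g] by auto

lemma rep_quot [simp]: "x \<in> \<Lambda> \<Longrightarrow> inverse (rep x g) * g \<in> B x"
  using rep_coset[of x g] by (auto simp: grp_simps)

lemma rep_mult [simp]:
  assumes x: "x \<in> \<Lambda>" and b: "b \<in> B x"
  shows "rep x (g * b) = rep x g"
proof -
  have "g * b \<in> B x \<longleftrightarrow> g \<in> B x"
    using subgrp_mult_right_iff[OF B[OF x] b] .
  moreover have "(*) (g * b) ` B x = (*) g ` B x"
  proof (intro equalityI subsetI)
    fix h assume "h \<in> (*) (g * b) ` B x"
    then obtain c where "c \<in> B x" "h = g * (b * c)" by (auto simp: mult.assoc)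
    then show "h \<in> (*) g ` B x" using x b by auto
  next
    fix h assume "h \<in> (*) g ` B x"
    then obtain c where c: "c \<in> B x" "h = g * c" by auto
    then have "h = g * b * (inverse b * c)" by (simp add: mult.assoc)
    then show "h \<in> (*) (g * b) ` B x" using x b c by auto
  qed
  ultimately show ?thesis by (simp add: rep_def)
qed

lemma rep_eq: "x \<in> \<Lambda> \<Longrightarrow> inverse g * h \<in> B x \<Longrightarrow> rep x g = rep x h"
  using rep_mult[of x "inverse g * h" g] by simp

lemma rep_rep [simp]: "x \<in> \<Lambda> \<Longrightarrow> rep x (rep x g) = rep x g"
  by (rule rep_eq) simp_all

lemma rep_one [simp]: "x \<in> \<Lambda> \<Longrightarrow> rep x 1 = 1"
  by (simp add: rep_def)

lemma rep_eq_one: "x \<in> \<Lambda> \<Longrightarrow> rep x g = 1 \<longleftrightarrow> g \<in> B x"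
  using rep_quot[of x g] by (auto simp: rep_def)

text \<open>What remains of \<open>g\<close> after splitting off its representative, moved across the
  letter \<open>x\<close>: \<open>g t x = rep x g t x (carry x g)\<close>.\<close>

definition carry :: "'l \<Rightarrow> 'g \<Rightarrow> 'g" where
  "carry x g = \<theta> x (inverse (rep x g) * g)"

lemma carry_in [simp]: "x \<in> \<Lambda> \<Longrightarrow> carry x g \<in> B (bar x)"
  by (simp add: carry_def \<theta>_in)

lemma carry_in_G [simp]: "x \<in> \<Lambda> \<Longrightarrow> carry x g \<in> G"
  using carry_in[of x g] B_in_G[of "bar x"] by simp

text \<open>Normal forms: a word \<open>s\<^sub>1 x\<^sub>1 s\<^sub>2 x\<^sub>2 \<dots>\<close> of
  coset representatives and letters without backtracking, to be followed by an element of
  \<open>G\<close>.\<close>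

fun reduced :: "('g \<times> 'l) list \<Rightarrow> bool" where
  "reduced [] = True"
| "reduced ((s, x) # p) \<longleftrightarrow> s \<in> G \<and> x \<in> \<Lambda> \<and> rep x s = s \<and> reduced p \<and> \<not> starts (1, bar x) p"

text \<open>Multiplying a normal form by \<open>a \<in> G\<close> from the left changes the
  representatives one after the other. The resulting word is \<open>path a p\<close>, and
  \<open>rem a p\<close> is the element of \<open>G\<close> that comes out at its end.\<close>

fun path :: "'g \<Rightarrow> ('g \<times> 'l) list \<Rightarrow> ('g \<times> 'l) list" where
  "path a [] = []"
| "path a ((s, x) # p) = (rep x (a * s), x) # path (carry x (a * s)) p"

fun rem :: "'g \<Rightarrow> ('g \<times> 'l) list \<Rightarrow> 'g" where
  "rem a [] = a"
| "rem a ((s, x) # p) = rem (carry x (a * s)) p"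

text \<open>Multiplication by an element of \<open>B x\<close> keeps a leading pair
  \<open>(1, x)\<close>, so it neither creates nor destroys backtracking.\<close>

lemma path_head:
  assumes "x \<in> \<Lambda>" "c \<in> B x" "reduced p"
  shows "starts (1, x) (path c p) \<longleftrightarrow> starts (1, x) p"
proof (cases p)
  case (Cons q p')
  obtain s y where q: "q = (s, y)" by (cases q)
  have "c * s \<in> B x \<longleftrightarrow> s \<in> B x"
    using subgrp_mult_left_iff[OF B[OF assms(1)] assms(2)] .
  then show ?thesis
    using Cons q assms rep_eq_one[of x "c * s"] rep_eq_one[of x s] by auto
qed simp

lemma reduced_path: "a \<in> G \<Longrightarrow> reduced p \<Longrightarrow> reduced (path a p)"
proof (induction p arbitrary: a)
  case (Cons q p)
  obtain s x where q: "q = (s, x)" by (cases q)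
  then show ?case
    using Cons path_head[of "bar x" "carry x (a * s)" p] by simp
qed simp

lemma rem_in: "a \<in> G \<Longrightarrow> reduced p \<Longrightarrow> rem a p \<in> G"
  by (induction p arbitrary: a) auto

lemma carry_mult:
  assumes x: "x \<in> \<Lambda>"
  shows "rep x (a * rep x (b * s)) = rep x (a * b * s)"
    and "carry x (a * rep x (b * s)) * carry x (b * s) = carry x (a * b * s)"
proof -
  show e: "rep x (a * rep x (b * s)) = rep x (a * b * s)"
    using rep_quot[OF x, of "b * s"] by (intro rep_eq[OF x]) (simp add: grp_simps)
  have "carry x (a * rep x (b * s)) * carry x (b * s)
      = \<theta> x (inverse (rep x (a * rep x (b * s))) * (a * rep x (b * s)) * (inverse (rep x (b * s)) * (b * s)))"
    unfolding carry_def using \<theta>_hom[OF x] x by (simp add: hom_on_def)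
  then show "carry x (a * rep x (b * s)) * carry x (b * s) = carry x (a * b * s)"
    by (simp add: e) (simp add: carry_def mult.assoc)
qed

lemma path_mult:
  "a \<in> G \<Longrightarrow> b \<in> G \<Longrightarrow> reduced p \<Longrightarrow> path a (path b p) = path (a * b) p \<and> rem a (path b p) * rem b p = rem (a * b) p"
proof (induction p arbitrary: a b)
  case (Cons q p)
  obtain s x where q: "q = (s, x)" by (cases q)
  then show ?case
    using Cons carry_mult[of x a b s] by simp
qed simp

lemma carry_one: "x \<in> \<Lambda> \<Longrightarrow> rep x s = s \<Longrightarrow> carry x s = 1"
  using hom_on_one[OF \<theta>_hom B] by (simp add: carry_def grp_left_inverse)

lemma path_one: "reduced p \<Longrightarrow> path 1 p = p \<and> rem 1 p = 1"
proof (induction p)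
  case (Cons q p)
  obtain s x where q: "q = (s, x)" by (cases q)
  then show ?case using Cons carry_one[of x s] by simp
qed simp

definition NF :: "(('g \<times> 'l) list \<times> 'g) set" where
  "NF = {p. reduced p} \<times> G"

definition lact :: "'g \<Rightarrow> ('g \<times> 'l) list \<times> 'g \<Rightarrow> ('g \<times> 'l) list \<times> 'g" where
  "lact a = (\<lambda>(p, g). (path a p, rem a p * g))"

definition tact :: "'l \<Rightarrow> ('g \<times> 'l) list \<times> 'g \<Rightarrow> ('g \<times> 'l) list \<times> 'g" where
  "tact x = (\<lambda>(p, g). if starts (1, bar x) p then (tl p, g) else ((1, x) # p, g))"

lemma lact_NF: "a \<in> G \<Longrightarrow> n \<in> NF \<Longrightarrow> lact a n \<in> NF"
  by (auto simp: NF_def lact_def reduced_path rem_in)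

lemma lact_mult: "a \<in> G \<Longrightarrow> b \<in> G \<Longrightarrow> n \<in> NF \<Longrightarrow> lact a (lact b n) = lact (a * b) n"
  using path_mult[of a b "fst n"] by (auto simp: NF_def lact_def mult.assoc[symmetric])

lemma lact_one: "n \<in> NF \<Longrightarrow> lact 1 n = n"
  using path_one[of "fst n"] by (auto simp: NF_def lact_def)

lemma tact_NF: "x \<in> \<Lambda> \<Longrightarrow> n \<in> NF \<Longrightarrow> tact x n \<in> NF"
  by (auto simp: NF_def tact_def starts_def)

lemma tact_bar: "x \<in> \<Lambda> \<Longrightarrow> n \<in> NF \<Longrightarrow> tact (bar x) (tact x n) = n"
  by (auto simp: NF_def tact_def starts_def)

text \<open>The defining relation \<open>b t x = t x \<theta> x b\<close>, as an equality of
  actions on normal forms.\<close>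

lemma lact_tact:
  assumes x: "x \<in> \<Lambda>" and b: "b \<in> B x" and n: "n \<in> NF"
  shows "lact b (tact x n) = tact x (lact (\<theta> x b) n)"
proof -
  obtain p g where pg: "n = (p, g)" by (cases n)
  have p: "reduced p" "g \<in> G" using n pg by (auto simp: NF_def)
  have tb: "\<theta> x b \<in> B (bar x)" using \<theta>_in x b by simp
  have r: "rep x b = 1" "carry x b = \<theta> x b" using rep_eq_one[OF x, of b] b by (auto simp: carry_def)
  have r': "rep (bar x) (\<theta> x b) = 1" "carry (bar x) (\<theta> x b) = b"
    using rep_eq_one[of "bar x" "\<theta> x b"] tb x \<theta>_inverse[OF x b] by (auto simp: carry_def)
  have h: "starts (1, bar x) (path (\<theta> x b) p) \<longleftrightarrow> starts (1, bar x) p"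
    using path_head[of "bar x" "\<theta> x b" p] tb x p by simp
  show ?thesis
  proof (cases "starts (1, bar x) p")
    case True
    then obtain q where q: "p = (1, bar x) # q" by (auto simp: starts_def)
    then show ?thesis by (simp add: pg tact_def lact_def r')
  next
    case False
    then show ?thesis using h by (simp add: pg tact_def lact_def r)
  qed
qed

definition lperm :: "'g \<Rightarrow> (('g \<times> 'l) list \<times> 'g) sym" where
  "lperm a = ext_sym NF (lact a)"

definition tperm :: "'l \<Rightarrow> (('g \<times> 'l) list \<times> 'g) sym" where
  "tperm x = ext_sym NF (tact x)"

lemma sapp_lperm:
  assumes "a \<in> G"
  shows "sapp (lperm a) n = (if n \<in> NF then lact a n else n)"
  unfolding lperm_def
proof (rule sapp_ext_sym, rule bij_betw_byWitness[where f' = "lact (inverse a)"])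
  show "\<forall>n\<in>NF. lact (inverse a) (lact a n) = n" "\<forall>n\<in>NF. lact a (lact (inverse a) n) = n"
    using assms by (auto simp: lact_mult lact_one grp_left_inverse grp_right_inverse)
qed (use assms lact_NF in auto)

lemma sapp_tperm:
  assumes "x \<in> \<Lambda>"
  shows "sapp (tperm x) n = (if n \<in> NF then tact x n else n)"
  unfolding tperm_def
proof (rule sapp_ext_sym, rule bij_betw_byWitness[where f' = "tact (bar x)"])
  show "\<forall>n\<in>NF. tact (bar x) (tact x n) = n" "\<forall>n\<in>NF. tact x (tact (bar x) n) = n"
    using assms tact_bar[of x] tact_bar[of "bar x"] by auto
qed (use assms tact_NF in auto)

lemma lperm_mult: "a \<in> G \<Longrightarrow> b \<in> G \<Longrightarrow> lperm (a * b) = lperm a * lperm b"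
  by (rule sym_eqI) (simp add: sapp_lperm lact_NF lact_mult)

lemma lperm_one: "lperm 1 = 1"
  by (rule sym_eqI) (simp add: sapp_lperm lact_one)

lemma lperm_inverse: "a \<in> G \<Longrightarrow> lperm (inverse a) = inverse (lperm a)"
  using lperm_mult[of a "inverse a"] lperm_one by (simp add: grp_right_inverse grp_inverse_unique)

lemma tperm_bar: "x \<in> \<Lambda> \<Longrightarrow> tperm (bar x) = inverse (tperm x)"
proof -
  assume x: "x \<in> \<Lambda>"
  have "tperm x * tperm (bar x) = 1"
    by (rule sym_eqI) (use x tact_bar[of "bar x"] in \<open>simp add: sapp_tperm tact_NF\<close>)
  then show ?thesis by (simp add: grp_inverse_unique)
qed

lemma lperm_tperm: "x \<in> \<Lambda> \<Longrightarrow> b \<in> B x \<Longrightarrow> lperm b * tperm x = tperm x * lperm (\<theta> x b)"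
  using \<theta>_in[of x b] B_in_G[of "bar x"] bar(1)[of x]
  by (intro sym_eqI) (simp add: sapp_lperm sapp_tperm tact_NF lact_NF lact_tact del: bar)

text \<open>The extension is realised by permutations of its normal forms.\<close>

definition hnn_group :: "(('g \<times> 'l) list \<times> 'g) sym set" where
  "hnn_group = gen (lperm ` G \<union> tperm ` \<Lambda>)"

lemma hnn_group [simp]: "subgrp hnn_group"
  by (simp add: hnn_group_def)

lemma lperm_hnn_group [simp]: "a \<in> G \<Longrightarrow> lperm a \<in> hnn_group" and tperm_hnn_group [simp]: "x \<in> \<Lambda> \<Longrightarrow> tperm x \<in> hnn_group"
  using gen_superset[of "lperm ` G \<union> tperm ` \<Lambda>"] by (auto simp: hnn_group_def)

fun word :: "('g \<times> 'l) list \<Rightarrow> (('g \<times> 'l) list \<times> 'g) sym" where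
  "word [] = 1"
| "word ((s, x) # p) = lperm s * (tperm x * word p)"

definition eval_nf :: "('g \<times> 'l) list \<times> 'g \<Rightarrow> (('g \<times> 'l) list \<times> 'g) sym" where
  "eval_nf = (\<lambda>(p, g). word p * lperm g)"

lemma word_L: "a \<in> G \<Longrightarrow> reduced p \<Longrightarrow> lperm a * word p = word (path a p) * lperm (rem a p)"
proof (induction p arbitrary: a)
  case (Cons q p)
  obtain s x where q: "q = (s, x)" by (cases q)
  then have s: "s \<in> G" "x \<in> \<Lambda>" "reduced p" using Cons by auto
  have b: "inverse (rep x (a * s)) * (a * s) \<in> B x" using s by simp
  then have bG: "inverse (rep x (a * s)) * (a * s) \<in> G" using s(2) B_in_G by blast
  have "lperm (rep x (a * s) * (inverse (rep x (a * s)) * (a * s)))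
      = lperm (rep x (a * s)) * lperm (inverse (rep x (a * s)) * (a * s))"
    by (rule lperm_mult[OF _ bG]) (use Cons.prems s in simp)
  then have "lperm a * lperm s = lperm (rep x (a * s)) * lperm (inverse (rep x (a * s)) * (a * s))"
    using lperm_mult[of a s] Cons.prems s by simp
  then have "lperm a * lperm s * tperm x = lperm (rep x (a * s)) * (tperm x * lperm (carry x (a * s)))"
    using lperm_tperm[OF s(2) b] by (simp add: mult.assoc carry_def)
  then have "lperm a * word (q # p) = lperm (rep x (a * s)) * (tperm x * (lperm (carry x (a * s)) * word p))"
    by (simp add: q mult.assoc[symmetric])
  then show ?case
    using Cons.IH[of "carry x (a * s)"] s by (simp add: q mult.assoc)
qed simp

lemma eval_nf_L: "a \<in> G \<Longrightarrow> n \<in> NF \<Longrightarrow> lperm a * eval_nf n = eval_nf (lact a n)"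
  using word_L[of a "fst n"] lperm_mult[of "rem a (fst n)" "snd n"] rem_in[of a "fst n"]
  by (auto simp: NF_def eval_nf_def lact_def mult.assoc) (simp add: mult.assoc[symmetric])

lemma eval_nf_T: "x \<in> \<Lambda> \<Longrightarrow> n \<in> NF \<Longrightarrow> tperm x * eval_nf n = eval_nf (tact x n)"
  by (auto simp: NF_def eval_nf_def tact_def starts_def lperm_one tperm_bar mult.assoc)

text
  \<open>Evaluation of normal forms is equivariant, because it is so for the generators. This is van der Waerden's argument: an element of the group is determined by the image of the empty normal form.\<close>

lemma hnn_group_act:
  assumes "k \<in> hnn_group"
  shows "(\<forall>n. sapp k n \<in> NF \<longleftrightarrow> n \<in> NF) \<and> (\<forall>n\<in>NF. k * eval_nf n = eval_nf (sapp k n))"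
proof -
  define S where "S = {k. (\<forall>n. sapp k n \<in> NF \<longleftrightarrow> n \<in> NF) \<and> (\<forall>n\<in>NF. k * eval_nf n = eval_nf (sapp k n))}"
  have "hnn_group \<subseteq> S" unfolding hnn_group_def
  proof (rule gen_least)
    show "lperm ` G \<union> tperm ` \<Lambda> \<subseteq> S"
      by (auto simp: S_def sapp_lperm sapp_tperm lact_NF tact_NF eval_nf_L eval_nf_T split: if_splits simp del: split_paired_All)
    show "subgrp S"
      unfolding subgrp_def
    proof (intro conjI ballI)
      show "1 \<in> S" by (simp add: S_def)
      fix k l assume k: "k \<in> S"
      have 1: "sapp (inverse k) n \<in> NF \<longleftrightarrow> n \<in> NF" for n
        using k sapp_inverse(2)[of k n] unfolding S_def by (metis (mono_tags, lifting) mem_Collect_eq)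
      have "inverse k * eval_nf n = eval_nf (sapp (inverse k) n)" if n: "n \<in> NF" for n
      proof -
        have "k * eval_nf (sapp (inverse k) n) = eval_nf (sapp k (sapp (inverse k) n))"
          using k 1 n unfolding S_def by blast
        then show ?thesis by (metis grp_cancel_left sapp_inverse(2))
      qed
      then show "inverse k \<in> S" using 1 by (simp add: S_def)
      assume "l \<in> S"
      then show "k * l \<in> S" using k by (simp add: S_def mult.assoc del: split_paired_All)
    qed
  qed
  then show ?thesis using assms by (auto simp: S_def)
qed

definition base :: "('g \<times> 'l) list \<times> 'g" where "base = ([], 1)"

lemma base_NF [simp]: "base \<in> NF"
  by (simp add: base_def NF_def)

lemma sapp_base [simp]: "k \<in> hnn_group \<Longrightarrow> sapp k base \<in> NF"
  using hnn_group_act base_NF by blast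

lemma eval_nf_sapp_base: 
  assumes "k \<in> hnn_group"
  shows "eval_nf (sapp k base) = k"
proof -
  have "k * eval_nf base = eval_nf (sapp k base)" using hnn_group_act[OF assms] base_NF by blast
  then show ?thesis by (simp add: base_def eval_nf_def lperm_one)
qed

lemma word_base: "reduced p \<Longrightarrow> g \<in> G \<Longrightarrow> sapp (word p) ([], g) = (p, g)"
proof (induction p)
  case (Cons q p)
  obtain s x where q: "q = (s, x)" by (cases q)
  then have s: "s \<in> G" "x \<in> \<Lambda>" "reduced p" "rep x s = s" "\<not> starts (1, bar x) p" using Cons by auto
  then show ?case
    using Cons path_one[of p] carry_one[of x s]
    by (simp add: q sapp_tperm sapp_lperm NF_def tact_def lact_def)
qed simp

lemma sapp_eval_nf: "n \<in> NF \<Longrightarrow> sapp (eval_nf n) base = n"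
  using word_base[of "fst n" "snd n"]
  by (auto simp: eval_nf_def base_def sapp_lperm NF_def lact_def)

text \<open>Distinct representatives stay distinct under multiplication by \<open>a\<close>, so the
  words first differ at the same place as before.\<close>

lemma lcp_path:
  "a \<in> G \<Longrightarrow> reduced p \<Longrightarrow> reduced q \<Longrightarrow> lcp (path a p) (path a q) = lcp p q"
proof (induction p q arbitrary: a rule: lcp.induct)
  case (1 u p w q)
  obtain s x where u: "u = (s, x)" by (cases u)
  obtain r y where w: "w = (r, y)" by (cases w)
  show ?case
  proof (cases "u = w")
    case True
    then show ?thesis using 1 u w by simp
  next
    case False
    have "rep x (a * s) \<noteq> rep x (a * r)" if "x = y"
    proof
      assume e: "rep x (a * s) = rep x (a * r)"
      have x: "x \<in> \<Lambda>" "rep x s = s" "rep x r = r" using 1 u w that by auto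
      have "inverse (rep x (a * s)) * (a * s) \<in> B x" by (rule rep_quot[OF x(1)])
      moreover have "inverse (rep x (a * s)) * (a * r) \<in> B x" unfolding e by (rule rep_quot[OF x(1)])
      ultimately have "inverse (inverse (rep x (a * s)) * (a * s)) * (inverse (rep x (a * s)) * (a * r)) \<in> B x"
        using subgrp_mult[OF B[OF x(1)]] subgrp_inverse[OF B[OF x(1)]] by blast
      then have "inverse s * r \<in> B x" by (simp add: grp_simps)
      from rep_eq[OF x(1) this] show False using x(2,3) False u w that by simp
    qed
    then show ?thesis using False u w by auto
  qed
qed (auto simp: lcp_sym[of "path a p" for a p])

lemma length_path [simp]: "length (path a p) = length p"
  by (induction a p rule: path.induct) auto

text \<open>A letter acts by adding or removing a first entry. If it adds one to \<open>p\<close> and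
  removes one from \<open>q\<close>, there is no common prefix before, and none afterwards since
  \<open>q\<close> is reduced.\<close>

lemma list_dist_T:
  assumes x: "x \<in> \<Lambda>" and n: "n \<in> NF" "m \<in> NF"
  shows "list_dist (fst (tact x n)) (fst (tact x m)) = list_dist (fst n) (fst m)"
proof -
  have *: "list_dist q ((1, x) # p) = list_dist ((1, bar x) # q) p"
    if "reduced ((1, bar x) # q)" "\<not> starts (1, bar x) p" for p q
  proof -
    have "lcp q ((1, x) # p) = 0" using that x by (cases q) auto
    moreover have "lcp ((1, bar x) # q) p = 0" using that by (cases p) auto
    ultimately show ?thesis by (simp add: list_dist_def)
  qed
  have list_dist_sym: "list_dist p q = list_dist q p" for p q :: "('g \<times> 'l) list" by (simp add: list_dist_def lcp_sym[of p q])
  obtain p g q h where pq: "n = (p, g)" "m = (q, h)" by (cases n, cases m)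
  have r: "reduced p" "reduced q" using n pq by (auto simp: NF_def)
  show ?thesis
  proof (cases "starts (1, bar x) p")
    case True
    then obtain p' where p': "p = (1, bar x) # p'" by (auto simp: starts_def)
    show ?thesis
    proof (cases "starts (1, bar x) q")
      case True
      then obtain q' where "q = (1, bar x) # q'" by (auto simp: starts_def)
      then show ?thesis by (simp add: pq p' tact_def list_dist_def)
    next
      case False
      then show ?thesis using *[of p' q] r p' by (simp add: pq tact_def)
    qed
  next
    case p: False
    show ?thesis
    proof (cases "starts (1, bar x) q")
      case True
      then obtain q' where q': "q = (1, bar x) # q'" by (auto simp: starts_def)
      then show ?thesis using *[of q' p] r p by (simp add: pq tact_def list_dist_sym)
    next
      case False
      then show ?thesis using p by (simp add: pq tact_def list_dist_def)
    qed
  qed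
qed

lemma list_dist_hnn_group:
  assumes "k \<in> hnn_group" "n \<in> NF" "m \<in> NF"
  shows "list_dist (fst (sapp k n)) (fst (sapp k m)) = list_dist (fst n) (fst m)"
proof -
  define S where "S = {k \<in> hnn_group. \<forall>n\<in>NF. \<forall>m\<in>NF. list_dist (fst (sapp k n)) (fst (sapp k m)) = list_dist (fst n) (fst m)}"
  have NFact: "sapp k n \<in> NF" if "k \<in> hnn_group" "n \<in> NF" for k n using hnn_group_act that by blast
  have "hnn_group \<subseteq> S" unfolding hnn_group_def
  proof (rule gen_least)
    have "list_dist (fst (lact a n)) (fst (lact a m)) = list_dist (fst n) (fst m)" if "a \<in> G" "n \<in> NF" "m \<in> NF" for a n m
      using lcp_path[of a "fst n" "fst m"] that by (auto simp: NF_def lact_def list_dist_def)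
    then show "lperm ` G \<union> tperm ` \<Lambda> \<subseteq> S"
      by (auto simp: S_def sapp_lperm sapp_tperm list_dist_T)
    show "subgrp S"
      unfolding subgrp_def
    proof (intro conjI ballI)
      show "1 \<in> S" by (simp add: S_def)
      fix k l assume k: "k \<in> S"
      have "list_dist (fst (sapp (inverse k) n)) (fst (sapp (inverse k) m)) = list_dist (fst n) (fst m)"
        if n: "n \<in> NF" "m \<in> NF" for n m
      proof -
        have "sapp (inverse k) n \<in> NF" "sapp (inverse k) m \<in> NF"
          using NFact[of "inverse k"] k n by (auto simp: S_def)
        then have "list_dist (fst (sapp k (sapp (inverse k) n))) (fst (sapp k (sapp (inverse k) m)))
            = list_dist (fst (sapp (inverse k) n)) (fst (sapp (inverse k) m))"
          using k unfolding S_def by blast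
        then show ?thesis by simp
      qed
      then show "inverse k \<in> S" using k by (simp add: S_def)
      assume "l \<in> S"
      then show "k * l \<in> S" using k NFact by (simp add: S_def)
    qed
  qed
  then show ?thesis using assms by (auto simp: S_def)
qed

text \<open>The elements of the group become vertices of the tree of lists through their normal forms; the
  element of \<open>G\<close> at the end is dropped, so cosets of \<open>G\<close> are vertices.\<close>

definition hnn_dist :: "(('g \<times> 'l) list \<times> 'g) sym \<Rightarrow> (('g \<times> 'l) list \<times> 'g) sym \<Rightarrow> int" where
  "hnn_dist k l = list_dist (fst (sapp k base)) (fst (sapp l base))"

lemma hnn_dist_zero:
  assumes "k \<in> hnn_group" "l \<in> hnn_group"
  shows "hnn_dist k l = 0 \<longleftrightarrow> inverse k * l \<in> lperm ` G"
proof -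
  obtain p g q h where pq: "sapp k base = (p, g)" "sapp l base = (q, h)" by (metis surj_pair)
  have n: "reduced p" "g \<in> G" "reduced q" "h \<in> G"
    using sapp_base[OF assms(1)] sapp_base[OF assms(2)] pq by (auto simp: NF_def)
  have kl: "k = word p * lperm g" "l = word q * lperm h"
    using eval_nf_sapp_base[OF assms(1)] eval_nf_sapp_base[OF assms(2)] pq by (auto simp: eval_nf_def)
  have "inverse k * l \<in> lperm ` G" if "p = q"
  proof -
    have "inverse k * l = lperm (inverse g * h)"
      using n by (simp add: kl that lperm_mult lperm_inverse grp_simps)
    then show ?thesis using n by auto
  qed
  moreover have "p = q" if "inverse k * l \<in> lperm ` G"
  proof -
    obtain a where a: "a \<in> G" "inverse k * l = lperm a" using \<open>inverse k * l \<in> lperm ` G\<close> by blast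
    have "l = k * (inverse k * l)" by simp
    also have "\<dots> = word p * lperm (g * a)" unfolding a(2) using n a by (simp add: kl lperm_mult mult.assoc)
    finally have "l = eval_nf (p, g * a)" by (simp add: eval_nf_def)
    then have "sapp l base = (p, g * a)" using sapp_eval_nf[of "(p, g * a)"] n a by (simp add: NF_def)
    then show ?thesis using pq by simp
  qed
  ultimately show ?thesis by (auto simp: hnn_dist_def pq list_dist_zero)
qed

lemma hnn_dist_left: "h \<in> hnn_group \<Longrightarrow> k \<in> hnn_group \<Longrightarrow> l \<in> hnn_group \<Longrightarrow> hnn_dist (h * k) (h * l) = hnn_dist k l"
  by (simp add: hnn_dist_def list_dist_hnn_group)

lemma letter_base: "s \<in> G \<Longrightarrow> x \<in> \<Lambda> \<Longrightarrow> fst (sapp (lperm s * tperm x) base) = [(rep x s, x)]"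
  by (auto simp: base_def NF_def sapp_lperm sapp_tperm tact_def lact_def)

lemma path_cons:
  assumes "k \<in> hnn_group" "fst (sapp k base) = (s, x) # p"
  shows "s \<in> G" "x \<in> \<Lambda>" "rep x s = s" "\<exists>g\<in>G. k = lperm s * (tperm x * (word p * lperm g))"
proof -
  obtain g where g: "sapp k base = ((s, x) # p, g)" using assms(2) by (metis prod.collapse)
  then show s: "s \<in> G" "x \<in> \<Lambda>" "rep x s = s" using sapp_base[OF assms(1)] by (auto simp: NF_def)
  have "g \<in> G" using sapp_base[OF assms(1)] g by (auto simp: NF_def)
  then show "\<exists>g\<in>G. k = lperm s * (tperm x * (word p * lperm g))"
    using eval_nf_sapp_base[OF assms(1)] g by (auto simp: eval_nf_def mult.assoc)
qed

lemma hnn_dist_one: "hnn_dist 1 k = int (length (fst (sapp k base)))"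
  by (simp add: hnn_dist_def base_def list_dist_def)

lemma hnn_dist_step:
  assumes "k \<in> hnn_group" "l \<in> hnn_group" "hnn_dist k l > 0"
  shows "\<exists>m\<in>hnn_group. hnn_dist k m = 1 \<and> hnn_dist m l = hnn_dist k l - 1"
proof -
  define y where "y = inverse k * l"
  have y: "y \<in> hnn_group" "hnn_dist 1 y = hnn_dist k l"
    using assms hnn_dist_left[of "inverse k" k l] by (auto simp: y_def grp_left_inverse)
  obtain s x p where p: "fst (sapp y base) = (s, x) # p"
    using y assms(3) by (cases "fst (sapp y base)") (auto simp: hnn_dist_one)
  note s = path_cons[OF y(1) p]
  define z where "z = lperm s * tperm x"
  have z: "z \<in> hnn_group" using s by (simp add: z_def)
  have zb: "fst (sapp z base) = [(s, x)]" unfolding z_def using letter_base[OF s(1,2)] s(3) by simp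
  have "hnn_dist 1 z = 1" by (simp add: hnn_dist_one zb)
  moreover have "hnn_dist z y = hnn_dist 1 y - 1" unfolding hnn_dist_one by (simp add: hnn_dist_def zb p list_dist_def)
  ultimately show ?thesis
    using hnn_dist_left[of k 1 z] hnn_dist_left[of k z y] y z assms
    by (intro bexI[of _ "k * z"]) (simp_all add: y_def)
qed

end

text \<open>The group \<open>H\<close> acts on a tree with vertex stabiliser \<open>G\<close>. The
  element \<open>t x\<close> moves the base vertex along an edge with stabiliser \<open>B x\<close>;
  every edge is a translate of such an edge.\<close>

locale bass_serre = tree_group H G d for H G :: "'g::grp set" and d +
  fixes \<Lambda> :: "'l set" and bar :: "'l \<Rightarrow> 'l" and t :: "'l \<Rightarrow> 'g" and B :: "'l \<Rightarrow> 'g set"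
  assumes t_in [simp]: "x \<in> \<Lambda> \<Longrightarrow> t x \<in> H"
    and bar_in [simp]: "x \<in> \<Lambda> \<Longrightarrow> bar x \<in> \<Lambda>"
    and t_bar: "x \<in> \<Lambda> \<Longrightarrow> t (bar x) = inverse (t x)"
    and B_subgrp: "x \<in> \<Lambda> \<Longrightarrow> subgrp (B x)"
    and B_sub: "x \<in> \<Lambda> \<Longrightarrow> B x \<subseteq> G"
    and edge_stab: "\<lbrakk>x \<in> \<Lambda>; y \<in> \<Lambda>; g \<in> G; inverse (t x) * g * t y \<in> G\<rbrakk> \<Longrightarrow> x = y \<and> g \<in> B x"
    and B_conj: "x \<in> \<Lambda> \<Longrightarrow> b \<in> B x \<Longrightarrow> inverse (t x) * b * t x \<in> B (bar x)"
    and neighbour: "\<lbrakk>u \<in> H; v \<in> H; d u v = 1\<rbrakk> \<Longrightarrow> \<exists>g\<in>G. \<exists>x\<in>\<Lambda>. d (u * g * t x) v = 0"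
    and d_t: "x \<in> \<Lambda> \<Longrightarrow> d 1 (t x) = 1"

theorem (in hnn_data) bass_serre: "bass_serre hnn_group (lperm ` G) hnn_dist \<Lambda> bar tperm (\<lambda>x. lperm ` B x)"
proof
  show "subgrp hnn_group" by simp
  have hom: "hom_on G lperm" by (simp add: hom_on_def lperm_mult)
  show "subgrp (lperm ` G)" by (rule subgrp_image[OF hom G])
  show "lperm ` G \<subseteq> hnn_group" by auto
  have lp: "lcp p q \<le> length q" for p q :: "'b list" using lcp_le[of q p] lcp_sym[of p q] by simp
  show "0 \<le> hnn_dist x y" for x y
    using lcp_le[of "fst (sapp x base)" "fst (sapp y base)"] lp[of "fst (sapp x base)" "fst (sapp y base)"]
    by (simp add: hnn_dist_def list_dist_def)
  show "hnn_dist x y = hnn_dist y x" for x y by (simp add: hnn_dist_def list_dist_def lcp_sym)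
  show "hnn_dist (h * x) (h * y) = hnn_dist x y" if "h \<in> hnn_group" "x \<in> hnn_group" "y \<in> hnn_group" for h x y
    using hnn_dist_left that by blast
  show "hnn_dist x y = 0 \<longleftrightarrow> inverse x * y \<in> lperm ` G" if "x \<in> hnn_group" "y \<in> hnn_group" for x y
    using hnn_dist_zero that by blast
  show "hnn_dist x y + hnn_dist z w \<le> max (hnn_dist x z + hnn_dist y w) (hnn_dist x w + hnn_dist y z)" for x y z w
    unfolding hnn_dist_def by (rule list_dist_four)
  show "even (hnn_dist x y + hnn_dist y z + hnn_dist x z)" for x y z by (simp add: hnn_dist_def list_dist_def)
  show "\<exists>z\<in>hnn_group. hnn_dist x z = 1 \<and> hnn_dist z y = hnn_dist x y - 1" if "x \<in> hnn_group" "y \<in> hnn_group" "hnn_dist x y > 0" for x y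
    using hnn_dist_step that by blast
  show "tperm x \<in> hnn_group" "bar x \<in> \<Lambda>" "tperm (bar x) = inverse (tperm x)" if "x \<in> \<Lambda>" for x
    using that by (simp_all add: tperm_bar)
  show "subgrp (lperm ` B x)" if "x \<in> \<Lambda>" for x
    using subgrp_image[of "B x" lperm] hom that by (auto simp: hom_on_def)
  show "lperm ` B x \<subseteq> lperm ` G" if "x \<in> \<Lambda>" for x
    using that by auto
  show "hnn_dist 1 (tperm x) = 1" if "x \<in> \<Lambda>" for x
    using letter_base[of 1 x] that by (simp add: hnn_dist_one lperm_one)
  show "inverse (tperm x) * b * tperm x \<in> lperm ` B (bar x)" if x: "x \<in> \<Lambda>" "b \<in> lperm ` B x" for x b
  proof -
    obtain c where c: "c \<in> B x" "b = lperm c" using x by blast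
    then have "inverse (tperm x) * b * tperm x = lperm (\<theta> x c)" using lperm_tperm[of x c] x by (simp add: mult.assoc)
    then show ?thesis using \<theta>_in[of x c] x c by auto
  qed
  show "x = y \<and> g \<in> lperm ` B x"
    if h: "x \<in> \<Lambda>" "y \<in> \<Lambda>" "g \<in> lperm ` G" "inverse (tperm x) * g * tperm y \<in> lperm ` G" for x y g
  proof -
    obtain c where c: "c \<in> G" "g = lperm c" using h by blast
    have "hnn_dist (lperm 1 * tperm x) (lperm c * tperm y) = 0"
      using h c by (subst hnn_dist_zero) (simp_all add: lperm_one mult.assoc)
    then have "[(rep x 1, x)] = [(rep y c, y)]"
      unfolding hnn_dist_def list_dist_zero using letter_base[of 1 x] letter_base[of c y] h c by simp
    then show ?thesis using h c rep_eq_one[of y c] by auto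
  qed
  show "\<exists>g\<in>lperm ` G. \<exists>x\<in>\<Lambda>. hnn_dist (u * g * tperm x) v = 0" if u: "u \<in> hnn_group" "v \<in> hnn_group" "hnn_dist u v = 1" for u v
  proof -
    define y where "y = inverse u * v"
    have y: "y \<in> hnn_group" "hnn_dist 1 y = 1"
      using u hnn_dist_left[of "inverse u" u v] by (auto simp: y_def grp_left_inverse)
    obtain s x p where p: "fst (sapp y base) = (s, x) # p" "p = []"
      using y by (cases "fst (sapp y base)") (auto simp: hnn_dist_one)
    note s = path_cons[OF y(1) p(1)]
    have "hnn_dist (lperm s * tperm x) y = 0"
      unfolding hnn_dist_def using letter_base[OF s(1,2)] s(3) p by (simp add: list_dist_zero)
    then have "hnn_dist (u * lperm s * tperm x) v = 0"
      using hnn_dist_left[of u "lperm s * tperm x" y] u y s by (simp add: y_def mult.assoc)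
    then show ?thesis using s by blast
  qed
qed

lemma (in hnn_data) lperm_inj: "inj_on lperm G"
proof (rule inj_onI)
  fix a b assume "a \<in> G" "b \<in> G" "lperm a = lperm b"
  then have "lact a base = lact b base" using sapp_lperm[of a base] sapp_lperm[of b base] by simp
  then show "a = b" by (simp add: lact_def base_def)
qed

lemma (in hnn_data) hnn_group_card: "hnn_group \<lesssim> lists (G \<times> \<Lambda>) \<times> G"
proof -
  have "inj_on (\<lambda>k. sapp k base) hnn_group"
    by (rule inj_onI) (metis eval_nf_sapp_base)
  moreover have "reduced p \<Longrightarrow> p \<in> lists (G \<times> \<Lambda>)" for p
    by (induction p) auto
  then have "NF \<subseteq> lists (G \<times> \<Lambda>) \<times> G" by (auto simp: NF_def)
  then have "(\<lambda>k. sapp k base) ` hnn_group \<subseteq> lists (G \<times> \<Lambda>) \<times> G" using sapp_base by blast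
  ultimately show ?thesis unfolding lepoll_def by blast
qed

section \<open>Admissible groups\<close>

definition conj_pair :: "'g::grp set \<Rightarrow> 'g \<Rightarrow> 'g \<Rightarrow> 'g \<Rightarrow> 'g \<Rightarrow> bool" where
  "conj_pair S i j r s \<longleftrightarrow> (\<exists>g\<in>S. g * i * inverse g = r \<and> g * j * inverse g = s)"

definition malnormal_pair :: "'g::grp set \<Rightarrow> 'g \<Rightarrow> 'g \<Rightarrow> bool" where
  "malnormal_pair S r s \<longleftrightarrow> (\<exists>r'\<in>Invs S. \<exists>s'\<in>Invs S. r' \<noteq> s' \<and> r \<in> dih r' s' \<and> s \<in> dih r' s' \<and>
     malnormal_in S (dih r' s'))"

lemma malnormal_pairI:
  "\<lbrakk>malnormal_in S (dih r' s'); r' \<in> Invs S; s' \<in> Invs S; r' \<noteq> s'; r \<in> dih r' s'; s \<in> dih r' s'\<rbrakk>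
    \<Longrightarrow> malnormal_pair S r s"
  unfolding malnormal_pair_def by blast

lemma conj_pairI: "g \<in> S \<Longrightarrow> conj_pair S i j (g * i * inverse g) (g * j * inverse g)"
  by (auto simp: conj_pair_def)

lemma conj_pair_trans:
  assumes "subgrp S" "conj_pair S i j r s" "conj_pair S r s r' s'"
  shows "conj_pair S i j r' s'"
proof -
  obtain g h where gh: "g \<in> S" "g * i * inverse g = r" "g * j * inverse g = s"
    "h \<in> S" "h * r * inverse h = r'" "h * s * inverse h = s'"
    using assms(2,3) by (auto simp: conj_pair_def)
  then show ?thesis
    using assms(1) conj_pairI[of "h * g" S i j] by (simp add: grp_inverse_mult mult.assoc[symmetric]) (simp add: mult.assoc)
qed

lemma conj_inverse_cancel: "a * (inverse a * r * a) * inverse a = r" for a r :: "'g::grp"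
  by (simp add: grp_simps)

lemma conj_pair_unconj: "a \<in> S \<Longrightarrow> conj_pair S (inverse a * r * a) (inverse a * s * a) r s"
  unfolding conj_pair_def using conj_inverse_cancel by blast

lemma conj_pair_mono: "S \<subseteq> S' \<Longrightarrow> conj_pair S i j r s \<Longrightarrow> conj_pair S' i j r s"
  by (auto simp: conj_pair_def)

lemma malnormal_pair_conj:
  assumes S: "subgrp S" and m: "malnormal_pair S r s" and c: "conj_pair S r s r' s'"
  shows "malnormal_pair S r' s'"
proof -
  obtain g where g: "g \<in> S" "g * r * inverse g = r'" "g * s * inverse g = s'"
    using c by (auto simp: conj_pair_def)
  obtain a b where ab: "a \<in> Invs S" "b \<in> Invs S" "a \<noteq> b" "r \<in> dih a b" "s \<in> dih a b" "malnormal_in S (dih a b)"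
    using m by (auto simp: malnormal_pair_def)
  show ?thesis
  proof (rule malnormal_pairI)
    show "g * a * inverse g \<in> Invs S" "g * b * inverse g \<in> Invs S" using Invs_conj S g ab by auto
    show "g * a * inverse g \<noteq> g * b * inverse g" using ab by simp
    show "malnormal_in S (dih (g * a * inverse g) (g * b * inverse g))"
      unfolding dih_conj by (rule malnormal_conj[OF S g(1) ab(6)])
    show "r' \<in> dih (g * a * inverse g) (g * b * inverse g)" "s' \<in> dih (g * a * inverse g) (g * b * inverse g)"
      unfolding dih_conj using g ab by auto
  qed
qed

text \<open>The class of groups that all extensions stay in. The involutions \<open>i\<close>,
  \<open>j\<close> are kept throughout. A pair in a malnormal dihedral group is one that can still be
  made conjugate to \<open>(i, j)\<close>. The condition \<open>base_pairs\<close> makes it enough to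
  conjugate a pair into \<open>dih i j\<close>; it holds in the given sharply 2-transitive group and
  concerns a group that never changes.\<close>

locale admissible =
  fixes S :: "'g::grp set" and i j :: 'g
  assumes S [simp]: "subgrp S" and i: "i \<in> Invs S" and j: "j \<in> Invs S" and ij: "i \<noteq> j"
    and inf: "r \<in> Invs S \<Longrightarrow> s \<in> Invs S \<Longrightarrow> r \<noteq> s \<Longrightarrow> inf_ord (r * s)"
    and cent: "g \<in> S \<Longrightarrow> g * i = i * g \<Longrightarrow> g * j = j * g \<Longrightarrow> g = 1"
    and pairs: "r \<in> Invs S \<Longrightarrow> s \<in> Invs S \<Longrightarrow> r \<noteq> s \<Longrightarrow> conj_pair S i j r s \<or> malnormal_pair S r s"
    and base_pairs: "r \<in> Invs (dih i j) \<Longrightarrow> s \<in> Invs (dih i j) \<Longrightarrow> r \<noteq> s \<Longrightarrow> conj_pair S i j r s"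

lemma Invs_image:
  assumes f: "hom_on S f" "inj_on f S" and S: "subgrp S"
  shows "Invs (f ` S) = f ` Invs S"
proof -
  have "f x = 1 \<longleftrightarrow> x = 1" if "x \<in> S" for x
    using hom_on_one[OF f(1) S] inj_on_eq_iff[OF f(2) that subgrp_one[OF S]] by simp
  then show ?thesis
    using hom_on_mult[OF f(1)] subgrp_mult[OF S] by (force simp: Invs_def)
qed

lemma inf_ord_image:
  assumes f: "hom_on S f" "inj_on f S" and S: "subgrp S" and x: "x \<in> S"
  shows "inf_ord (f x) \<longleftrightarrow> inf_ord x"
proof -
  have "f y = 1 \<longleftrightarrow> y = 1" if "y \<in> S" for y
    using hom_on_one[OF f(1) S] inj_on_eq_iff[OF f(2) that subgrp_one[OF S]] by simp
  then show ?thesis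
    using hom_on_power[OF f(1) S x] subgrp_power[OF S x] by (metis inf_ord_def)
qed

lemma dih_image:
  assumes f: "hom_on S f" and S: "subgrp S" and r: "r \<in> S" "s \<in> S"
  shows "dih (f r) (f s) = f ` dih r s"
proof -
  have "f ((r * s) powi k) = (f r * f s) powi k" for k
    using hom_on_powi[OF f S, of "r * s" k] hom_on_mult[OF f r] subgrp_mult[OF S r] by simp
  moreover have "f ((r * s) powi k * r) = f ((r * s) powi k) * f r" for k
    using hom_on_mult[OF f] subgrp_powi[OF S] subgrp_mult[OF S] r by blast
  ultimately show ?thesis by (simp add: dih_def image_Un image_image)
qed

lemma hom_on_conj:
  assumes "hom_on S f" "subgrp S" "g \<in> S" "x \<in> S"
  shows "f (g * x * inverse g) = f g * f x * inverse (f g)"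
  using hom_on_mult[OF assms(1)] hom_on_inverse[OF assms(1,2)] subgrp_mult[OF assms(2)] subgrp_inverse[OF assms(2)] assms(3,4)
  by simp

lemma conj_pair_image:
  assumes f: "hom_on S f" and S: "subgrp S" and "i \<in> S" "j \<in> S" "conj_pair S i j r s"
  shows "conj_pair (f ` S) (f i) (f j) (f r) (f s)"
  using assms by (auto simp: conj_pair_def hom_on_conj)

theorem admissible_image:
  assumes "admissible S i j" and f: "hom_on S f" "inj_on f S"
  shows "admissible (f ` S) (f i) (f j)"
proof -
  interpret admissible S i j by fact
  note I = Invs_image[OF f S]
  have iS: "i \<in> S" "j \<in> S" using i j by (auto simp: Invs_def)
  have D: "dih i j \<subseteq> S" using dih_least[OF _ _ S] InvsD[OF i] InvsD[OF j] by blast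
  show ?thesis
  proof
    show "subgrp (f ` S)" by (rule subgrp_image[OF f(1) S])
    show "f i \<in> Invs (f ` S)" "f j \<in> Invs (f ` S)" unfolding I using i j by auto
    show "f i \<noteq> f j" using ij iS inj_on_eq_iff[OF f(2)] by blast
  next
    fix r s assume rs: "r \<in> Invs (f ` S)" "s \<in> Invs (f ` S)" "r \<noteq> s"
    then obtain a b where ab: "a \<in> Invs S" "b \<in> Invs S" "r = f a" "s = f b" "a \<noteq> b" unfolding I by blast
    then have abS: "a \<in> S" "b \<in> S" by (auto simp: Invs_def)
    have "inf_ord (f (a * b))"
      using inf_ord_image[OF f S] subgrp_mult[OF S abS] inf[OF ab(1,2,5)] by blast
    then show "inf_ord (r * s)" using hom_on_mult[OF f(1) abS] ab by simp
    show "conj_pair (f ` S) (f i) (f j) r s \<or> malnormal_pair (f ` S) r s"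
      using pairs[OF ab(1,2,5)]
    proof
      assume "conj_pair S i j a b"
      then show ?thesis using conj_pair_image[OF f(1) S iS] ab by blast
    next
      assume "malnormal_pair S a b"
      then obtain a' b' where m: "a' \<in> Invs S" "b' \<in> Invs S" "a' \<noteq> b'" "a \<in> dih a' b'" "b \<in> dih a' b'"
        "malnormal_in S (dih a' b')"
        by (auto simp: malnormal_pair_def)
      then have m': "a' \<in> S" "b' \<in> S" by (auto simp: Invs_def)
      have D': "dih a' b' \<subseteq> S" using dih_least[OF _ _ S m'] InvsD[OF m(1)] InvsD[OF m(2)] by blast
      note di = dih_image[OF f(1) S m']
      have "malnormal_in (f ` S) (f ` dih a' b')"
        unfolding malnormal_in_def
      proof (intro ballI impI)
        fix x y assume x: "x \<in> f ` S" and y: "y \<in> f ` dih a' b'" "inf_ord y" and xy: "x * y * inverse x \<in> f ` dih a' b'"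
        obtain u v w where u: "u \<in> S" "x = f u" and v: "v \<in> dih a' b'" "y = f v"
          and w: "w \<in> dih a' b'" "x * y * inverse x = f w" using x y xy by blast
        have "f (u * v * inverse u) = f w" using hom_on_conj[OF f(1) S u(1)] v w D' u by auto
        moreover have "u * v * inverse u \<in> S" "w \<in> S" using u v w D' S by auto
        ultimately have "u * v * inverse u = w" using inj_on_eq_iff[OF f(2)] by blast
        moreover have "inf_ord v" using inf_ord_image[OF f S] v y D' by blast
        ultimately have "u \<in> dih a' b'"
          using m(6) u v w unfolding malnormal_in_def by blast
        then show "x \<in> f ` dih a' b'" using u by blast
      qed
      moreover have "f a' \<noteq> f b'" using inj_on_eq_iff[OF f(2) m'] m by blast
      ultimately have "malnormal_pair (f ` S) r s"
        unfolding malnormal_pair_def I using m(1,2,4,5) ab(3,4)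
        by (intro bexI[of _ "f a'"] bexI[of _ "f b'"] conjI) (auto simp only: di)
      then show ?thesis ..
    qed
  next
    fix g assume g: "g \<in> f ` S" "g * f i = f i * g" "g * f j = f j * g"
    then obtain x where x: "x \<in> S" "g = f x" by blast
    have "x * y = y * x" if "y \<in> S" "g * f y = f y * g" for y
    proof -
      have "f (x * y) = f (y * x)" using that x hom_on_mult[OF f(1)] by simp
      then show ?thesis using inj_on_eq_iff[OF f(2)] subgrp_mult[OF S] x that by blast
    qed
    then have "x * i = i * x" "x * j = j * x" using g iS by blast+
    then have "x = 1" using cent x by blast
    then show "g = 1" using x hom_on_one[OF f(1) S] by simp
  next
    fix r s assume rs: "r \<in> Invs (dih (f i) (f j))" "s \<in> Invs (dih (f i) (f j))" "r \<noteq> s"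
    have "Invs (dih (f i) (f j)) = f ` Invs (dih i j)"
      unfolding dih_image[OF f(1) S iS]
      by (rule Invs_image) (use D f InvsD[OF i] InvsD[OF j] subgrp_dih inj_on_subset in \<open>auto simp: hom_on_def subset_iff\<close>)
    then obtain a b where ab: "a \<in> Invs (dih i j)" "b \<in> Invs (dih i j)" "r = f a" "s = f b" "a \<noteq> b"
      using rs by blast
    then show "conj_pair (f ` S) (f i) (f j) r s"
      using conj_pair_image[OF f(1) S iS] base_pairs by blast
  qed
qed

section \<open>Edge groups and fixed vertices\<close>

context bass_serre
begin

lemma fixes_step:
  assumes y: "y \<in> H" and ab: "a \<in> H" "b \<in> H" "d a (y * a) = 0" "d b (y * b) = 0" "d a b \<ge> 1"
  obtains c where "c \<in> H" "d a c = 1" "d c b = d a b - 1" "d c (y * c) = 0"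
proof -
  obtain c where c: "c \<in> H" "d a c = 1" "d c b = d a b - 1"
    using step[OF ab(1,2)] ab(5) by auto
  then have "d c (y * c) = 0" using fixes_geodesic[OF y ab(1,2) c(1)] ab by simp
  then show thesis using that c by blast
qed

lemma fixes_edge:
  assumes y: "y \<in> H" and ab: "a \<in> H" "b \<in> H" "d a (y * a) = 0" "d b (y * b) = 0" "d a b = 1"
  obtains g x where "g \<in> G" "x \<in> \<Lambda>" "d (a * g * t x) b = 0" "inverse g * (inverse a * y * a) * g \<in> B x"
proof -
  obtain g x where gx: "g \<in> G" "x \<in> \<Lambda>" "d (a * g * t x) b = 0"
    using neighbour[OF ab(1,2,5)] by blast
  define c where "c = a * g * t x"
  have c: "c \<in> H" using gx ab by (simp add: c_def)
  have "d (y * c) (y * b) = 0" using d_left[OF y c ab(2)] gx by (simp add: c_def)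
  then have "d c (y * c) = 0"
    using d_zero_eq(1)[OF c ab(2), of "y * c"] d_zero_eq(2)[of "y * c" "y * b" b] d_sym[of b "y * c"]
      d_sym[of b "y * b"] y c ab gx by (simp add: c_def)
  then have 1: "inverse c * y * c \<in> G" using d_zero[OF c, of "y * c"] y c by (simp add: mult.assoc)
  have "inverse a * y * a \<in> G" using d_zero[OF ab(1), of "y * a"] y ab by (simp add: mult.assoc)
  then have 2: "inverse g * (inverse a * y * a) * g \<in> G" using gx by simp
  have "inverse (t x) * (inverse g * (inverse a * y * a) * g) * t x = inverse c * y * c"
    by (simp add: c_def grp_simps)
  then have "inverse g * (inverse a * y * a) * g \<in> B x"
    using edge_stab[OF gx(2,2) 2] 1 by simp
  then show thesis using that gx by blast
qed

lemma same_edge: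
  assumes "x \<in> \<Lambda>" "g \<in> G" "g' \<in> G" "inverse g * g' \<in> B x" "c \<in> H"
  shows "d (c * g * t x) (c * g' * t x) = 0"
proof -
  have "inverse (c * g * t x) * (c * g' * t x) = inverse (t x) * (inverse g * g') * t x"
    by (simp add: grp_simps)
  moreover have "inverse (t x) * (inverse g * g') * t x \<in> G"
    using B_conj[OF assms(1,4)] B_sub[OF bar_in[OF assms(1)]] by blast
  ultimately show ?thesis using d_zero[of "c * g * t x" "c * g' * t x"] assms by simp
qed

lemma vertex_Invs:
  assumes r: "r \<in> Invs H" and x: "x \<in> H" "d x (r * x) = 0"
  shows "inverse x * r * x \<in> Invs G"
proof -
  have "inverse x * r * x \<in> G" using d_zero[OF x(1), of "r * x"] x InvsD(1)[OF r] by (simp add: mult.assoc)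
  moreover have "inverse x * r * inverse (inverse x) \<in> Invs H"
    by (rule Invs_conj[OF H _ r]) (use x in simp)
  ultimately show ?thesis by (simp add: Invs_def)
qed

lemma stabilised_iff: "y \<in> H \<Longrightarrow> x \<in> H \<Longrightarrow> d (inverse x) (y * inverse x) = 0 \<longleftrightarrow> x * y * inverse x \<in> G"
  using d_zero[of "inverse x" "y * inverse x"] by (simp add: mult.assoc)

lemma fixes_base: "y \<in> G \<Longrightarrow> d 1 (y * 1) = 0"
  using d_zero[of 1 y] by simp

end

locale admissible_ext = bass_serre H G d \<Lambda> bar t B + admissible G i j
  for H G :: "'g::grp set" and d and \<Lambda> :: "'l set" and bar t B i j
begin

lemma vertex_pair_inf:
  assumes rs: "r \<in> Invs H" "s \<in> Invs H" "r \<noteq> s" and x: "x \<in> H" "d x (r * x) = 0" "d x (s * x) = 0"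
  shows "inf_ord (r * s)"
proof -
  have "inf_ord (inverse x * r * x * (inverse x * s * x))"
    using inf[OF vertex_Invs vertex_Invs] rs x by simp
  moreover have "inverse x * r * x * (inverse x * s * x) = inverse x * (r * s) * inverse (inverse x)"
    by (simp add: grp_simps)
  ultimately show ?thesis by (simp only: inf_ord_conj)
qed

lemma ij_rot: "i * j \<in> G" "inf_ord (i * j)" "i * (i * j) * inverse i = inverse (i * j)"
  using i j inf[OF i j ij] InvsD[OF i] InvsD[OF j] rot_flip[of i j] by simp_all

lemma commuting_fixes_base:
  assumes g: "g \<in> H" "g * i = i * g" "g * j = j * g"
  shows "d g (i * j * g) = 0"
proof -
  have "i * j * g = g * (i * j)" using g by (metis mult.assoc)
  then show ?thesis using d_left[of g 1 "i * j"] fixes_base[OF ij_rot(1)] g ij_rot by simp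
qed

end

section \<open>Adjoining involutions that invert cyclic groups\<close>

text \<open>The letter \<open>u x\<close> is an involution inverting the cyclic group
  \<open>B x\<close> generated by \<open>w x\<close>. For \<open>w x = 1\<close> it is a free
  involution. The cyclic groups form a malnormal family in \<open>G\<close>.\<close>

locale inverting_ext = admissible_ext H G d \<Lambda> "\<lambda>x. x" u B i j
  for H G :: "'g::grp set" and d and \<Lambda> :: "'l set" and u B i j +
  fixes w :: "'l \<Rightarrow> 'g"
  assumes B_eq: "x \<in> \<Lambda> \<Longrightarrow> B x = range (\<lambda>k. w x powi k)"
    and w: "x \<in> \<Lambda> \<Longrightarrow> w x = 1 \<or> inf_ord (w x)"
    and flip: "x \<in> \<Lambda> \<Longrightarrow> u x * w x * u x = inverse (w x)"
    and mal: "\<lbrakk>x \<in> \<Lambda>; y \<in> \<Lambda>; g \<in> G; b \<in> B x; b \<noteq> 1; g * b * inverse g \<in> B y\<rbrakk> \<Longrightarrow> x = y \<and> g \<in> B x"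
begin

lemma u_inverse: "x \<in> \<Lambda> \<Longrightarrow> inverse (u x) = u x"
  using t_bar by simp

lemma u_square: "x \<in> \<Lambda> \<Longrightarrow> u x * u x = 1"
  using grp_left_inverse[of "u x"] by (simp add: u_inverse)

lemma u_Invs: "x \<in> \<Lambda> \<Longrightarrow> u x \<in> Invs H"
  using u_square d_t[of x] by (auto simp: Invs_def)

lemma u_powi: "x \<in> \<Lambda> \<Longrightarrow> u x * w x powi k = w x powi (- k) * u x"
  by (rule dihedral_flip[OF u_square flip])

lemma B_torsion_free:
  assumes "x \<in> \<Lambda>" "b \<in> B x" "b * b = 1"
  shows "b = 1"
proof -
  obtain k where k: "b = w x powi k" using assms B_eq by blast
  have "w x powi (k + k) = 1" unfolding powi_add using k assms by simp
  then show ?thesis using w[OF assms(1)] k inf_ord_powi_eq_one[of "w x" "k + k"] by auto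
qed

lemma B_inf_ord: "x \<in> \<Lambda> \<Longrightarrow> b \<in> B x \<Longrightarrow> b \<noteq> 1 \<Longrightarrow> inf_ord b"
  using w[of x] inf_ord_powi[of "w x"] by (auto simp: B_eq) (metis powi_0)

text \<open>A non-trivial element fixing two vertices at distance two would lie in the stabilisers of both
  edges at the vertex in between; by malnormality these edges agree.\<close>

lemma fixed_vertices_adjacent:
  assumes y: "y \<in> H" "y \<noteq> 1" and ab: "a \<in> H" "b \<in> H" "d a (y * a) = 0" "d b (y * b) = 0"
  shows "d a b \<le> 1"
proof (rule ccontr)
  assume far: "\<not> d a b \<le> 1"
  obtain c where c: "c \<in> H" "d a c = 1" "d c b = d a b - 1" "d c (y * c) = 0"
    using fixes_step[OF y(1) ab] far by auto
  obtain e where e: "e \<in> H" "d c e = 1" "d e b = d c b - 1" "d e (y * e) = 0"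
    using fixes_step[OF y(1) c(1) ab(2) c(4) ab(4)] far c by auto
  have ae: "d a e \<noteq> 0" using triangle[OF ab(1) e(1) ab(2)] c e by auto
  have ca: "d c a = 1" using d_sym[OF c(1) ab(1)] c by simp
  obtain g x where gx: "g \<in> G" "x \<in> \<Lambda>" "d (c * g * u x) a = 0" "inverse g * (inverse c * y * c) * g \<in> B x"
    using fixes_edge[OF y(1) c(1) ab(1) c(4) ab(3) ca] .
  obtain g' x' where gx': "g' \<in> G" "x' \<in> \<Lambda>" "d (c * g' * u x') e = 0" "inverse g' * (inverse c * y * c) * g' \<in> B x'"
    using fixes_edge[OF y(1) c(1) e(1) c(4) e(4) e(2)] .
  define b0 where "b0 = inverse g * (inverse c * y * c) * g"
  have b0: "b0 \<in> B x" "b0 \<noteq> 1"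
    using gx y conj_eq_one[of "inverse (c * g)" y] by (simp_all add: b0_def grp_simps)
  have "inverse g' * g * b0 * inverse (inverse g' * g) = inverse g' * (inverse c * y * c) * g'"
    by (simp add: b0_def grp_simps)
  then have c0: "inverse g' * g * b0 * inverse (inverse g' * g) \<in> B x'" using gx'(4) by (simp only:)
  have m: "x = x' \<and> inverse g' * g \<in> B x"
    by (rule mal[OF gx(2) gx'(2) _ b0 c0]) (use gx gx' in simp)
  have 0: "d (c * g' * u x) (c * g * u x) = 0" by (rule same_edge[OF gx(2) gx'(1) gx(1) conjunct2[OF m] c(1)])
  have cg: "c * g' * u x \<in> H" "c * g * u x \<in> H" using gx gx' c by simp_all
  have "d e a = 0"
    using d_zero_eq(1)[OF cg(1) e(1) ab(1)] d_zero_eq(1)[OF cg ab(1) 0] gx gx' m by simp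
  then show False using ae d_sym[OF e(1) ab(1)] by simp
qed

text \<open>An element of \<open>G\<close> inverted by an involution of \<open>G\<close> lies in no edge
  group, because edge groups are malnormal and torsion-free.\<close>

lemma inverted_fixes_only_base:
  assumes y: "y \<in> G" "y \<noteq> 1" and r: "r \<in> Invs G" "r * y * inverse r = inverse y"
    and b: "b \<in> H" "d b (y * b) = 0"
  shows "b \<in> G"
proof (rule ccontr)
  assume "b \<notin> G"
  then have "d 1 b \<noteq> 0" using d_zero[of 1 b] b by simp
  then have pos: "d 1 b \<ge> 1" using d_nonneg[of 1 b] b by simp
  have yH: "y \<in> H" using y by simp
  obtain c where c: "c \<in> H" "d 1 c = 1" "d c (y * c) = 0"
    using fixes_step[OF yH _ b(1) fixes_base[OF y(1)] b(2) pos] by auto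
  obtain g x where gx: "g \<in> G" "x \<in> \<Lambda>" "inverse g * (inverse 1 * y * 1) * g \<in> B x"
    using fixes_edge[OF yH subgrp_one[OF H] c(1) fixes_base[OF y(1)] c(3,2)] .
  define b0 where "b0 = inverse g * y * g"
  have b0: "b0 \<in> B x" "b0 \<noteq> 1"
    using gx y conj_eq_one[of "inverse g" y] by (simp_all add: b0_def)
  define r' where "r' = inverse g * r * g"
  have "inverse g * r * inverse (inverse g) \<in> Invs G"
    by (rule Invs_conj) (use gx r in simp_all)
  then have r': "r' \<in> Invs G" by (simp add: r'_def)
  have "r' * b0 * inverse r' = inverse g * (r * y * inverse r) * g"
    by (simp add: r'_def b0_def grp_simps)
  also have "\<dots> = inverse b0" unfolding r(2) by (simp add: b0_def grp_simps)
  finally have "r' * b0 * inverse r' \<in> B x" using b0 B_subgrp[OF gx(2)] by simp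
  then have "r' \<in> B x" using mal[OF gx(2,2) InvsD(1)[OF r'] b0] by simp
  then show False using B_torsion_free[OF gx(2)] InvsD[OF r'] by blast
qed

text \<open>The stabiliser of an edge is conjugate to \<open>B x\<close> extended by
  \<open>u x\<close>. As \<open>B x\<close> is torsion-free, its involutions lie outside of
  \<open>B x\<close>.\<close>

lemma edge_Invs:
  assumes r: "r \<in> Invs H" and ab: "a \<in> H" "b \<in> H" "preserves_edge r a b"
    and gx: "g \<in> G" "x \<in> \<Lambda>" "d (a * g * u x) b = 0"
  shows "\<exists>k. inverse (a * g) * r * (a * g) = u x * w x powi k"
proof -
  define h where "h = a * g"
  define r' where "r' = inverse h * r * h"
  have h: "h \<in> H" "h * u x \<in> H" using ab gx by (simp_all add: h_def)
  have rH: "r \<in> H" using r by (simp add: Invs_def)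
  have ha: "d a h = 0" using d_left[OF ab(1) subgrp_one[OF H], of g] d_zero[of 1 g] ab gx by (simp add: h_def)
  have hb: "d (h * u x) b = 0" using gx by (simp add: h_def)
  have tr: "d p (r * q) = d p' (r * q')" if "d p p' = 0" "d q q' = 0" "p \<in> H" "q \<in> H" "p' \<in> H" "q' \<in> H" for p q p' q'
    using d_zero_eq(1)[of p p' "r * q"] d_zero_eq(2)[of "r * q" "r * q'" p'] d_left[of r q q'] that rH by simp
  have hb': "d b (h * u x) = 0" using d_sym[OF ab(2) h(2)] hb by simp
  have r'I: "r' \<in> Invs H"
    using Invs_conj[OF H _ r, of "inverse h"] h by (simp add: r'_def)
  \<comment> \<open>Either \<open>r\<close> fixes both ends of the edge, which puts it into the torsion-free \<open>B x\<close>, or it swaps them.\<close>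
  consider "d h (r * h) = 0" "d (h * u x) (r * (h * u x)) = 0"
    | "d h (r * (h * u x)) = 0" "d (h * u x) (r * h) = 0"
    using ab(3) tr[OF ha ha] tr[OF hb' hb'] tr[OF ha hb'] tr[OF hb' ha] ab h
    unfolding preserves_edge_def by auto
  then show ?thesis
  proof cases
    case 1
    have "r' \<in> G" using d_zero[of h "r * h"] 1 h rH by (simp add: r'_def mult.assoc)
    moreover have "inverse (u x) * r' * u x \<in> G"
      using d_zero[of "h * u x" "r * (h * u x)"] 1 h rH by (simp add: r'_def grp_simps)
    ultimately have "r' \<in> B x" using edge_stab[OF gx(2,2)] by blast
    then have False using B_torsion_free[OF gx(2)] InvsD[OF r'I] by blast
    then show ?thesis ..
  next
    case 2
    define g0 where "g0 = u x * r'"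
    have "g0 \<in> G"
      using d_zero[of "h * u x" "r * h"] 2 h rH by (simp add: g0_def r'_def grp_simps u_inverse[OF gx(2)])
    moreover have "inverse (u x) * g0 * u x \<in> G"
      using d_zero[of h "r * (h * u x)"] 2 h rH by (simp add: g0_def r'_def grp_simps)
    ultimately have "g0 \<in> B x" using edge_stab[OF gx(2,2)] by blast
    then obtain k where "g0 = w x powi k" using B_eq[OF gx(2)] by blast
    moreover have "r' = u x * g0" using u_square[OF gx(2)] by (simp add: g0_def mult.assoc[symmetric])
    ultimately show ?thesis by (auto simp: r'_def h_def)
  qed
qed

lemma edge_product: "x \<in> \<Lambda> \<Longrightarrow> u x * w x powi k * (u x * w x powi l) = w x powi (l - k)"
proof -
  assume x: "x \<in> \<Lambda>"
  have "u x * w x powi k * (u x * w x powi l) = w x powi (- k) * (u x * u x) * w x powi l"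
    by (simp only: u_powi[OF x] mult.assoc)
  then show ?thesis using powi_add[of "w x" "- k" l] u_square[OF x] by simp
qed

lemma ext_inf:
  assumes rs: "r \<in> Invs H" "s \<in> Invs H" "r \<noteq> s"
  shows "inf_ord (r * s)"
proof -
  note R = InvsD(1,3)[OF rs(1)] and Q = InvsD(1,3)[OF rs(2)]
  consider (v) x where "x \<in> H" "d x (r * x) = 0" "d x (s * x) = 0"
    | (e) a b where "a \<in> H" "b \<in> H" "d a b = 1" "preserves_edge r a b" "preserves_edge s a b"
    | (h) x L where "hyp (r * s) x L"
    using involutions_trichotomy[OF R Q] by blast
  then show ?thesis
  proof cases
    case v
    then show ?thesis using vertex_pair_inf rs by blast
  next
    case e
    obtain g x where gx: "g \<in> G" "x \<in> \<Lambda>" "d (a * g * u x) b = 0" using neighbour e by blast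
    define h where "h = a * g"
    obtain k l where k: "inverse h * r * h = u x * w x powi k" "inverse h * s * h = u x * w x powi l"
      using edge_Invs[OF rs(1) e(1,2,4) gx] edge_Invs[OF rs(2) e(1,2,5) gx] by (auto simp: h_def)
    have "w x powi k \<noteq> w x powi l"
    proof
      assume "w x powi k = w x powi l"
      then have "inverse h * r * h = inverse h * s * h" using k by simp
      then show False using rs by (simp add: mult.assoc)
    qed
    then have "w x powi (l - k) \<noteq> 1" by (auto simp: powi_diff grp_eq_iff[of "w x powi k"]) (metis grp_cancel_right grp_inverse_unique mult.assoc mult_1_right grp_right_inverse grp_inverse_inverse)
    then have "inf_ord (w x powi (l - k))" using B_inf_ord[OF gx(2)] B_eq[OF gx(2)] by blast
    then have "inf_ord (inverse h * r * h * (inverse h * s * h))"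
      using edge_product[OF gx(2)] k by simp
    then have "inf_ord (inverse h * (r * s) * inverse (inverse h))" by (simp add: grp_simps)
    then show ?thesis by (simp only: inf_ord_conj)
  next
    case h
    then show ?thesis by (rule hyp_inf_ord)
  qed
qed

text \<open>An element of infinite order of \<open>dih r s\<close> is inverted by \<open>r\<close>, so
  it fixes the base vertex only. What conjugates it into \<open>G\<close> therefore fixes the base
  vertex, too.\<close>

lemma malnormal_dih_ext:
  assumes rs: "r \<in> Invs G" "s \<in> Invs G" and m: "malnormal_in G (dih r s)"
  shows "malnormal_in H (dih r s)"
  unfolding malnormal_in_def
proof (intro ballI impI)
  fix x y assume x: "x \<in> H" and y: "y \<in> dih r s" "inf_ord y" and xy: "x * y * inverse x \<in> dih r s"
  note R = InvsD[OF rs(1)] and Q = InvsD[OF rs(2)]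
  have D: "dih r s \<subseteq> G" by (rule dih_least[OF R(3) Q(3) G R(1) Q(1)])
  obtain k where k: "y = (r * s) powi k" using dih_inf_ordE[OF R(3) Q(3) y] by metis
  have "r * y * inverse r = inverse y"
    using flip_powi[OF R(3) Q(3), of k] R by (simp add: k mult.assoc powi_minus)
  then have "inverse x \<in> G"
    using inverted_fixes_only_base[of y r "inverse x"] D y rs(1) x xy stabilised_iff[of y x] inf_ord_ne(1)
    by auto
  then have "x \<in> G" using subgrp_inverse[OF G, of "inverse x"] by simp
  then show "x \<in> dih r s" using m y xy by (auto simp: malnormal_in_def)
qed

text \<open>A non-trivial element of \<open>B x\<close> fixes the two ends of one edge and nothing
  else. What conjugates it into \<open>B x\<close> preserves this edge.\<close>

lemma malnormal_edge:
  assumes x: "x \<in> \<Lambda>" and wi: "inf_ord (w x)"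
  shows "malnormal_in H (dih (u x) (u x * w x))"
  unfolding malnormal_in_def
proof (intro ballI impI)
  let ?D = "dih (u x) (u x * w x)"
  note U = u_square[OF x]
  have uw: "u x * (u x * w x) = w x" using U by (simp add: mult.assoc[symmetric])
  have W: "u x * w x * (u x * w x) = 1" using edge_product[OF x, of 1 1] by simp
  have uH: "u x \<in> H" using x by simp
  note DG = dih_gens[OF U W] and DS = subgrp_dih[OF U W]
  have BD: "b \<in> ?D" if "b \<in> B x" for b using dihI(1)[of "u x" "u x * w x"] that B_eq[OF x] by (auto simp: uw)
  fix z y assume z: "z \<in> H" and y: "y \<in> ?D" "inf_ord y" and zy: "z * y * inverse z \<in> ?D"
  obtain m where m: "y = w x powi m" using dih_inf_ordE[OF U W y] unfolding uw by metis
  have "inf_ord (z * y * inverse z)" using y by (simp add: inf_ord_conj)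
  then obtain l where l: "z * y * inverse z = w x powi l" using dih_inf_ordE[OF U W zy] unfolding uw by metis
  define y2 where "y2 = z * y * inverse z"
  have yB: "y \<in> B x" "y2 \<in> B x" using m l B_eq[OF x] by (auto simp: y2_def)
  have yG: "y \<in> G" "y2 \<in> G" using yB B_sub[OF x] by auto
  have y1: "y \<noteq> 1" "y2 \<noteq> 1" using inf_ord_ne(1) y \<open>inf_ord (z * y * inverse z)\<close> by (auto simp: y2_def)
  have fu: "d (u x) (b * u x) = 0" if "b \<in> B x" for b
  proof -
    have "inverse (u x) * b * u x \<in> G" using B_conj[OF x that] B_sub[OF x] by auto
    then show ?thesis using d_zero[OF uH, of "b * u x"] that B_sub[OF x] uH by (auto simp: mult.assoc)
  qed
  have "y2 * z = z * y" by (simp add: y2_def grp_simps)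
  then have fz: "d z (y2 * z) = 0" using d_left[of z 1 y] fixes_base[OF yG(1)] z yG by simp
  have y2H: "y2 \<in> H" using yG by simp
  have 1: "d 1 z \<le> 1"
    by (rule fixed_vertices_adjacent[OF y2H y1(2) _ z fixes_base[OF yG(2)] fz]) simp
  have 2: "d (u x) z \<le> 1"
    by (rule fixed_vertices_adjacent[OF y2H y1(2) uH z fu[OF yB(2)] fz])
  have "even (d 1 (u x) + d (u x) z + d 1 z)" using parity[of 1 "u x" z] uH z by simp
  then have "d 1 z = 0 \<or> d (u x) z = 0"
    using 1 2 d_t[OF x] d_nonneg[of 1 z] d_nonneg[of "u x" z] uH z by (cases "d 1 z = 1"; cases "d (u x) z = 1") auto
  then show "z \<in> ?D"
  proof
    assume "d 1 z = 0"
    then have "z \<in> G" using d_zero[of 1 z] z by simp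
    then show ?thesis using mal[OF x x _ yB(1) y1(1)] yB(2) BD by (simp add: y2_def)
  next
    assume "d (u x) z = 0"
    then have uz: "u x * z \<in> G" using d_zero[OF uH z] by (simp add: u_inverse[OF x])
    have "u x * z * y * inverse (u x * z) = u x * (z * y * inverse z) * u x"
      by (simp add: grp_simps u_inverse[OF x])
    also have "\<dots> = w x powi (- l)" unfolding l u_powi[OF x] by (simp add: mult.assoc U)
    finally have "u x * z * y * inverse (u x * z) \<in> B x" using B_eq[OF x] by blast
    then have "u x * z \<in> ?D" using mal[OF x x uz yB(1) y1(1)] BD by blast
    then show ?thesis using subgrp_mult_left_iff[OF DS DG(1)] by simp
  qed
qed

theorem admissible: "admissible H i j"
proof
  show "subgrp H" by simp
  have GI: "Invs G \<subseteq> Invs H" by (auto simp: Invs_def)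
  show "i \<in> Invs H" "j \<in> Invs H" using i j GI by auto
  show "i \<noteq> j" by (rule ij)
  show "inf_ord (r * s)" if "r \<in> Invs H" "s \<in> Invs H" "r \<noteq> s" for r s
    by (rule ext_inf[OF that])
  show "g = 1" if g: "g \<in> H" "g * i = i * g" "g * j = j * g" for g
  proof -
    have "g \<in> G"
      by (rule inverted_fixes_only_base[OF ij_rot(1) inf_ord_ne(1)[OF ij_rot(2)] i ij_rot(3) g(1) commuting_fixes_base[OF g]])
    then show ?thesis using cent g by blast
  qed
  show "conj_pair H i j r s" if "r \<in> Invs (dih i j)" "s \<in> Invs (dih i j)" "r \<noteq> s" for r s
    using base_pairs[OF that] conj_pair_mono[OF GH] by blast
  show "conj_pair H i j r s \<or> malnormal_pair H r s" if rs: "r \<in> Invs H" "s \<in> Invs H" "r \<noteq> s" for r s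
  proof -
    note R = InvsD(1,3)[OF rs(1)] and Q = InvsD(1,3)[OF rs(2)]
    consider (v) x where "x \<in> H" "d x (r * x) = 0" "d x (s * x) = 0"
      | (e) a b where "a \<in> H" "b \<in> H" "d a b = 1" "preserves_edge r a b" "preserves_edge s a b"
      | (h) x L where "hyp (r * s) x L"
      using involutions_trichotomy[OF R Q] by blast
    then show ?thesis
    proof cases
      case v
      define r' s' where "r' = inverse x * r * x" and "s' = inverse x * s * x"
      have I: "r' \<in> Invs G" "s' \<in> Invs G" "r' \<noteq> s'"
        using vertex_Invs rs v by (auto simp: r'_def s'_def)
      have c: "conj_pair H r' s' r s" unfolding r'_def s'_def by (rule conj_pair_unconj[OF v(1)])
      show ?thesis
        using pairs[OF I]
      proof
        assume "conj_pair G i j r' s'"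
        then show ?thesis using conj_pair_mono[OF GH] conj_pair_trans[OF H _ c] by blast
      next
        assume "malnormal_pair G r' s'"
        then have "malnormal_pair H r' s'"
          unfolding malnormal_pair_def using malnormal_dih_ext GI by blast
        then show ?thesis using malnormal_pair_conj[OF H _ c] by blast
      qed
    next
      case e
      obtain g x where gx: "g \<in> G" "x \<in> \<Lambda>" "d (a * g * u x) b = 0" using neighbour e by blast
      define h where "h = a * g"
      have h: "h \<in> H" using gx e by (simp add: h_def)
      obtain k l where k: "inverse h * r * h = u x * w x powi k" "inverse h * s * h = u x * w x powi l"
        using edge_Invs[OF rs(1) e(1,2,4) gx] edge_Invs[OF rs(2) e(1,2,5) gx] by (auto simp: h_def)
      have "w x \<noteq> 1"
      proof
        assume "w x = 1"
        then have "inverse h * r * h = inverse h * s * h" using k by simp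
        then show False using rs by (simp add: mult.assoc)
      qed
      then have wi: "inf_ord (w x)" using w[OF gx(2)] by simp
      note U = u_square[OF gx(2)]
      have uw: "u x * (u x * w x) = w x" using U by (simp add: mult.assoc[symmetric])
      have D: "u x * w x powi m \<in> dih (u x) (u x * w x)" for m
        using dihI(2)[of "u x" "u x * w x" "- m"] u_powi[OF gx(2), of m] by (simp add: uw)
      have uwI: "u x * w x \<in> Invs H"
      proof -
        have "w x \<in> B x" using B_eq[OF gx(2)] powi_1[of "w x"] by (metis rangeI)
        then have "w x \<in> H" using B_sub[OF gx(2)] by auto
        moreover have "u x * w x \<noteq> 1"
          using grp_inverse_unique[of "u x" "w x"] u_inverse[OF gx(2)] U inf_ord_ne(2)[OF wi] by auto
        ultimately show ?thesis using edge_product[OF gx(2), of 1 1] gx by (simp add: Invs_def)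
      qed
      have "u x \<noteq> u x * w x" using \<open>w x \<noteq> 1\<close> by (metis grp_left_cancel mult_1_right)
      then have "malnormal_pair H (inverse h * r * h) (inverse h * s * h)"
        unfolding k by (rule malnormal_pairI[OF malnormal_edge[OF gx(2) wi] u_Invs[OF gx(2)] uwI _ D D])
      then show ?thesis using malnormal_pair_conj[OF H _ conj_pair_unconj[OF h]] by blast
    next
      case h
      have f3: "y * y = 1"
        if "y \<in> H" "a \<in> H" "b \<in> H" "d a (y * a) = 0" "d b (y * b) = 0" "d a b \<ge> 3" for y a b
        using fixed_vertices_adjacent[of y a b] that by fastforce
      have "\<exists>q\<in>Invs H. q \<noteq> r \<and> s \<in> dih r q \<and> malnormal_in H (dih r q)"
      proof (rule hyperbolic_pair_in_malnormal_dih[OF rs(1,2) h])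
        show "y * y = 1"
          if "y \<in> H" "a \<in> H" "b \<in> H" "d a (y * a) = 0" "d b (y * b) = 0" "d a b \<ge> 3" for y a b
          by (rule f3[OF that])
        show "inf_ord (a * b)" if "a \<in> Invs H" "b \<in> Invs H" "a \<noteq> b" for a b
          by (rule ext_inf[OF that])
      qed
      then obtain q where q: "q \<in> Invs H" "q \<noteq> r" "s \<in> dih r q" "malnormal_in H (dih r q)"
        by blast
      have "r \<in> dih r q" by (rule dih_gens(1)[OF InvsD(3)[OF rs(1)] InvsD(3)[OF q(1)]])
      then have "malnormal_pair H r s" using malnormal_pairI[OF q(4) rs(1) q(1)] q by auto
      then show ?thesis ..
    qed
  qed
qed

end

section \<open>Adjoining letters that conjugate dihedral groups\<close>

text \<open>For \<open>k \<in> R\<close> the letter \<open>t (k, True)\<close> conjugates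
  \<open>B (k, False)\<close> to \<open>dih i j\<close>, and \<open>t (k, False)\<close> is its
  inverse. So, inside the stabiliser of one of its ends, the stabiliser of an edge looks like
  \<open>dih i j\<close>, and inside the stabiliser of the other end it looks like some
  \<open>B (k, False)\<close>. The condition \<open>edges\<close> says that two different edges at a
  vertex are fixed by a common element of infinite order only if both stabilisers look like
  \<open>dih i j\<close> there.\<close>

locale conjugating_ext = admissible_ext H G d "R \<times> UNIV" "\<lambda>(k, b). (k, \<not> b)" t B i j
  for H G :: "'g::grp set" and d and R :: "'k set" and t B i j +
  assumes B_True: "k \<in> R \<Longrightarrow> B (k, True) = dih i j"
    and B_square: "x \<in> R \<times> UNIV \<Longrightarrow> b \<in> B x \<Longrightarrow> inf_ord b \<or> b * b = 1"
    and edges: "\<lbrakk>x \<in> R \<times> UNIV; y \<in> R \<times> UNIV; g \<in> G; b \<in> B x; inf_ord b; g * b * inverse g \<in> B y\<rbrakk>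
      \<Longrightarrow> x = y \<and> g \<in> B x \<or> snd x \<and> snd y"
    and cover: "\<lbrakk>r \<in> Invs G; s \<in> Invs G; r \<noteq> s\<rbrakk> \<Longrightarrow> conj_pair G i j r s \<or>
      (\<exists>k\<in>R. \<exists>r'\<in>B (k, False). \<exists>s'\<in>B (k, False). conj_pair G r' s' r s)"
begin

text \<open>An edge that leaves \<open>c\<close> by \<open>t (k, True)\<close> leaves its other end by
  \<open>t (k, False)\<close>.\<close>

lemma no_return:
  assumes "k \<in> R" "l \<in> R" "c \<in> H" "a \<in> H" "g \<in> G" "g' \<in> G"
  shows "\<not> (d (c * g * t (k, True)) a = 0 \<and> d (a * g' * t (l, True)) c = 0)"
proof
  assume z: "d (c * g * t (k, True)) a = 0 \<and> d (a * g' * t (l, True)) c = 0"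
  define g1 where "g1 = inverse (c * g * t (k, True)) * a"
  define g2 where "g2 = inverse (a * g' * t (l, True)) * c"
  have g1: "g1 \<in> G" using d_zero[of "c * g * t (k, True)" a] z assms by (simp add: g1_def)
  have g2: "g2 \<in> G" using d_zero[of "a * g' * t (l, True)" c] z assms by (simp add: g2_def)
  have tF: "inverse (t (k, False)) = t (k, True)" using t_bar[of "(k, True)"] assms by simp
  have "a = c * g * t (k, True) * g1" by (simp add: g1_def grp_simps)
  then have "g2 = inverse (c * g * t (k, True) * g1 * g' * t (l, True)) * c" by (simp add: g2_def)
  also have "\<dots> = inverse (t (k, True) * (g1 * g') * t (l, True)) * inverse g" by (simp add: grp_simps)
  finally have "inverse (g2 * g) = t (k, True) * (g1 * g') * t (l, True)" by (simp add: grp_simps)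
  moreover have "inverse (g2 * g) \<in> G" using g2 assms by simp
  ultimately have "inverse (t (k, False)) * (g1 * g') * t (l, True) \<in> G" by (simp add: tF)
  then show False using edge_stab[of "(k, False)" "(l, True)" "g1 * g'"] assms g1 by simp
qed

text \<open>If an element of infinite order fixes two different neighbours of a vertex, then both edges
  leave that vertex by a conjugate of \<open>dih i j\<close>.\<close>

lemma fixes_two_neighbours:
  assumes y: "y \<in> H" "inf_ord y" and c: "c \<in> H" "d c (y * c) = 0"
    and a: "a \<in> H" "d c a = 1" "d a (y * a) = 0"
    and e: "e \<in> H" "d c e = 1" "d e (y * e) = 0" and ae: "d a e \<noteq> 0"
  obtains k g where "k \<in> R" "g \<in> G" "d (c * g * t (k, True)) a = 0"
proof -
  obtain g x where gx: "g \<in> G" "x \<in> R \<times> UNIV" "d (c * g * t x) a = 0" "inverse g * (inverse c * y * c) * g \<in> B x"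
    using fixes_edge[OF y(1) c(1) a(1) c(2) a(3) a(2)] .
  obtain g' x' where gx': "g' \<in> G" "x' \<in> R \<times> UNIV" "d (c * g' * t x') e = 0" "inverse g' * (inverse c * y * c) * g' \<in> B x'"
    using fixes_edge[OF y(1) c(1) e(1) c(2) e(3) e(2)] .
  define b0 where "b0 = inverse g * (inverse c * y * c) * g"
  have b0: "b0 \<in> B x" "inf_ord b0"
    using gx y inf_ord_conj[of "inverse (c * g)" y] by (simp_all add: b0_def grp_simps)
  have "inverse g' * g * b0 * inverse (inverse g' * g) = inverse g' * (inverse c * y * c) * g'"
    by (simp add: b0_def grp_simps)
  then have c0: "inverse g' * g * b0 * inverse (inverse g' * g) \<in> B x'" using gx'(4) by (simp only:)
  have "x = x' \<and> inverse g' * g \<in> B x \<or> snd x \<and> snd x'"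
    by (rule edges[OF gx(2) gx'(2) _ b0 c0]) (use gx gx' in simp)
  moreover have False if "x = x' \<and> inverse g' * g \<in> B x"
  proof -
    have 0: "d (c * g' * t x) (c * g * t x) = 0"
      by (rule same_edge[OF gx(2) gx'(1) gx(1) conjunct2[OF that] c(1)])
    have cg: "c * g' * t x \<in> H" "c * g * t x \<in> H" using gx gx' c by simp_all
    have "d e a = 0"
      using d_zero_eq(1)[OF cg(1) e(1) a(1)] d_zero_eq(1)[OF cg a(1) 0] gx gx' that by simp
    then show False using ae d_sym[OF e(1) a(1)] by simp
  qed
  ultimately have "snd x" by blast
  then show thesis using that[of "fst x" g] gx by (cases x) auto
qed

text \<open>On a path of three edges fixed by an element of infinite order, the middle edge would leave
  both of its ends by a letter \<open>t (k, True)\<close>, against \<open>no_return\<close>. Elements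
  of finite order of edge groups have order at most two.\<close>

lemma fixes_far_square:
  assumes y: "y \<in> H" and ab: "a \<in> H" "b \<in> H" "d a (y * a) = 0" "d b (y * b) = 0" "d a b \<ge> 3"
  shows "y * y = 1"
proof (rule ccontr)
  assume y2: "y * y \<noteq> 1"
  obtain p where p: "p \<in> H" "d a p = 1" "d p b = d a b - 1" "d p (y * p) = 0"
    using fixes_step[OF y ab(1-4)] ab by auto
  obtain q where q: "q \<in> H" "d p q = 1" "d q b = d p b - 1" "d q (y * q) = 0"
    using fixes_step[OF y p(1) ab(2) p(4) ab(4)] p ab by auto
  obtain e where e: "e \<in> H" "d q e = 1" "d e b = d q b - 1" "d e (y * e) = 0"
    using fixes_step[OF y q(1) ab(2) q(4) ab(4)] p q ab by auto
  obtain g x where gx: "g \<in> G" "x \<in> R \<times> UNIV" "inverse g * (inverse a * y * a) * g \<in> B x"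
    using fixes_edge[OF y ab(1) p(1) ab(3) p(4,2)] .
  have yi: "inf_ord y"
  proof -
    have "inverse g * (inverse a * y * a) * g = inverse (a * g) * y * inverse (inverse (a * g))"
      by (simp add: grp_simps)
    then have "inf_ord (inverse (a * g) * y * inverse (inverse (a * g))) \<or>
        inverse (a * g) * y * inverse (inverse (a * g)) * (inverse (a * g) * y * inverse (inverse (a * g))) = 1"
      using B_square[OF gx(2,3)] by (simp only:)
    then show ?thesis unfolding conj_mult conj_eq_one inf_ord_conj using y2 by blast
  qed
  have aq: "d q a \<noteq> 0" using triangle[OF ab(1) q(1) ab(2)] d_sym[OF ab(1) q(1)] p q by auto
  have pe: "d p e \<noteq> 0" using triangle[OF p(1) e(1) ab(2)] q e by auto
  have pa: "d p a = 1" using d_sym[OF p(1) ab(1)] p by simp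
  have qp: "d q p = 1" using d_sym[OF q(1) p(1)] q by simp
  obtain k g1 where k: "k \<in> R" "g1 \<in> G" "d (p * g1 * t (k, True)) q = 0"
    using fixes_two_neighbours[OF y yi p(1,4) q(1,2,4) ab(1) pa ab(3) aq] .
  obtain l g2 where l: "l \<in> R" "g2 \<in> G" "d (q * g2 * t (l, True)) p = 0"
    using fixes_two_neighbours[OF y yi q(1,4) p(1) qp p(4) e(1,2,4) pe] .
  show False using no_return[OF k(1) l(1) p(1) q(1) k(2) l(2)] k l by blast
qed

text \<open>An inverted edge would need a letter that is its own inverse.\<close>

lemma no_inversion:
  assumes r: "r \<in> H" and ab: "a \<in> H" "b \<in> H" "d a b = 1" "preserves_edge r a b"
  shows "d a (r * a) = 0"
proof (rule ccontr)
  assume "d a (r * a) \<noteq> 0"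
  then have sw: "d a (r * b) = 0" "d b (r * a) = 0" using ab(4) by (auto simp: preserves_edge_def)
  obtain g x where gx: "g \<in> G" "x \<in> R \<times> UNIV" "d (a * g * t x) b = 0" using neighbour ab by blast
  define g1 where "g1 = inverse b * (r * a)"
  define g2 where "g2 = inverse a * (r * b)"
  define g3 where "g3 = inverse (a * g * t x) * b"
  have m: "a * g * t x \<in> H" using gx ab by simp
  have g: "g1 \<in> G" "g2 \<in> G" "g3 \<in> G"
    using d_zero[of b "r * a"] d_zero[of a "r * b"] d_zero[OF m ab(2)] sw gx ab r
    by (simp_all add: g1_def g2_def g3_def)
  have b: "b = a * g * t x * g3" by (simp add: g3_def grp_simps)
  have "t x * (g3 * g1 * g) * t x * g3 = inverse g * g2"
    by (simp add: g1_def g2_def b grp_simps)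
  then have "t x * (g3 * g1 * g) * t x = inverse g * g2 * inverse g3"
    by (metis grp_right_inverse mult.assoc mult_1_right)
  moreover have "inverse g * g2 * inverse g3 \<in> G" using g gx by simp
  ultimately have *: "t x * (g3 * g1 * g) * t x \<in> G" by simp
  obtain k c where x: "x = (k, c)" by (cases x)
  have "inverse (t (k, \<not> c)) = t x" using t_bar[OF gx(2)] x by simp
  then show False
    using edge_stab[of "(k, \<not> c)" x "g3 * g1 * g"] * g gx x by auto
qed

text \<open>The letter \<open>t (k, False)\<close> carries a pair in \<open>B (k, False)\<close>
  into \<open>dih i j\<close>, where all pairs are conjugate.\<close>

lemma G_pairs:
  assumes rs: "r \<in> Invs G" "s \<in> Invs G" "r \<noteq> s"
  shows "conj_pair H i j r s"
  using cover[OF rs]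
proof
  assume "conj_pair G i j r s"
  then show ?thesis using conj_pair_mono[OF GH] by blast
next
  assume "\<exists>k\<in>R. \<exists>r'\<in>B (k, False). \<exists>s'\<in>B (k, False). conj_pair G r' s' r s"
  then obtain k r' s' where k: "k \<in> R" and rs': "r' \<in> B (k, False)" "s' \<in> B (k, False)" "conj_pair G r' s' r s"
    by blast
  obtain g where g: "g \<in> G" "g * r' * inverse g = r" "g * s' * inverse g = s"
    using rs'(3) by (auto simp: conj_pair_def)
  define \<tau> where "\<tau> = t (k, False)"
  have \<tau>: "\<tau> \<in> H" using k by (simp add: \<tau>_def)
  define r2 s2 where "r2 = inverse \<tau> * r' * \<tau>" and "s2 = inverse \<tau> * s' * \<tau>"
  have D: "r2 \<in> dih i j" "s2 \<in> dih i j"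
    using B_conj[of "(k, False)"] B_True[OF k] k rs' by (auto simp: r2_def s2_def \<tau>_def)
  have GI: "Invs G \<subseteq> Invs H" by (auto simp: Invs_def)
  have e: "r2 = inverse (g * \<tau>) * r * inverse (inverse (g * \<tau>))" "s2 = inverse (g * \<tau>) * s * inverse (inverse (g * \<tau>))"
    unfolding g(2,3)[symmetric] r2_def s2_def by (simp_all add: grp_simps)
  have "r2 \<in> Invs H" "s2 \<in> Invs H" unfolding e using Invs_conj[OF H, of "inverse (g * \<tau>)"] g \<tau> rs GI by auto
  then have I: "r2 \<in> Invs (dih i j)" "s2 \<in> Invs (dih i j)" using D by (auto simp: Invs_def)
  have "r2 \<noteq> s2" unfolding e using rs by simp
  then have 1: "conj_pair H i j r2 s2" using base_pairs[OF I] conj_pair_mono[OF GH] by blast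
  have 2: "conj_pair H r2 s2 r' s'" unfolding r2_def s2_def by (rule conj_pair_unconj[OF \<tau>])
  have 3: "conj_pair H r' s' r s" using rs'(3) conj_pair_mono[OF GH] by blast
  show ?thesis using conj_pair_trans[OF H conj_pair_trans[OF H 1 2] 3] .
qed

lemma involution_dichotomy:
  assumes rs: "r \<in> Invs H" "s \<in> Invs H"
  obtains (v) x where "x \<in> H" "d x (r * x) = 0" "d x (s * x) = 0" | (h) x L where "hyp (r * s) x L"
proof -
  note R = InvsD(1,3)[OF rs(1)] and Q = InvsD(1,3)[OF rs(2)]
  show thesis
    using involutions_trichotomy[OF R Q] no_inversion[OF R(1)] no_inversion[OF Q(1)] that by blast
qed

lemma ext_inf:
  assumes rs: "r \<in> Invs H" "s \<in> Invs H" "r \<noteq> s"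
  shows "inf_ord (r * s)"
  using rs(1,2)
proof (cases rule: involution_dichotomy)
  case v
  then show ?thesis using vertex_pair_inf rs by blast
next
  case h
  then show ?thesis by (rule hyp_inf_ord)
qed

text \<open>Suppose that \<open>g\<close> commutes with \<open>i\<close> and \<open>j\<close> but moves
  the base vertex. Then \<open>i j\<close> fixes the base vertex and its image under \<open>g\<close>.
  The path between them leaves the base vertex by a letter \<open>t (k, True)\<close> and cannot
  continue from there, so \<open>g\<close> moves the base vertex along one such edge. The same holds for
  the inverse of \<open>g\<close>, which moves it along the reversed edge.\<close>

lemma ext_cent:
  assumes g: "g \<in> H" "g * i = i * g" "g * j = j * g"
  shows "g = 1"
proof -
  define y where "y = i * j"
  have y: "y \<in> H" "y \<in> G" "inf_ord y" using ij_rot by (simp_all add: y_def)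
  have yD: "y \<in> dih i j" using dihI(1)[of i j 1] by (simp add: y_def)
  have y1: "d 1 (y * 1) = 0" using fixes_base[OF y(2)] .
  have adj: "\<exists>k\<in>R. \<exists>a\<in>G. d (1 * a * t (k, True)) h = 0"
    if h: "h \<in> H" "h * i = i * h" "h * j = j * h" "h \<notin> G" for h
  proof -
    have yh: "d h (y * h) = 0" unfolding y_def by (rule commuting_fixes_base[OF h(1-3)])
    have pos: "d 1 h \<ge> 1" using d_zero[of 1 h] d_nonneg[of 1 h] h by auto
    obtain c where c: "c \<in> H" "d 1 c = 1" "d c h = d 1 h - 1" "d c (y * c) = 0"
      using fixes_step[OF y(1) _ h(1) y1 yh pos] by auto
    obtain a x where ax: "a \<in> G" "x \<in> R \<times> UNIV" "d (1 * a * t x) c = 0" "inverse a * (inverse 1 * y * 1) * a \<in> B x"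
      using fixes_edge[OF y(1) _ c(1) y1 c(4,2)] by auto
    obtain k b where x: "x = (k, b)" by (cases x)
    have k: "k \<in> R" using ax x by simp
    have "(k, True) = x \<and> inverse a \<in> B (k, True) \<or> snd (k, True) \<and> snd x"
      by (rule edges[OF _ ax(2) _ _ y(3)]) (use ax k yD B_True in simp_all)
    then have x': "x = (k, True)" using x by auto
    have "d 1 h = 1"
    proof (rule ccontr)
      assume "d 1 h \<noteq> 1"
      then have "d c h \<ge> 1" using pos c by simp
      then obtain e where e: "e \<in> H" "d c e = 1" "d e h = d c h - 1" "d e (y * e) = 0"
        using fixes_step[OF y(1) c(1) h(1) c(4) yh] by auto
      have c1: "d c 1 = 1" using d_sym[of c 1] c by simp
      have "d 1 e \<noteq> 0" using triangle[of 1 e h] e c h by auto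
      then obtain l g' where l: "l \<in> R" "g' \<in> G" "d (c * g' * t (l, True)) 1 = 0"
        using fixes_two_neighbours[OF y(1,3) c(1,4) _ c1 y1 e(1,2,4)] by auto
      then show False using no_return[OF k l(1) _ c(1) ax(1) l(2)] ax x' by simp
    qed
    then have "d c h = 0" using c by simp
    then have "d (1 * a * t x) h = 0"
      using d_zero_eq(1)[of "1 * a * t x" c h] ax c h by simp
    then show ?thesis using ax x' k by blast
  qed
  have "g \<in> G"
  proof (rule ccontr)
    assume nG: "g \<notin> G"
    then have nG': "inverse g \<notin> G" using subgrp_inverse[OF G, of "inverse g"] by auto
    have ci: "inverse g * z = z * inverse g" if "g * z = z * g" for z
      using that by (metis grp_cancel_left grp_right_inverse mult.assoc mult_1_right)
    obtain k a where k: "k \<in> R" "a \<in> G" "d (1 * a * t (k, True)) g = 0" using adj[OF g nG] by blast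
    obtain l b where l: "l \<in> R" "b \<in> G" "d (1 * b * t (l, True)) (inverse g) = 0"
      using adj[OF _ ci[OF g(2)] ci[OF g(3)] nG'] g by auto
    have "d (g * b * t (l, True)) 1 = 0"
      using d_left[OF g(1), of "b * t (l, True)" "inverse g"] l g by (simp add: grp_simps)
    then show False using no_return[OF k(1) l(1) _ g(1) k(2) l(2)] k by simp
  qed
  then show "g = 1" using cent g by blast
qed

theorem admissible: "admissible H i j"
proof
  show "subgrp H" by simp
  have GI: "Invs G \<subseteq> Invs H" by (auto simp: Invs_def)
  show "i \<in> Invs H" "j \<in> Invs H" using i j GI by auto
  show "i \<noteq> j" by (rule ij)
  show "inf_ord (r * s)" if "r \<in> Invs H" "s \<in> Invs H" "r \<noteq> s" for r s
    by (rule ext_inf[OF that])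
  show "g = 1" if "g \<in> H" "g * i = i * g" "g * j = j * g" for g
    by (rule ext_cent[OF that])
  show "conj_pair H i j r s" if "r \<in> Invs (dih i j)" "s \<in> Invs (dih i j)" "r \<noteq> s" for r s
    using base_pairs[OF that] conj_pair_mono[OF GH] by blast
  show "conj_pair H i j r s \<or> malnormal_pair H r s" if rs: "r \<in> Invs H" "s \<in> Invs H" "r \<noteq> s" for r s
    using rs(1,2)
  proof (cases rule: involution_dichotomy)
    case (v x)
    have "conj_pair H i j (inverse x * r * x) (inverse x * s * x)"
      using G_pairs[OF vertex_Invs vertex_Invs] rs v by auto
    then show ?thesis using conj_pair_trans[OF H _ conj_pair_unconj[OF v(1)]] by blast
  next
    case (h x L)
    have "\<exists>q\<in>Invs H. q \<noteq> r \<and> s \<in> dih r q \<and> malnormal_in H (dih r q)"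
    proof (rule hyperbolic_pair_in_malnormal_dih[OF rs(1,2) h])
      show "y * y = 1"
        if "y \<in> H" "a \<in> H" "b \<in> H" "d a (y * a) = 0" "d b (y * b) = 0" "d a b \<ge> 3" for y a b
        by (rule fixes_far_square[OF that])
      show "inf_ord (a * b)" if "a \<in> Invs H" "b \<in> Invs H" "a \<noteq> b" for a b
        by (rule ext_inf[OF that])
    qed
    then obtain q where q: "q \<in> Invs H" "q \<noteq> r" "s \<in> dih r q" "malnormal_in H (dih r q)" by blast
    have "r \<in> dih r q" by (rule dih_gens(1)[OF InvsD(3)[OF rs(1)] InvsD(3)[OF q(1)]])
    then have "malnormal_pair H r s" using malnormal_pairI[OF q(4) rs(1) q(1)] q by auto
    then show ?thesis ..
  qed
qed

end

section \<open>Free involutions\<close>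

text \<open>The cyclic groups generated by the elements of \<open>W\<close> are malnormal, and no
  non-trivial elements of two different ones are conjugate. In particular no \<open>w \<in> W\<close>
  is conjugate to its inverse.\<close>

definition malnormal_family :: "'g::grp set \<Rightarrow> 'g set \<Rightarrow> bool" where
  "malnormal_family S W \<longleftrightarrow> W \<subseteq> S \<and> (\<forall>w\<in>W. inf_ord w) \<and>
    (\<forall>w\<in>W. \<forall>w'\<in>W. \<forall>g\<in>S. \<forall>k l. k \<noteq> 0 \<longrightarrow> g * w powi k * inverse g = w' powi l \<longrightarrow>
      w = w' \<and> g \<in> range (\<lambda>m. w powi m))"

text \<open>If \<open>p powi N\<close> moves \<open>g\<close> by no more than its translation length,
  then \<open>g\<close> lies on the axis of \<open>p\<close>. For translation length one this axis is
  the orbit of \<open>v\<close>.\<close>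

lemma (in tree_group) locate_on_axis:
  assumes h: "hyp p v 1" and g: "g \<in> H" and N: "d g (p powi N * g) = N" "d v g < N"
  shows "\<exists>k. d g (p powi k * v) = 0"
proof -
  have pv: "p \<in> H" "v \<in> H" using h by (auto simp: hyp_def)
  define P where "P = p powi N * v"
  define Q where "Q = p powi (- N) * v"
  have m: "P \<in> H" "Q \<in> H" "p powi N * g \<in> H" using pv g by (auto simp: P_def Q_def)
  have N0: "N > 0" using N d_nonneg[OF pv(2) g] by linarith
  have vP: "d v P = N" using hyp_dist[OF h, of 0 N] N0 by (simp add: P_def)
  have QP: "d Q P = 2 * N" using hyp_dist[OF h, of "- N" N] N0 by (simp add: P_def Q_def)
  have 1: "d P (p powi N * g) = d v g" using d_left[of "p powi N" v g] pv g by (simp add: P_def)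
  have "p powi N * Q = v" by (simp add: Q_def powi_minus)
  then have 2: "d v (p powi N * g) = d Q g" using d_left[of "p powi N" Q g] pv g m by simp
  have S: "d Q g + d g P = 2 * N"
    using four[OF pv(2) m(1) g m(3)] four[OF pv(2) m(3) m(1) g] vP N 1 2
      d_sym[OF g m(1)] d_sym[OF g m(3)] d_sym[OF m(1) m(3)] d_sym[OF pv(2) g]
    by (auto simp: max_def split: if_splits)
  define k where "k = d Q g - N"
  have "d Q (p powi k * v) = d Q g" "d (p powi k * v) P = d g P"
    using hyp_dist[OF h, of "- N" k] hyp_dist[OF h, of k N] S d_nonneg[OF m(2) g] d_nonneg[OF g m(1)]
    by (auto simp: k_def Q_def P_def)
  note D = this
  have "d g (p powi k * v) = 0"
  proof (rule same_position[OF m(2,1) g])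
    show "p powi k * v \<in> H" using pv by simp
    show "d Q g + d g P = d Q P" "d Q (p powi k * v) + d (p powi k * v) P = d Q P"
      "d Q g = d Q (p powi k * v)"
      using D S QP by linarith+
  qed
  then show ?thesis ..
qed

locale free_ext = inverting_ext H G d \<Lambda> u B i j "\<lambda>_. 1"
  for H G :: "'g::grp set" and d and \<Lambda> :: "'l set" and u B i j +
  fixes c :: "'l \<Rightarrow> 'g"
  assumes c_in [simp]: "x \<in> \<Lambda> \<Longrightarrow> c x \<in> G" and c_square: "x \<in> \<Lambda> \<Longrightarrow> c x * c x \<noteq> 1"
begin

lemma B_trivial: "x \<in> \<Lambda> \<Longrightarrow> b \<in> B x \<longleftrightarrow> b = 1"
  by (auto simp: B_eq)

text \<open>The path from the base vertex by \<open>u x\<close> backtracks after one step only if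
  \<open>c x\<close> lies in the trivial edge group.\<close>

lemma hyp_uc:
  assumes x: "x \<in> \<Lambda>"
  shows "hyp (u x * c x) 1 1"
proof -
  let ?v = "u x * c x"
  have v: "?v \<in> H" using x by simp
  have 0: "d (u x) ?v = 0" using d_zero[of "u x" ?v] x v by simp
  have 1: "d 1 ?v = 1" using d_zero_eq(2)[of "u x" ?v 1] 0 x d_t[OF x] by simp
  have 2: "d ?v (?v * ?v) = 1" using d_left[OF v, of 1 ?v] 1 v by simp
  have "even (d 1 ?v + d ?v (?v * ?v) + d 1 (?v * ?v))" using parity[of 1 ?v "?v * ?v"] v by simp
  then have "even (d 1 (?v * ?v))" using 1 2 by simp
  moreover have "d 1 (?v * ?v) \<le> 2" using triangle[of 1 ?v "?v * ?v"] 1 2 v by simp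
  moreover have "d 1 (?v * ?v) \<noteq> 0"
  proof
    assume "d 1 (?v * ?v) = 0"
    then have "?v * ?v * inverse (c x) \<in> G" using d_zero[of 1 "?v * ?v"] v x by simp
    then have "inverse (u x) * c x * u x \<in> G" by (simp add: u_inverse[OF x] grp_simps)
    then have "c x = 1" using edge_stab[OF x x c_in[OF x]] B_trivial[OF x] by simp
    then show False using c_square[OF x] by simp
  qed
  moreover have "d 1 (?v * ?v) \<ge> 0" using d_nonneg v by simp
  ultimately have "d 1 (?v * ?v) = 2" by presburger
  then show ?thesis using 1 v by (simp add: hyp_def)
qed

text \<open>Let \<open>g\<close> conjugate a power of \<open>v = u x * c x\<close> to a power of
  \<open>v' = u x' * c x'\<close>. It carries the axis of \<open>v\<close> to that of
  \<open>v'\<close>. After multiplication with a power of \<open>v'\<close> it fixes the base vertex, so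
  it is an element \<open>g0\<close> of \<open>G\<close> matching the two edges of both axes there. If
  directions are kept, the edge groups being trivial forces \<open>x = x'\<close> and
  \<open>g0 = 1\<close>. If they are reversed, it forces \<open>x = x'\<close> and
  \<open>c x = g0 = inverse (c x)\<close>, which \<open>c_square\<close> excludes.\<close>

theorem malnormal_uc: "malnormal_family H ((\<lambda>x. u x * c x) ` \<Lambda>)"
  unfolding malnormal_family_def
proof (intro conjI ballI allI impI)
  show "(\<lambda>x. u x * c x) ` \<Lambda> \<subseteq> H" by auto
  show "inf_ord v" if "v \<in> (\<lambda>x. u x * c x) ` \<Lambda>" for v
    using hyp_inf_ord[OF hyp_uc] that by blast
  fix v v' g k l
  assume v: "v \<in> (\<lambda>x. u x * c x) ` \<Lambda>" and v': "v' \<in> (\<lambda>x. u x * c x) ` \<Lambda>" and g: "g \<in> H"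
    and k: "k \<noteq> 0" and e: "g * v powi k * inverse g = v' powi l"
  obtain x where x: "x \<in> \<Lambda>" "v = u x * c x" using v by blast
  obtain x' where x': "x' \<in> \<Lambda>" "v' = u x' * c x'" using v' by blast
  have h: "hyp v 1 1" "hyp v' 1 1" using hyp_uc x x' by auto
  have vH: "v \<in> H" "v' \<in> H" using x x' by auto
  have kl: "\<bar>k\<bar> = \<bar>l\<bar>" by (rule conj_power_length[OF h g e])
  \<comment> \<open>An element conjugating powers of \<open>v\<close> to powers of \<open>v'\<close> sends the base vertex to the axis of \<open>v'\<close>.\<close>
  have loc: "\<exists>q. d z (v' powi q) = 0" if z: "z \<in> H" "z * v powi k * inverse z = v' powi l" for z
  proof -
    define n where "n = d 1 z + 1"
    have n: "n \<ge> 1" using d_nonneg[of 1 z] z by (simp add: n_def)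
    define N where "N = \<bar>l\<bar> * n"
    have "z * v powi (k * (n * sgn l)) * inverse z = v' powi N"
      using powi_conj[of z "v powi k" "n * sgn l"] z(2) by (simp add: powi_mult N_def abs_sgn ac_simps)
    then have "v' powi N * z = z * v powi (k * (n * sgn l))"
      by (metis grp_left_inverse mult.assoc mult_1_right)
    then have "d z (v' powi N * z) = d 1 (v powi (k * (n * sgn l)))"
      using d_left[OF z(1), of 1 "v powi (k * (n * sgn l))"] vH by simp
    also have "\<dots> = N" using hyp_dist[OF h(1), of 0 "k * (n * sgn l)"] kl n k
      by (simp add: N_def abs_mult abs_sgn_eq)
    finally have 1: "d z (v' powi N * z) = N" .
    have "N \<ge> n" using n k kl by (simp add: N_def mult_le_cancel_right1)
    then have 2: "d 1 z < N" by (simp add: n_def)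
    show ?thesis using locate_on_axis[OF h(2) z(1) 1 2] by simp
  qed
  \<comment> \<open>Dividing by a power of \<open>v'\<close> makes \<open>g\<close> fix the base vertex.\<close>
  obtain q where q: "d g (v' powi q) = 0" using loc[OF g e] by blast
  define g0 where "g0 = v' powi (- q) * g"
  have g0H: "g0 \<in> H" using vH g by (simp add: g0_def)
  have "d (v' powi q) g = 0" using d_sym[OF g, of "v' powi q"] q vH by simp
  then have g0: "g0 \<in> G" using d_zero[of "v' powi q" g] vH g by (simp add: g0_def powi_minus)
  have e0: "g0 * v powi k * inverse g0 = v' powi l"
  proof -
    have "g0 * v powi k * inverse g0 = v' powi (- q) * (g * v powi k * inverse g) * inverse (v' powi (- q))"
      by (simp add: g0_def grp_simps)
    also have "\<dots> = v' powi (- q) * v' powi l * v' powi q" unfolding e by (simp add: powi_minus)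
    also have "\<dots> = v' powi (- q + l + q)" by (simp only: powi_add)
    finally show ?thesis by simp
  qed
  have shift: "\<exists>q. \<bar>q\<bar> = 1 \<and> d (g0 * v powi \<epsilon>) (v' powi q) = 0" if \<epsilon>: "\<bar>\<epsilon>\<bar> = 1" for \<epsilon>
  proof -
    have z: "g0 * v powi \<epsilon> \<in> H" using g0H vH by simp
    have "g0 * v powi \<epsilon> * v powi k * inverse (g0 * v powi \<epsilon>) = g0 * (v powi \<epsilon> * v powi k * inverse (v powi \<epsilon>)) * inverse g0"
      by (simp add: grp_simps)
    also have "v powi \<epsilon> * v powi k * inverse (v powi \<epsilon>) = v powi k"
      by (simp add: powi_commute[of v \<epsilon> k] mult.assoc grp_right_inverse)
    finally have "g0 * v powi \<epsilon> * v powi k * inverse (g0 * v powi \<epsilon>) = v' powi l" using e0 by simp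
    from loc[OF z this] obtain q where q: "d (g0 * v powi \<epsilon>) (v' powi q) = 0" by blast
    have "d 1 g0 = 0" using d_zero[of 1 g0] g0 by simp
    then have "d 1 (g0 * v powi \<epsilon>) = d (g0 * 1) (g0 * v powi \<epsilon>)" using d_zero_eq(1)[of 1 g0] g0H z by simp
    also have "\<dots> = 1" using d_left[OF g0H, of 1 "v powi \<epsilon>"] hyp_dist[OF h(1), of 0 \<epsilon>] \<epsilon> vH by simp
    finally have "d 1 (v' powi q) = 1" using d_zero_eq(2)[OF z _ subgrp_one[OF H] q] vH by simp
    then show ?thesis using q hyp_dist[OF h(2), of 0 q] by auto
  qed
  have inG: "inverse a * b \<in> G" if "d a b = 0" "a \<in> H" "b \<in> H" for a b using d_zero that by blast
  have vi: "inverse v = inverse (c x) * u x" "inverse v' = inverse (c x') * u x'"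
    using x x' by (simp_all add: grp_inverse_mult u_inverse)
  \<comment> \<open>The two neighbours of the base vertex on the axis of \<open>v\<close> go to those on the axis of \<open>v'\<close>.\<close>
  obtain q1 where q1: "\<bar>q1\<bar> = 1" "d (g0 * v) (v' powi q1) = 0" using shift[of 1] by auto
  obtain q2 where q2: "\<bar>q2\<bar> = 1" "d (g0 * v powi (- 1)) (v' powi q2) = 0" using shift[of "- 1"] by auto
  have m: "g0 * v \<in> H" "g0 * v powi (- 1) \<in> H" "v' powi q1 \<in> H" "v' powi q2 \<in> H"
    using g0H vH by auto
  have "d (v' powi q1) (v' powi q2) = d (g0 * v) (g0 * v powi (- 1))"
    using d_zero_eq(1)[OF m(1,3,4) q1(2)] d_zero_eq(2)[OF m(2,4,1) q2(2)] by simp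
  also have "\<dots> = 2" using d_left[OF g0H, of v "v powi (- 1)"] hyp_dist[OF h(1), of 1 "- 1"] vH by simp
  finally have q12: "\<bar>q1 - q2\<bar> = 2" using hyp_dist[OF h(2), of q1 q2] by simp
  show "v = v'" "g \<in> range (\<lambda>m. v powi m)"
  proof -
    have "v = v' \<and> g \<in> range (\<lambda>m. v powi m)"
      if "q1 = 1 \<or> q1 = - 1 \<and> q2 = 1"
      using that
    proof
      assume "q1 = 1"
      then have "c x * (inverse (g0 * v) * v') * inverse (c x') \<in> G" using inG[OF q1(2)] m x x' by simp
      then have "inverse (u x) * inverse g0 * u x' \<in> G" by (simp add: x x' grp_simps)
      then have "x = x' \<and> inverse g0 \<in> B x" using edge_stab[OF x(1) x'(1), of "inverse g0"] subgrp_inverse[OF G g0] by blast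
      then have xx: "x = x'" "g0 = 1" using B_trivial[OF x(1)] by auto
      then have "g = v' powi q" by (simp add: g0_def powi_minus) (metis grp_cancel_right mult_1_right)
      then show ?thesis using xx x x' by auto
    next
      assume q: "q1 = - 1 \<and> q2 = 1"
      then have "c x * (inverse (g0 * v) * v' powi (- 1)) \<in> G" using inG[OF q1(2)] m x by simp
      then have "inverse (u x) * (inverse g0 * inverse (c x')) * u x' \<in> G" by (simp add: x vi grp_simps)
      then have "x = x' \<and> inverse g0 * inverse (c x') \<in> B x" using edge_stab[OF x(1) x'(1)]
          subgrp_mult[OF G subgrp_inverse[OF G g0] subgrp_inverse[OF G c_in[OF x'(1)]]] by blast
      then have xx: "x = x'" "inverse g0 * inverse (c x) = 1" using B_trivial[OF x(1)] by auto
      have g0c: "g0 = inverse (c x)" using xx(2) grp_inverse_unique[of "inverse g0" "inverse (c x)"] by simp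
      have "inverse (g0 * v powi (- 1)) * v' * inverse (c x') \<in> G" using inG[OF q2(2)] m q x' by simp
      then have "inverse (u x) * (c x * inverse g0) * u x' \<in> G" by (simp add: vi x' grp_simps)
      then have "c x * inverse g0 \<in> B x" using edge_stab[OF x(1) x'(1)]
          subgrp_mult[OF G c_in[OF x(1)] subgrp_inverse[OF G g0]] by blast
      then have "c x * c x = 1" using B_trivial[OF x(1)] g0c by simp
      then show ?thesis using c_square[OF x(1)] by simp
    qed
    moreover have "q1 = 1 \<or> q1 = - 1 \<and> q2 = 1" using q1(1) q2(1) q12 by linarith
    ultimately show "v = v'" "g \<in> range (\<lambda>m. v powi m)" by auto
  qed
qed

end

section \<open>The three extension steps\<close>

definition embeds :: "'g::grp set \<Rightarrow> ('g \<Rightarrow> 'h::grp) \<Rightarrow> 'h set \<Rightarrow> bool" where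
  "embeds S f S' \<longleftrightarrow> hom_on S f \<and> inj_on f S \<and> f ` S \<subseteq> S'"

lemma embedsD: "embeds S f S' \<Longrightarrow> hom_on S f" "embeds S f S' \<Longrightarrow> inj_on f S" "embeds S f S' \<Longrightarrow> x \<in> S \<Longrightarrow> f x \<in> S'"
  by (auto simp: embeds_def)

lemma embeds_compose:
  assumes f: "embeds S f S'" and g: "embeds S' g S''"
  shows "embeds S (g \<circ> f) S''"
  unfolding embeds_def
proof (intro conjI)
  show "hom_on S (g \<circ> f)"
    using hom_on_mult[OF embedsD(1)[OF f]] hom_on_mult[OF embedsD(1)[OF g]] embedsD(3)[OF f]
    by (simp add: hom_on_def)
  show "inj_on (g \<circ> f) S"
    using comp_inj_on[OF embedsD(2)[OF f] inj_on_subset[OF embedsD(2)[OF g], of "f ` S"]] f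
    unfolding embeds_def by blast
  show "(g \<circ> f) ` S \<subseteq> S''" using f g unfolding embeds_def image_comp[symmetric] by blast
qed

lemma embeds_Invs: "embeds S f S' \<Longrightarrow> subgrp S \<Longrightarrow> r \<in> Invs S \<Longrightarrow> f r \<in> Invs S'"
proof -
  assume f: "embeds S f S'" and "subgrp S" "r \<in> Invs S"
  then have "f r \<in> Invs (f ` S)" using Invs_image[OF embedsD(1,2)[OF f]] by blast
  moreover have "f ` S \<subseteq> S'" using f by (simp add: embeds_def)
  ultimately show ?thesis by (auto simp: Invs_def)
qed

lemma subgrp_cyclic: "subgrp (range (\<lambda>k. w powi k))" for w :: "'g::grp"
  unfolding subgrp_def
proof (intro conjI ballI)
  show "1 \<in> range (\<lambda>k. w powi k)" by (rule range_eqI[of _ _ 0]) simp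
  fix x assume "x \<in> range (\<lambda>k. w powi k)"
  then obtain k where k: "x = w powi k" by blast
  then show "inverse x \<in> range (\<lambda>k. w powi k)" by (intro range_eqI[of _ _ "- k"]) (simp add: powi_minus)
  fix y assume "y \<in> range (\<lambda>k. w powi k)"
  then obtain l where "y = w powi l" by blast
  then show "x * y \<in> range (\<lambda>k. w powi k)" using k by (intro range_eqI[of _ _ "k + l"]) (simp add: powi_add)
qed

text \<open>Realises \<open>inverting_ext\<close> over a given group. The properties of the edge groups
  carry over from \<open>S\<close> to its image.\<close>

lemma inverting_extension:
  fixes S :: "'g::grp set" and w :: "'l \<Rightarrow> 'g" and \<Lambda> :: "'l set"
  assumes A: "admissible S i j"
    and wS: "\<And>x. x \<in> \<Lambda> \<Longrightarrow> w x \<in> S" and w: "\<And>x. x \<in> \<Lambda> \<Longrightarrow> w x = 1 \<or> inf_ord (w x)"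
    and mal: "\<And>x y g k l. \<lbrakk>x \<in> \<Lambda>; y \<in> \<Lambda>; g \<in> S; w x powi k \<noteq> 1; g * w x powi k * inverse g = w y powi l\<rbrakk>
      \<Longrightarrow> x = y \<and> g \<in> range (\<lambda>m. w x powi m)"
  obtains H :: "(('g \<times> 'l) list \<times> 'g) sym set" and f d u B
  where "embeds S f H" "inverting_ext H (f ` S) d \<Lambda> u B (f i) (f j) (\<lambda>x. f (w x))"
    "H \<lesssim> lists (S \<times> \<Lambda>) \<times> S"
proof -
  interpret A: admissible S i j by fact
  let ?B = "\<lambda>x. range (\<lambda>k. w x powi k)"
  interpret D: hnn_data S \<Lambda> "\<lambda>x. x" ?B "\<lambda>x. inverse"
  proof
    fix x assume x: "x \<in> \<Lambda>"
    show sB: "subgrp (?B x)" by (rule subgrp_cyclic)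
    show "?B x \<subseteq> S" using wS[OF x] by auto
    show "inverse b \<in> ?B x" if "b \<in> ?B x" for b using subgrp_inverse[OF sB that] .
    show "hom_on (?B x) inverse"
      by (auto simp: hom_on_def grp_inverse_mult[symmetric] powi_commute)
  qed simp_all
  define H f d u B where "H = D.hnn_group" and "f = D.lperm" and "d = D.hnn_dist" and "u = D.tperm" and "B = (\<lambda>x. f ` ?B x)"
  have hom: "hom_on S f" by (simp add: hom_on_def f_def D.lperm_mult)
  have inj: "inj_on f S" unfolding f_def by (rule D.lperm_inj)
  have emb: "embeds S f H" using hom inj by (auto simp: embeds_def H_def f_def)
  note hp = hom_on_powi[OF hom A.S]
  have adm: "admissible (f ` S) (f i) (f j)" by (rule admissible_image[OF A hom inj])
  have bs: "bass_serre H (f ` S) d \<Lambda> (\<lambda>x. x) u B"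
    unfolding H_def f_def d_def u_def B_def by (rule D.bass_serre)
  have "inverting_ext H (f ` S) d \<Lambda> u B (f i) (f j) (\<lambda>x. f (w x))"
  proof (intro inverting_ext.intro admissible_ext.intro bs adm inverting_ext_axioms.intro)
    fix x assume x: "x \<in> \<Lambda>"
    show Bx: "B x = range (\<lambda>k. f (w x) powi k)" by (simp add: B_def image_image hp[OF wS[OF x]])
    show "f (w x) = 1 \<or> inf_ord (f (w x))"
      using w[OF x] hom_on_one[OF hom A.S] inf_ord_image[OF hom inj A.S wS[OF x]] by auto
    have "w x \<in> ?B x" by (rule range_eqI[of _ _ 1]) simp
    then have e: "f (w x) * u x = u x * f (inverse (w x))" unfolding f_def u_def by (rule D.lperm_tperm[OF x])
    have "u x * u x = 1" using D.tperm_bar[OF x] grp_left_inverse[of "u x"] by (simp add: u_def)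
    then have "u x * f (w x) * u x = f (inverse (w x))" by (simp add: e mult.assoc) (simp add: mult.assoc[symmetric])
    then show "u x * f (w x) * u x = inverse (f (w x))" using hom_on_inverse[OF hom A.S wS[OF x]] by simp
    fix y g b assume y: "y \<in> \<Lambda>" and g: "g \<in> f ` S" and b: "b \<in> B x" "b \<noteq> 1" and c: "g * b * inverse g \<in> B y"
    obtain a where a: "a \<in> S" "g = f a" using g by blast
    obtain k where k: "b = f (w x powi k)" using b by (auto simp: B_def)
    obtain l where l: "g * b * inverse g = f (w y powi l)" using c by (auto simp: B_def)
    have wk: "w x powi k \<in> S" "w y powi l \<in> S" using wS x y by auto
    have "f (a * w x powi k * inverse a) = f (w y powi l)"
      using hom_on_conj[OF hom A.S a(1) wk(1)] l k a by simp
    then have "a * w x powi k * inverse a = w y powi l"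
      using inj_on_eq_iff[OF inj _ wk(2)] a wk by simp
    moreover have "w x powi k \<noteq> 1" using b k hom_on_one[OF hom A.S] by auto
    ultimately have "x = y \<and> a \<in> ?B x" using mal[OF x y a(1)] by blast
    then show "x = y \<and> g \<in> B x" using a by (auto simp: B_def)
  qed
  moreover have "H \<lesssim> lists (S \<times> \<Lambda>) \<times> S" unfolding H_def by (rule D.hnn_group_card)
  ultimately show thesis using that emb by blast
qed

text \<open>One free involution for each \<open>h\<close> with \<open>h * h \<noteq> 1\<close>,
  indexed by \<open>h\<close> itself.\<close>

lemma free_involutions_extension:
  fixes S :: "'g::grp set"
  assumes A: "admissible S i j"
  obtains H :: "(('g \<times> 'g) list \<times> 'g) sym set" and f W where "embeds S f H" "admissible H (f i) (f j)"
    "malnormal_family H W" "\<And>h. h \<in> S \<Longrightarrow> h * h \<noteq> 1 \<Longrightarrow> \<exists>e\<in>Invs H. e * f h \<in> W"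
    "H \<lesssim> lists (S \<times> S) \<times> S"
proof -
  interpret A: admissible S i j by fact
  define \<Lambda> where "\<Lambda> = {h \<in> S. h * h \<noteq> 1}"
  obtain H :: "(('g \<times> 'g) list \<times> 'g) sym set" and f d u B where H: "embeds S f H"
    "inverting_ext H (f ` S) d \<Lambda> u B (f i) (f j) (\<lambda>x. f 1)" "H \<lesssim> lists (S \<times> \<Lambda>) \<times> S"
    by (rule inverting_extension[OF A, of \<Lambda> "\<lambda>_. 1"]) auto
  note e = embedsD[OF H(1)]
  have f1: "f 1 = 1" using hom_on_one[OF e(1) A.S] .
  interpret E: inverting_ext H "f ` S" d \<Lambda> u B "f i" "f j" "\<lambda>x. 1" using H(2) by (simp add: f1)
  interpret F: free_ext H "f ` S" d \<Lambda> u B "f i" "f j" f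
  proof
    fix x assume x: "x \<in> \<Lambda>"
    then show "f x \<in> f ` S" by (auto simp: \<Lambda>_def)
    have "f (x * x) \<noteq> f 1" using x inj_on_eq_iff[OF e(2)] by (auto simp: \<Lambda>_def)
    then show "f x * f x \<noteq> 1" using x hom_on_mult[OF e(1)] by (auto simp: \<Lambda>_def f1)
  qed
  show thesis
  proof (rule that[OF H(1) E.admissible F.malnormal_uc])
    show "\<exists>e\<in>Invs H. e * f h \<in> (\<lambda>x. u x * f x) ` \<Lambda>" if "h \<in> S" "h * h \<noteq> 1" for h
      using that E.u_Invs[of h] by (intro bexI[of _ "u h"]) (auto simp: \<Lambda>_def)
    have "\<Lambda> \<subseteq> S" by (auto simp: \<Lambda>_def)
    then have "lists (S \<times> \<Lambda>) \<times> S \<lesssim> lists (S \<times> S) \<times> S"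
      by (intro subset_imp_lepoll) (auto simp: lists_eq_set)
    then show "H \<lesssim> lists (S \<times> S) \<times> S" using H(3) lepoll_trans by blast
  qed
qed

text \<open>If \<open>u\<close> is an involution inverting \<open>w\<close>, of infinite order, then
  \<open>u * w\<close> is an involution as well, and \<open>w = u * (u * w)\<close>.\<close>

lemma inverted_family_extension:
  fixes S :: "'g::grp set"
  assumes A: "admissible S i j" and W: "malnormal_family S W"
  obtains H :: "(('g \<times> 'g) list \<times> 'g) sym set" and f where "embeds S f H" "admissible H (f i) (f j)"
    "\<And>w. w \<in> W \<Longrightarrow> \<exists>r\<in>Invs H. \<exists>s\<in>Invs H. f w = r * s" "H \<lesssim> lists (S \<times> S) \<times> S"
proof -
  interpret A: admissible S i j by fact
  have W': "W \<subseteq> S" "\<And>w. w \<in> W \<Longrightarrow> inf_ord w" using W by (auto simp: malnormal_family_def)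
  obtain H :: "(('g \<times> 'g) list \<times> 'g) sym set" and f d u B where H: "embeds S f H"
    "inverting_ext H (f ` S) d W u B (f i) (f j) f" "H \<lesssim> lists (S \<times> W) \<times> S"
  proof (rule inverting_extension[OF A, of W "\<lambda>w. w"])
    show "x = y \<and> g \<in> range (\<lambda>m. x powi m)"
      if "x \<in> W" "y \<in> W" "g \<in> S" "x powi k \<noteq> 1" "g * x powi k * inverse g = y powi l" for x y g k l
    proof -
      have "k \<noteq> 0" using that by auto
      then show ?thesis using W that unfolding malnormal_family_def by blast
    qed
  qed (use W' in auto)
  interpret E: inverting_ext H "f ` S" d W u B "f i" "f j" f by fact
  show thesis
  proof (rule that[OF H(1) E.admissible])
    fix w assume w: "w \<in> W"
    have "u w * f w \<in> Invs H"
    proof -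
      have "u w * f w * (u w * f w) = 1" using E.edge_product[OF w, of 1 1] by simp
      moreover have "u w * f w \<noteq> 1"
      proof
        assume "u w * f w = 1"
        then have "f w = u w" using grp_inverse_unique[of "u w" "f w"] E.u_inverse[OF w] by simp
        then have "f w * f w = 1" using E.u_square[OF w] by simp
        moreover have "inf_ord (f w)"
          using inf_ord_image[OF embedsD(1,2)[OF H(1)] A.S] W' w by blast
        ultimately show False using inf_ord_ne(2) by blast
      qed
      ultimately show ?thesis using w W' embedsD(3)[OF H(1)] by (auto simp: Invs_def)
    qed
    moreover have "f w = u w * (u w * f w)" using E.u_square[OF w] by (simp add: mult.assoc[symmetric])
    ultimately show "\<exists>r\<in>Invs H. \<exists>s\<in>Invs H. f w = r * s" using E.u_Invs[OF w] by blast
  next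
    have "lists (S \<times> W) \<times> S \<lesssim> lists (S \<times> S) \<times> S"
      using W'(1) by (intro subset_imp_lepoll) (auto simp: lists_eq_set)
    then show "H \<lesssim> lists (S \<times> S) \<times> S" using H(3) lepoll_trans by blast
  qed
qed

text \<open>Conjugate dihedral groups must not get separate letters: two letters for one conjugacy class
  would produce an element centralising \<open>i\<close> and \<open>j\<close>. So representatives of the
  classes are chosen, each given by a pair of generating involutions.\<close>

definition mal_gens :: "'g::grp set \<Rightarrow> ('g \<times> 'g) set" where
  "mal_gens S = {(a, b). a \<in> Invs S \<and> b \<in> Invs S \<and> a \<noteq> b \<and> malnormal_in S (dih a b)}"

definition conj_sets :: "'g::grp set \<Rightarrow> ('g set \<times> 'g set) set" where
  "conj_sets S = {(D, E). \<exists>g\<in>S. (\<lambda>x. g * x * inverse g) ` D = E}"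

lemma conj_setsI: "g \<in> S \<Longrightarrow> (\<lambda>x. g * x * inverse g) ` D = E \<Longrightarrow> (D, E) \<in> conj_sets S"
  unfolding conj_sets_def by blast

lemma equiv_conj_sets:
  assumes S: "subgrp S"
  shows "equiv UNIV (conj_sets S)"
proof (rule equivI)
  show "conj_sets S \<subseteq> UNIV \<times> UNIV" by simp
  show "refl (conj_sets S)"
    using S by (auto simp: refl_on_def conj_sets_def intro!: bexI[of _ 1])
  show "sym (conj_sets S)"
  proof (rule symI)
    fix D E assume "(D, E) \<in> conj_sets S"
    then obtain g where g: "g \<in> S" "(\<lambda>x. g * x * inverse g) ` D = E" by (auto simp: conj_sets_def)
    have "(\<lambda>x. inverse g * x * inverse (inverse g)) ` E = D"
      unfolding g(2)[symmetric] by (simp add: image_image grp_simps)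
    then show "(E, D) \<in> conj_sets S" by (rule conj_setsI[OF subgrp_inverse[OF S g(1)]])
  qed
  show "trans (conj_sets S)"
  proof (rule transI)
    fix D E F assume "(D, E) \<in> conj_sets S" "(E, F) \<in> conj_sets S"
    then obtain g h where g: "g \<in> S" "(\<lambda>x. g * x * inverse g) ` D = E"
      and h: "h \<in> S" "(\<lambda>x. h * x * inverse h) ` E = F" by (auto simp: conj_sets_def)
    have "(\<lambda>x. h * g * x * inverse (h * g)) ` D = F"
      unfolding h(2)[symmetric] g(2)[symmetric] by (simp add: image_image grp_simps)
    then show "(D, F) \<in> conj_sets S" by (rule conj_setsI[OF subgrp_mult[OF S h(1) g(1)]])
  qed
qed

lemma dihedral_representatives:
  assumes S: "subgrp S"
  obtains R where "R \<subseteq> mal_gens S"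
    "\<And>k l. k \<in> R \<Longrightarrow> l \<in> R \<Longrightarrow> (dih (fst k) (snd k), dih (fst l) (snd l)) \<in> conj_sets S \<Longrightarrow> k = l"
    "\<And>a b. (a, b) \<in> mal_gens S \<Longrightarrow> \<exists>k\<in>R. (dih (fst k) (snd k), dih a b) \<in> conj_sets S"
proof -
  note E = equiv_conj_sets[OF S]
  let ?dih = "\<lambda>k. dih (fst k) (snd k)"
  define c where "c D = (SOME k. k \<in> mal_gens S \<and> (?dih k, D) \<in> conj_sets S)" for D
  have c: "c (?dih k) \<in> mal_gens S \<and> (?dih (c (?dih k)), ?dih k) \<in> conj_sets S" if "k \<in> mal_gens S" for k
  proof -
    have "k \<in> mal_gens S \<and> (?dih k, ?dih k) \<in> conj_sets S"
      using E that by (auto simp: equiv_def refl_on_def)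
    then show ?thesis unfolding c_def by (rule someI)
  qed
  have ceq: "c D = c D'" if "(D, D') \<in> conj_sets S" for D D'
  proof -
    have "(X, D) \<in> conj_sets S \<longleftrightarrow> (X, D') \<in> conj_sets S" for X
      using E that by (meson equivE symE transE)
    then show ?thesis unfolding c_def by simp
  qed
  define R where "R = (\<lambda>k. c (?dih k)) ` mal_gens S"
  show thesis
  proof (rule that[of R])
    show "R \<subseteq> mal_gens S" using c by (auto simp: R_def)
    show "k = l" if kl: "k \<in> R" "l \<in> R" "(?dih k, ?dih l) \<in> conj_sets S" for k l
    proof -
      obtain k' l' where k': "k' \<in> mal_gens S" "k = c (?dih k')" and l': "l' \<in> mal_gens S" "l = c (?dih l')"
        using kl by (auto simp: R_def)
      have "c (?dih k) = k" using ceq[OF conjunct2[OF c[OF k'(1)]]] unfolding k'(2) .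
      moreover have "c (?dih l) = l" using ceq[OF conjunct2[OF c[OF l'(1)]]] unfolding l'(2) .
      ultimately show ?thesis using ceq[OF kl(3)] by (metis (no_types))
    qed
    show "\<exists>k\<in>R. (?dih k, dih a b) \<in> conj_sets S" if "(a, b) \<in> mal_gens S" for a b
    proof (rule bexI)
      show "(?dih (c (dih a b)), dih a b) \<in> conj_sets S" using c[OF that] by simp
      show "c (dih a b) \<in> R" unfolding R_def by (rule image_eqI[OF _ that]) simp
    qed
  qed
qed

lemma (in admissible) dih_subset: "(a, b) \<in> mal_gens S \<Longrightarrow> dih a b \<subseteq> S"
  using dih_least[OF _ _ S] by (auto simp: mal_gens_def Invs_def)

text \<open>The elements of either group send the common element \<open>y\<close> of infinite order to
  \<open>y\<close> or its inverse, so they lie in the other group by malnormality.\<close>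

lemma (in admissible) malnormal_dih_eq:
  assumes k: "(a, b) \<in> mal_gens S" "(a', b') \<in> mal_gens S" and y: "y \<in> dih a b" "y \<in> dih a' b'" "inf_ord y"
  shows "dih a b = dih a' b'"
proof -
  have *: "dih a b \<subseteq> dih a' b'"
    if k: "(a, b) \<in> mal_gens S" "(a', b') \<in> mal_gens S" and y: "y \<in> dih a b" "y \<in> dih a' b'" for a b a' b'
  proof
    fix x assume x: "x \<in> dih a b"
    have I: "a * a = 1" "b * b = 1" "a' * a' = 1" "b' * b' = 1" using k by (auto simp: mal_gens_def Invs_def)
    have "x * y * inverse x = y \<or> x * y * inverse x = inverse y"
      by (rule dih_conj_inf_ord[OF I(1,2) y(1) assms(5) x])
    then have "x * y * inverse x \<in> dih a' b'" using y subgrp_inverse[OF subgrp_dih[OF I(3,4)]] by auto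
    moreover have "x \<in> S" using dih_subset[OF k(1)] x by blast
    ultimately show "x \<in> dih a' b'" using k y assms(5) by (auto simp: mal_gens_def malnormal_in_def)
  qed
  show ?thesis using *[OF k y(1,2)] *[OF k(2,1) y(2,1)] by blast
qed

text \<open>By \<open>base_pairs\<close> some \<open>z\<close> fixes \<open>i\<close> and conjugates
  \<open>j\<close> to \<open>j i j\<close>, hence \<open>i j\<close> to its square. A malnormal
  dihedral group containing a conjugate of an element of infinite order of \<open>dih i j\<close>
  would contain the same conjugate of \<open>i\<close>, \<open>j\<close> and \<open>z\<close>; but in a
  dihedral group no element of infinite order is conjugate to its square.\<close>

lemma (in admissible) base_not_malnormal:
  assumes k: "(a, b) \<in> mal_gens S" and g: "g \<in> S" and y: "y \<in> dih i j" "inf_ord y"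
    and gy: "g * y * inverse g \<in> dih a b"
  shows False
proof -
  note I = InvsD[OF i] and J = InvsD[OF j]
  have ab: "a * a = 1" "b * b = 1" "malnormal_in S (dih a b)" using k by (auto simp: mal_gens_def Invs_def)
  note D = subgrp_dih[OF ab(1,2)]
  have gi: "inf_ord (g * y * inverse g)" using y by (simp add: inf_ord_conj)
  have inD: "g * z * inverse g \<in> dih a b" if z: "z \<in> dih i j" for z
  proof -
    have "z * y * inverse z = y \<or> z * y * inverse z = inverse y" by (rule dih_conj_inf_ord[OF I(3) J(3) y z])
    moreover have "(g * z * inverse g) * (g * y * inverse g) * inverse (g * z * inverse g) = g * (z * y * inverse z) * inverse g"
      by (simp add: grp_simps)
    moreover have "g * inverse y * inverse g = inverse (g * y * inverse g)" by (simp add: grp_simps)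
    ultimately have "(g * z * inverse g) * (g * y * inverse g) * inverse (g * z * inverse g) \<in> dih a b"
      using gy subgrp_inverse[OF D gy] by auto
    moreover have "g * z * inverse g \<in> S" using g z dih_least[OF I(3) J(3) S I(1) J(1)] by auto
    ultimately show ?thesis using ab(3) gy gi unfolding malnormal_in_def by blast
  qed
  note DG = dih_gens[OF I(3) J(3)] and DS = subgrp_dih[OF I(3) J(3)]
  have jij: "j * i * j \<in> Invs (dih i j)"
    using Invs_conj[OF DS DG(2), of i] DG(1) I J by (simp add: Invs_def)
  have ii: "i \<in> Invs (dih i j)" using DG I by (simp add: Invs_def)
  have p: "inf_ord (i * j)" by (rule inf[OF i j ij])
  have ne: "i \<noteq> j * i * j"
  proof
    assume "i = j * i * j"
    then have "i * j * (i * j) = 1" using I(3) by (metis mult.assoc)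
    then show False using inf_ord_ne(2)[OF p] by blast
  qed
  have jj: "j \<in> Invs (dih i j)" using DG J by (simp add: Invs_def)
  obtain z where z: "z \<in> S" "z * i * inverse z = i" "z * j * inverse z = j * i * j"
    using base_pairs[OF ii jij ne] by (auto simp: conj_pair_def)
  have zp: "z * (i * j) * inverse z = i * j * (i * j)"
  proof -
    have "z * (i * j) * inverse z = (z * i * inverse z) * (z * j * inverse z)" by (simp add: grp_simps)
    then show ?thesis unfolding z(2,3) by (simp add: mult.assoc)
  qed
  define p' z' where "p' = g * (i * j) * inverse g" and "z' = g * z * inverse g"
  have p': "p' \<in> dih a b" "inf_ord p'"
    using inD[OF subgrp_mult[OF DS DG]] p by (simp_all add: p'_def inf_ord_conj)
  have z'p: "z' * p' * inverse z' = p' * p'"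
  proof -
    have "z' * p' * inverse z' = g * (z * (i * j) * inverse z) * inverse g" by (simp add: z'_def p'_def grp_simps)
    also have "\<dots> = p' * p'" unfolding zp p'_def by (simp add: grp_simps)
    finally show ?thesis .
  qed
  have "z' \<in> S" using z g by (simp add: z'_def)
  moreover have "z' * p' * inverse z' \<in> dih a b" unfolding z'p using p' subgrp_mult[OF D] by blast
  ultimately have "z' \<in> dih a b" using ab(3) p' unfolding malnormal_in_def by blast
  then have "p' * p' = p' \<or> p' * p' = inverse p'"
    using dih_conj_inf_ord[OF ab(1,2) p', of z'] z'p by simp
  then have "p' = 1 \<or> p' ^ 3 = 1"
    by (metis grp_left_cancel grp_right_inverse mult_1_right power3_eq_cube mult.assoc)
  then show False using p'(2) by (auto simp: inf_ord_def)
qed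

text \<open>Edges leaving a vertex by different conjugates of dihedral groups share elements of infinite
  order only if both groups are conjugates of \<open>dih i j\<close>: this follows from
  \<open>malnormal_dih_eq\<close> for two malnormal groups and from \<open>base_not_malnormal\<close> in
  the mixed case.\<close>

lemma conjugating_extension:
  fixes S :: "'g::grp set"
  assumes A: "admissible S i j"
  obtains H :: "(('g \<times> ('g \<times> 'g) \<times> bool) list \<times> 'g) sym set" and f where "embeds S f H" "admissible H (f i) (f j)"
    "\<And>r s. r \<in> Invs S \<Longrightarrow> s \<in> Invs S \<Longrightarrow> r \<noteq> s \<Longrightarrow> conj_pair H (f i) (f j) (f r) (f s)"
    "H \<lesssim> lists (S \<times> (S \<times> S) \<times> (UNIV :: bool set)) \<times> S"
proof -
  interpret A: admissible S i j by fact
  note I = InvsD[OF A.i] and J = InvsD[OF A.j]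
  obtain R where R: "R \<subseteq> mal_gens S"
    "\<And>k l. k \<in> R \<Longrightarrow> l \<in> R \<Longrightarrow> (dih (fst k) (snd k), dih (fst l) (snd l)) \<in> conj_sets S \<Longrightarrow> k = l"
    "\<And>a b. (a, b) \<in> mal_gens S \<Longrightarrow> \<exists>k\<in>R. (dih (fst k) (snd k), dih a b) \<in> conj_sets S"
    by (rule dihedral_representatives[OF A.S]) blast
  have Rk: "fst k \<in> Invs S" "snd k \<in> Invs S" "fst k \<noteq> snd k" "malnormal_in S (dih (fst k) (snd k))" if "k \<in> R" for k
    using R(1) that by (auto simp: mal_gens_def)
  define B0 :: "('g \<times> 'g) \<times> bool \<Rightarrow> 'g set" where
    "B0 = (\<lambda>(k, b). if b then dih i j else dih (fst k) (snd k))"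
  define \<theta> :: "('g \<times> 'g) \<times> bool \<Rightarrow> 'g \<Rightarrow> 'g" where
    "\<theta> = (\<lambda>(k, b). if b then dih_map i j (fst k) (snd k) else dih_map (fst k) (snd k) i j)"
  note mp = dih_map_props
  have ijp: "i * i = 1" "j * j = 1" "i \<noteq> 1" "inf_ord (i * j)" using I J A.inf[OF A.i A.j A.ij] by auto
  have kp: "fst k * fst k = 1" "snd k * snd k = 1" "fst k \<noteq> 1" "inf_ord (fst k * snd k)" if "k \<in> R" for k
    using InvsD[OF Rk(1)[OF that]] InvsD[OF Rk(2)[OF that]] A.inf[OF Rk(1-3)[OF that]] by auto
  have B0S: "B0 x \<subseteq> S" if "x \<in> R \<times> UNIV" for x
  proof -
    obtain k b where kb: "x = (k, b)" "k \<in> R" using \<open>x \<in> R \<times> UNIV\<close> by blast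
    have "dih (fst k) (snd k) \<subseteq> S" using A.dih_subset[of "fst k" "snd k"] R(1) kb by auto
    then show ?thesis using dih_least[OF I(3) J(3) A.S I(1) J(1)] by (simp add: B0_def kb)
  qed
  interpret D: hnn_data S "R \<times> UNIV" "\<lambda>(k, b). (k, \<not> b)" B0 \<theta>
  proof
    fix x :: "('g \<times> 'g) \<times> bool" assume x: "x \<in> R \<times> UNIV"
    obtain k b where kb: "x = (k, b)" "k \<in> R" using x by blast
    show "subgrp (B0 x)" using subgrp_dih[OF ijp(1,2)] subgrp_dih[OF kp(1,2)[OF kb(2)]] by (simp add: B0_def kb)
    show "B0 x \<subseteq> S" by (rule B0S[OF x])
    show "hom_on (B0 x) (\<theta> x)" using mp(1)[OF ijp kp[OF kb(2)]] mp(1)[OF kp[OF kb(2)] ijp]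
      by (auto simp: B0_def \<theta>_def kb)
    fix c assume "c \<in> B0 x"
    then show "\<theta> x c \<in> B0 (case x of (k, b) \<Rightarrow> (k, \<not> b))" "\<theta> (case x of (k, b) \<Rightarrow> (k, \<not> b)) (\<theta> x c) = c"
      using mp(2,3)[OF ijp kp[OF kb(2)]] mp(2,3)[OF kp[OF kb(2)] ijp]
      by (auto simp: B0_def \<theta>_def kb split: if_splits)
  qed auto
  have square: "inf_ord b \<or> b * b = 1" if x: "x \<in> R \<times> UNIV" "b \<in> B0 x" for x b
  proof -
    have *: "inf_ord b \<or> b * b = 1" if "r * r = 1" "s * s = 1" "inf_ord (r * s)" "b \<in> dih r s" for r s
      using that(4)
    proof (rule dihE)
      fix k assume "b = (r * s) powi k"
      then show ?thesis using inf_ord_powi[OF that(3), of k] by (cases "k = 0") auto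
    next
      fix k assume "b = (r * s) powi k * r"
      then show ?thesis using dih_reflection_square[OF that(1,2)] by simp
    qed
    obtain k c where kb: "x = (k, c)" "k \<in> R" using x by blast
    show ?thesis using *[OF ijp(1,2,4)] *[OF kp(1,2,4)[OF kb(2)]] x(2) by (auto simp: B0_def kb split: if_splits)
  qed
  have edges: "x = y \<and> g \<in> B0 x \<or> snd x \<and> snd y"
    if x: "x \<in> R \<times> UNIV" and y: "y \<in> R \<times> UNIV" and g: "g \<in> S" and b: "b \<in> B0 x" "inf_ord b" and c: "g * b * inverse g \<in> B0 y"
    for x y g b
  proof -
    obtain k m where k: "x = (k, m)" "k \<in> R" using x by blast
    obtain l n where l: "y = (l, n)" "l \<in> R" using y by blast
    have kM: "(fst k, snd k) \<in> mal_gens S" "(fst l, snd l) \<in> mal_gens S" using R(1) k l by auto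
    have ci: "inf_ord (g * b * inverse g)" using b by (simp add: inf_ord_conj)
    consider "m" "n" | "m" "\<not> n" | "\<not> m" "n" | "\<not> m" "\<not> n" by blast
    then show ?thesis
    proof cases
      case 1
      then show ?thesis using k l by simp
    next
      case 2
      then show ?thesis using A.base_not_malnormal[OF kM(2) g _ b(2)] b c k l by (simp add: B0_def)
    next
      case 3
      have "inverse g * (g * b * inverse g) * inverse (inverse g) \<in> dih (fst k) (snd k)"
        using b k 3 by (simp add: B0_def grp_simps)
      then show ?thesis using A.base_not_malnormal[OF kM(1) _ _ ci, of "inverse g"] g c l 3 by (simp add: B0_def)
    next
      case 4
      let ?r = "g * fst k * inverse g" and ?s = "g * snd k * inverse g"
      have e: "dih ?r ?s = (\<lambda>x. g * x * inverse g) ` dih (fst k) (snd k)" by (rule dih_conj)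
      have rs: "(?r, ?s) \<in> mal_gens S"
        using Invs_conj[OF A.S g] Rk[OF k(2)] malnormal_conj[OF A.S g Rk(4)[OF k(2)]]
        unfolding mal_gens_def e[symmetric] by simp
      have "g * b * inverse g \<in> dih ?r ?s" unfolding e using b k 4 by (simp add: B0_def)
      moreover have cl: "g * b * inverse g \<in> dih (fst l) (snd l)" using c l 4 by (simp add: B0_def)
      ultimately have "dih ?r ?s = dih (fst l) (snd l)" using A.malnormal_dih_eq[OF rs kM(2) _ _ ci] by blast
      then have "(dih (fst k) (snd k), dih (fst l) (snd l)) \<in> conj_sets S"
        using g unfolding e by (auto simp: conj_sets_def)
      then have kl: "k = l" using R(2) k l by blast
      have "g \<in> dih (fst k) (snd k)"
        using Rk(4)[OF k(2)] g b cl kl k 4 unfolding malnormal_in_def B0_def by auto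
      then show ?thesis using kl k l 4 by (simp add: B0_def)
    qed
  qed
  have cover: "conj_pair S i j r s \<or> (\<exists>k\<in>R. \<exists>r'\<in>B0 (k, False). \<exists>s'\<in>B0 (k, False). conj_pair S r' s' r s)"
    if rs: "r \<in> Invs S" "s \<in> Invs S" "r \<noteq> s" for r s
    using A.pairs[OF rs]
  proof
    assume "malnormal_pair S r s"
    then obtain a b where ab: "(a, b) \<in> mal_gens S" "r \<in> dih a b" "s \<in> dih a b"
      by (auto simp: malnormal_pair_def mal_gens_def)
    obtain k g where k: "k \<in> R" "g \<in> S" "(\<lambda>x. g * x * inverse g) ` dih (fst k) (snd k) = dih a b"
      using R(3)[OF ab(1)] by (auto simp: conj_sets_def)
    obtain r' s' where rs': "r' \<in> dih (fst k) (snd k)" "s' \<in> dih (fst k) (snd k)"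
      "r = g * r' * inverse g" "s = g * s' * inverse g" using ab(2,3) k(3)[symmetric] by blast
    then have "conj_pair S r' s' r s" using conj_pairI[OF k(2)] by simp
    then show ?thesis using k(1) rs' by (auto simp: B0_def)
  qed simp
  define H f d t B where "H = D.hnn_group" and "f = D.lperm" and "d = D.hnn_dist" and "t = D.tperm" and "B = (\<lambda>x. f ` B0 x)"
  have hom: "hom_on S f" by (simp add: hom_on_def f_def D.lperm_mult)
  have inj: "inj_on f S" unfolding f_def by (rule D.lperm_inj)
  have emb: "embeds S f H" using hom inj by (auto simp: embeds_def H_def f_def)
  have adm: "admissible (f ` S) (f i) (f j)" by (rule admissible_image[OF A hom inj])
  have bs: "bass_serre H (f ` S) d (R \<times> UNIV) (\<lambda>(k, b). (k, \<not> b)) t B"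
    unfolding H_def f_def d_def t_def B_def by (rule D.bass_serre)
  interpret C: conjugating_ext H "f ` S" d R t B "f i" "f j"
  proof (intro conjugating_ext.intro admissible_ext.intro bs adm conjugating_ext_axioms.intro)
    show "B (k, True) = dih (f i) (f j)" if "k \<in> R" for k
      using dih_image[OF hom A.S I(1) J(1)] by (simp add: B_def B0_def)
    show "inf_ord b \<or> b * b = 1" if x: "x \<in> R \<times> UNIV" "b \<in> B x" for x b
    proof -
      obtain c where c: "c \<in> B0 x" "b = f c" using x by (auto simp: B_def)
      have cS: "c \<in> S" using c B0S[OF x(1)] by blast
      show ?thesis
        using square[OF x(1) c(1)] inf_ord_image[OF hom inj A.S cS] hom_on_mult[OF hom cS cS] hom_on_one[OF hom A.S] c
        by auto
    qed
    show "x = y \<and> g \<in> B x \<or> snd x \<and> snd y"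
      if x: "x \<in> R \<times> UNIV" and y: "y \<in> R \<times> UNIV" and g: "g \<in> f ` S" and b: "b \<in> B x" "inf_ord b"
        and c: "g * b * inverse g \<in> B y" for x y g b
    proof -
      obtain a where a: "a \<in> S" "g = f a" using g by blast
      obtain b' where b': "b' \<in> B0 x" "b = f b'" using b by (auto simp: B_def)
      obtain c' where c': "c' \<in> B0 y" "g * b * inverse g = f c'" using c by (auto simp: B_def)
      have S': "b' \<in> S" "c' \<in> S" using b' c' B0S[OF x] B0S[OF y] by auto
      have "f (a * b' * inverse a) = f c'" using hom_on_conj[OF hom A.S a(1) S'(1)] a b' c' by simp
      then have "a * b' * inverse a = c'" using inj_on_eq_iff[OF inj _ S'(2)] a S' by simp
      moreover have "inf_ord b'" using inf_ord_image[OF hom inj A.S S'(1)] b b' by simp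
      ultimately have "x = y \<and> a \<in> B0 x \<or> snd x \<and> snd y" using edges[OF x y a(1) b'(1)] c' by blast
      then show ?thesis using a by (auto simp: B_def)
    qed
    show "conj_pair (f ` S) (f i) (f j) r s \<or>
        (\<exists>k\<in>R. \<exists>r'\<in>B (k, False). \<exists>s'\<in>B (k, False). conj_pair (f ` S) r' s' r s)"
      if rs: "r \<in> Invs (f ` S)" "s \<in> Invs (f ` S)" "r \<noteq> s" for r s
    proof -
      obtain a b where ab: "a \<in> Invs S" "b \<in> Invs S" "r = f a" "s = f b" "a \<noteq> b"
        using rs unfolding Invs_image[OF hom inj A.S] by blast
      from cover[OF ab(1,2,5)] show ?thesis
      proof
        assume "conj_pair S i j a b"
        then show ?thesis using conj_pair_image[OF hom A.S I(1) J(1)] ab by blast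
      next
        assume "\<exists>k\<in>R. \<exists>r'\<in>B0 (k, False). \<exists>s'\<in>B0 (k, False). conj_pair S r' s' a b"
        then obtain k r' s' where k: "k \<in> R" "r' \<in> B0 (k, False)" "s' \<in> B0 (k, False)" "conj_pair S r' s' a b" by blast
        then have "r' \<in> S" "s' \<in> S" using B0S[of "(k, False)"] by auto
        then have "conj_pair (f ` S) (f r') (f s') r s" using conj_pair_image[OF hom A.S _ _ k(4)] ab by blast
        then show ?thesis using k by (auto simp: B_def)
      qed
    qed
  qed
  show thesis
  proof (rule that[OF emb C.admissible])
    show "conj_pair H (f i) (f j) (f r) (f s)" if rs: "r \<in> Invs S" "s \<in> Invs S" "r \<noteq> s" for r s
    proof (rule C.G_pairs)
      show "f r \<in> Invs (f ` S)" "f s \<in> Invs (f ` S)" using rs unfolding Invs_image[OF hom inj A.S] by auto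
      show "f r \<noteq> f s" using rs inj_on_eq_iff[OF inj] by (auto simp: Invs_def)
    qed
    have "R \<subseteq> S \<times> S" using R(1) by (auto simp: mal_gens_def Invs_def)
    then have "lists (S \<times> R \<times> UNIV) \<times> S \<subseteq> lists (S \<times> (S \<times> S) \<times> (UNIV :: bool set)) \<times> S"
      by (auto simp: lists_eq_set)
    then show "H \<lesssim> lists (S \<times> (S \<times> S) \<times> (UNIV :: bool set)) \<times> S"
      using D.hnn_group_card subset_imp_lepoll lepoll_trans unfolding H_def by blast
  qed
qed

section \<open>Cardinality\<close>

context
  includes cardinal_syntax
begin

lemma infinite_times_lepoll:
  assumes "infinite X" "A \<lesssim> X" "B \<lesssim> X"
  shows "A \<times> B \<lesssim> X"
proof -
  have "X \<times> X \<lesssim> X"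
    using card_of_Times_same_infinite[OF assms(1)] unfolding lepoll_def card_of_ordLeq
    by (rule ordIso_imp_ordLeq)
  then show ?thesis using times_lepoll_mono[OF assms(2,3)] lepoll_trans by blast
qed

text \<open>A list is determined by its length and a code of its entries under an injection of
  \<open>X \<times> X\<close> into \<open>X\<close>.\<close>

lemma infinite_lists_lepoll:
  assumes X: "infinite X" and A: "A \<lesssim> X"
  shows "lists A \<lesssim> X"
proof -
  obtain j where j: "inj_on j A" "j ` A \<subseteq> X" using A by (auto simp: lepoll_def)
  obtain p where p: "inj_on p (X \<times> X)" "p ` (X \<times> X) \<subseteq> X"
    using infinite_times_lepoll[OF X lepoll_refl lepoll_refl] by (auto simp: lepoll_def)
  obtain x0 where x0: "x0 \<in> X" using X by (metis ex_in_conv finite.emptyI)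
  define code where "code = rec_list x0 (\<lambda>a _ c. p (j a, c))"
  have c: "code [] = x0" "code (a # xs) = p (j a, code xs)" for a xs by (simp_all add: code_def)
  have inX: "xs \<in> lists A \<Longrightarrow> code xs \<in> X" for xs
    by (induction xs) (use x0 j p in \<open>auto simp: c\<close>)
  have inj: "xs \<in> lists A \<Longrightarrow> ys \<in> lists A \<Longrightarrow> length xs = length ys \<Longrightarrow> code xs = code ys \<Longrightarrow> xs = ys" for xs ys
  proof (induction xs arbitrary: ys)
    case (Cons a xs)
    then obtain b ys' where ys: "ys = b # ys'" by (cases ys) auto
    have "(j a, code xs) = (j b, code ys')"
      using inj_onD[OF p(1), of "(j a, code xs)" "(j b, code ys')"] Cons.prems ys inX j by (auto simp: c)
    then show ?case using Cons ys inj_onD[OF j(1)] by auto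
  qed simp
  have "lists A \<lesssim> (UNIV :: nat set) \<times> X"
    unfolding lepoll_def
  proof (intro exI conjI)
    show "inj_on (\<lambda>xs. (length xs, code xs)) (lists A)" by (rule inj_onI) (use inj in simp)
    show "(\<lambda>xs. (length xs, code xs)) ` lists A \<subseteq> UNIV \<times> X" using inX by blast
  qed
  moreover have "(UNIV :: nat set) \<times> X \<lesssim> X"
    using infinite_times_lepoll[OF X _ lepoll_refl] X by (simp add: infinite_le_lepoll)
  ultimately show ?thesis using lepoll_trans by blast
qed

lemma infinite_UN_lepoll:
  fixes A :: "nat \<Rightarrow> 'b set"
  assumes X: "infinite X" and A: "\<And>n. A n \<lesssim> X"
  shows "(\<Union>n. A n) \<lesssim> X"
proof -
  have "|UNIV :: nat set| \<le>o |X|"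
    using X infinite_le_lepoll[of X] unfolding lepoll_def card_of_ordLeq by simp
  moreover have "\<forall>n. |A n| \<le>o |X|" using A unfolding lepoll_def card_of_ordLeq by simp
  ultimately have "|\<Union>n. A n| \<le>o |X|" using card_of_UNION_ordLeq_infinite[OF X] by blast
  then show ?thesis unfolding lepoll_def card_of_ordLeq .
qed

end

section \<open>One round of extensions\<close>

lemma cayley_subgrp:
  fixes H :: "'g::grp set"
  assumes H: "subgrp H" and "H \<lesssim> (UNIV :: 'a set)"
  obtains \<psi> :: "'g \<Rightarrow> 'a sym" where "embeds H \<psi> (\<psi> ` H)"
proof -
  let ?K = "\<lparr>carrier = H, mult = (*), one = 1\<rparr>"
  have "group ?K"
  proof (rule groupI)
    show "\<exists>y\<in>carrier ?K. y \<otimes>\<^bsub>?K\<^esub> x = \<one>\<^bsub>?K\<^esub>" if "x \<in> carrier ?K" for x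
      using that subgrp_inverse[OF H, of x] grp_left_inverse[of x] by auto
  qed (simp_all add: H mult.assoc)
  moreover have "carrier ?K \<lesssim> (UNIV :: 'a set)" using assms(2) by simp
  ultimately show thesis
  proof (rule cayley)
    fix \<psi> :: "'g \<Rightarrow> 'a sym"
    assume "inj_on \<psi> (carrier ?K)"
      "\<And>x y. x \<in> carrier ?K \<Longrightarrow> y \<in> carrier ?K \<Longrightarrow> \<psi> (x \<otimes>\<^bsub>?K\<^esub> y) = \<psi> x * \<psi> y"
    then have "embeds H \<psi> (\<psi> ` H)" by (simp add: embeds_def hom_on_def)
    then show thesis by (rule that)
  qed
qed

text \<open>The types of the successive extensions of a group of permutations of
  \<open>'a\<close>.\<close>

type_synonym ('g, 'l) nf_sym = "(('g \<times> 'l) list \<times> 'g) sym"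
type_synonym 'a ext1 = "('a sym, 'a sym) nf_sym"
type_synonym 'a ext2 = "('a ext1, 'a ext1) nf_sym"
type_synonym 'a ext3 = "('a ext2, ('a ext2 \<times> 'a ext2) \<times> bool) nf_sym"

text \<open>The three extensions one after the other, moved back to permutations of \<open>'a\<close>.
  To write \<open>g\<close> as a product of four involutions choose \<open>k \<in> {i, j}\<close>
  different from \<open>g\<close>, so that \<open>h = g k\<close> is not trivial. If \<open>h\<close>
  is an involution, \<open>g = h k k k\<close> will do. Otherwise
  \<open>g = e (e h) k\<close>, where \<open>e\<close> is the free involution belonging to
  \<open>h\<close> and \<open>e h\<close> has become a product of two involutions.\<close>

lemma one_round:
  fixes S :: "'a sym set" and X :: "'a set"
  assumes A: "admissible S i j" and X: "infinite X" and SX: "S \<lesssim> X"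
  shows "\<exists>(S' :: 'a sym set) f. embeds S f S' \<and> admissible S' (f i) (f j) \<and> S' \<lesssim> X \<and>
    (\<forall>r\<in>Invs S. \<forall>s\<in>Invs S. r \<noteq> s \<longrightarrow> conj_pair S' (f i) (f j) (f r) (f s)) \<and>
    (\<forall>g\<in>S. \<exists>a\<in>Invs S'. \<exists>b\<in>Invs S'. \<exists>c\<in>Invs S'. \<exists>d\<in>Invs S'. f g = a * b * c * d)"
proof -
  interpret A: admissible S i j by fact
  note I = InvsD[OF A.i] and J = InvsD[OF A.j]
  obtain H1 :: "'a ext1 set" and f1 W where 1: "embeds S f1 H1"
    "admissible H1 (f1 i) (f1 j)" "malnormal_family H1 W"
    "\<And>h. h \<in> S \<Longrightarrow> h * h \<noteq> 1 \<Longrightarrow> \<exists>e\<in>Invs H1. e * f1 h \<in> W" "H1 \<lesssim> lists (S \<times> S) \<times> S"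
    by (rule free_involutions_extension[OF A]) blast
  obtain H2 :: "'a ext2 set" and f2 where 2: "embeds H1 f2 H2"
    "admissible H2 (f2 (f1 i)) (f2 (f1 j))" "\<And>w. w \<in> W \<Longrightarrow> \<exists>r\<in>Invs H2. \<exists>s\<in>Invs H2. f2 w = r * s"
    "H2 \<lesssim> lists (H1 \<times> H1) \<times> H1"
    by (rule inverted_family_extension[OF 1(2,3)]) blast
  define f12 where "f12 = f2 \<circ> f1"
  have e12: "embeds S f12 H2" unfolding f12_def by (rule embeds_compose[OF 1(1) 2(1)])
  interpret A1: admissible H1 "f1 i" "f1 j" by (rule 1(2))
  interpret A2: admissible H2 "f12 i" "f12 j" using 2(2) by (simp add: f12_def)
  obtain H3 :: "'a ext3 set" and f3 where 3: "embeds H2 f3 H3" "admissible H3 (f3 (f12 i)) (f3 (f12 j))"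
    "\<And>r s. r \<in> Invs H2 \<Longrightarrow> s \<in> Invs H2 \<Longrightarrow> r \<noteq> s \<Longrightarrow> conj_pair H3 (f3 (f12 i)) (f3 (f12 j)) (f3 r) (f3 s)"
    "H3 \<lesssim> lists (H2 \<times> (H2 \<times> H2) \<times> (UNIV :: bool set)) \<times> H2"
    by (rule conjugating_extension[OF A2.admissible_axioms]) blast
  interpret A3: admissible H3 "f3 (f12 i)" "f3 (f12 j)" by (rule 3(2))
  note T = infinite_times_lepoll[OF X] and L = infinite_lists_lepoll[OF X]
  have H1X: "H1 \<lesssim> X" by (rule lepoll_trans[OF 1(5)]) (intro T L SX)
  have H2X: "H2 \<lesssim> X" by (rule lepoll_trans[OF 2(4)]) (intro T L H1X)
  have bX: "(UNIV :: bool set) \<lesssim> X" by (rule finite_lepoll_infinite[OF X]) simp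
  have H3X: "H3 \<lesssim> X" by (rule lepoll_trans[OF 3(4)]) (intro T L H2X bX)
  have "H3 \<lesssim> (UNIV :: 'a set)" by (rule lepoll_trans[OF H3X]) (simp add: subset_imp_lepoll)
  then obtain f4 :: "_ \<Rightarrow> 'a sym" where 4: "embeds H3 f4 (f4 ` H3)" using cayley_subgrp[OF A3.S] by blast
  define S' where "S' = f4 ` H3"
  define f34 where "f34 = f4 \<circ> f3"
  have e34: "embeds H2 f34 S'" unfolding f34_def S'_def by (rule embeds_compose[OF 3(1) 4])
  define f where "f = f34 \<circ> f12"
  have e: "embeds S f S'" unfolding f_def by (rule embeds_compose[OF e12 e34])
  have adm: "admissible S' (f i) (f j)"
    using admissible_image[OF 3(2) embedsD(1,2)[OF 4]] by (simp add: S'_def f_def f34_def)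
  have card: "S' \<lesssim> X" unfolding S'_def by (rule lepoll_trans[OF image_lepoll H3X])
  have conj: "conj_pair S' (f i) (f j) (f r) (f s)" if rs: "r \<in> Invs S" "s \<in> Invs S" "r \<noteq> s" for r s
  proof -
    have ne: "f12 r \<noteq> f12 s" using rs inj_on_eq_iff[OF embedsD(2)[OF e12]] by (auto simp: Invs_def)
    have "conj_pair H3 (f3 (f12 i)) (f3 (f12 j)) (f3 (f12 r)) (f3 (f12 s))"
      by (rule 3(3)[OF embeds_Invs[OF e12 A.S rs(1)] embeds_Invs[OF e12 A.S rs(2)] ne])
    from conj_pair_image[OF embedsD(1)[OF 4] A3.S InvsD(1)[OF A3.i] InvsD(1)[OF A3.j] this]
    show ?thesis by (simp add: S'_def f_def f34_def)
  qed
  have four: "\<exists>a\<in>Invs H2. \<exists>b\<in>Invs H2. \<exists>c\<in>Invs H2. \<exists>d\<in>Invs H2. f12 g = a * b * c * d" if g: "g \<in> S" for g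
  proof -
    \<comment> \<open>The choice of \<open>k\<close> avoids \<open>g * k = 1\<close>.\<close>
    define k where "k = (if g = i then j else i)"
    have k: "k \<in> Invs S" "g \<noteq> k" using A.i A.j A.ij by (auto simp: k_def)
    note K = InvsD[OF k(1)]
    define h where "h = g * k"
    have h: "h \<in> S" "g = h * k" using g K by (simp_all add: h_def mult.assoc)
    have h1: "h \<noteq> 1"
    proof
      assume "h = 1"
      then show False using h(2) k(2) by simp
    qed
    note m = hom_on_mult[OF embedsD(1)[OF e12]]
    have fk: "f12 k \<in> Invs H2" by (rule embeds_Invs[OF e12 A.S k(1)])
    have fg: "f12 g = f12 h * f12 k" unfolding h(2) by (rule m[OF h(1) K(1)])
    show ?thesis
    proof (cases "h * h = 1")
      case True
      then have "f12 h \<in> Invs H2" using embeds_Invs[OF e12 A.S] h h1 by (simp add: Invs_def)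
      moreover have "f12 g = f12 h * f12 k * f12 k * f12 k" using fg InvsD(5)[OF fk, of 1] by (simp add: mult.assoc)
      ultimately show ?thesis using fk by blast
    next
      case False
      then obtain e where e: "e \<in> Invs H1" "e * f1 h \<in> W" using 1(4)[OF h(1)] by blast
      obtain r s where rs: "r \<in> Invs H2" "s \<in> Invs H2" "f2 (e * f1 h) = r * s" using 2(3)[OF e(2)] by blast
      have fe: "f2 e \<in> Invs H2" by (rule embeds_Invs[OF 2(1) A1.S e(1)])
      have "r * s = f2 e * f12 h"
        using rs(3) hom_on_mult[OF embedsD(1)[OF 2(1)] InvsD(1)[OF e(1)] embedsD(3)[OF 1(1) h(1)]] by (simp add: f12_def)
      then have "f12 h = f2 e * (r * s)" using InvsD(5)[OF fe] by simp
      then have "f12 g = f2 e * r * s * f12 k" using fg by (simp add: mult.assoc)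
      then show ?thesis using fe rs fk by blast
    qed
  qed
  have four': "\<exists>a\<in>Invs S'. \<exists>b\<in>Invs S'. \<exists>c\<in>Invs S'. \<exists>d\<in>Invs S'. f g = a * b * c * d" if g: "g \<in> S" for g
  proof -
    obtain a b c d where abcd: "a \<in> Invs H2" "b \<in> Invs H2" "c \<in> Invs H2" "d \<in> Invs H2" "f12 g = a * b * c * d"
      using four[OF g] by blast
    note m = hom_on_mult[OF embedsD(1)[OF e34]]
    have "f g = f34 a * f34 b * f34 c * f34 d"
      using abcd m subgrp_mult[OF A2.S] by (simp add: f_def Invs_def)
    then show ?thesis using embeds_Invs[OF e34 A2.S] abcd by blast
  qed
  show ?thesis using e adm card conj four' by blast
qed

section \<open>Germs of sequences and the direct limit\<close>

text
  \<open>Sequences up to equality of almost all terms. A chain of embeddings of groups in one type turns into an ascending chain of subgroups of the group of germs: an element is identified with the sequence of its images.\<close>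

quotient_type 'b germ = "nat \<Rightarrow> 'b" / "\<lambda>f g. \<exists>N. \<forall>n\<ge>N. f n = g n"
proof (rule equivpI)
  show "reflp (\<lambda>f g :: nat \<Rightarrow> 'b. \<exists>N. \<forall>n\<ge>N. f n = g n)" by (auto simp: reflp_def)
  show "symp (\<lambda>f g :: nat \<Rightarrow> 'b. \<exists>N. \<forall>n\<ge>N. f n = g n)" by (auto simp: symp_def) metis
  show "transp (\<lambda>f g :: nat \<Rightarrow> 'b. \<exists>N. \<forall>n\<ge>N. f n = g n)"
    by (rule transpI) (metis (no_types, lifting) max.boundedE nat_le_linear order_trans)
qed

instantiation germ :: (grp) grp
begin

lift_definition one_germ :: "'a germ" is "\<lambda>_. 1" .
lift_definition times_germ :: "'a germ \<Rightarrow> 'a germ \<Rightarrow> 'a germ" is "\<lambda>f g n. f n * g n"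
  by (metis (no_types, lifting) max.bounded_iff)
lift_definition inverse_germ :: "'a germ \<Rightarrow> 'a germ" is "\<lambda>f n. inverse (f n)"
  by metis
definition divide_germ :: "'a germ \<Rightarrow> 'a germ \<Rightarrow> 'a germ" where "divide_germ f g = f * inverse g"

instance
proof
  fix f g h :: "'a germ"
  show "f * g * h = f * (g * h)" by transfer (simp add: mult.assoc)
  show "1 * f = f" "f * 1 = f" by (transfer, simp)+
  show "inverse f * f = 1" by transfer (simp add: grp_left_inverse)
qed

end

lift_definition germ_of :: "(nat \<Rightarrow> 'b) \<Rightarrow> 'b germ" is "\<lambda>f. f" .

lemma germ_of_eq: "germ_of f = germ_of g \<longleftrightarrow> (\<exists>N. \<forall>n\<ge>N. f n = g n)"
  by transfer simp

lemma germ_of_mult: "germ_of f * germ_of g = germ_of (\<lambda>n. f n * g n)"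
  by transfer auto

locale embedding_chain =
  fixes S :: "nat \<Rightarrow> 'g::grp set" and \<phi> :: "nat \<Rightarrow> 'g \<Rightarrow> 'g"
  assumes S [simp]: "subgrp (S n)" and emb: "embeds (S n) (\<phi> n) (S (Suc n))"
begin

fun up :: "nat \<Rightarrow> nat \<Rightarrow> 'g \<Rightarrow> 'g" where
  "up n 0 g = g"
| "up n (Suc k) g = \<phi> (n + k) (up n k g)"

lemma up_embeds: "embeds (S n) (up n k) (S (n + k))"
proof (induction k)
  case 0
  then show ?case by (simp add: embeds_def hom_on_def)
next
  case (Suc k)
  have "up n (Suc k) = \<phi> (n + k) \<circ> up n k" by (rule ext) simp
  then show ?case using embeds_compose[OF Suc emb[of "n + k"]] by (simp only: add_Suc_right)
qed

lemma up_shift: "up (Suc n) k (\<phi> n g) = up n (Suc k) g"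
  by (induction k) simp_all

definition lim :: "nat \<Rightarrow> 'g \<Rightarrow> 'g germ" where
  "lim n g = germ_of (\<lambda>m. up n (m - n) g)"

definition limit :: "'g germ set" where
  "limit = (\<Union>n. lim n ` S n)"

lemma lim_hom: "hom_on (S n) (lim n)"
  using embedsD(1)[OF up_embeds[of n]] by (simp add: hom_on_def lim_def germ_of_mult)

lemma lim_inj: "inj_on (lim n) (S n)"
proof (rule inj_onI)
  fix g h assume gh: "g \<in> S n" "h \<in> S n" "lim n g = lim n h"
  then obtain N where N: "\<And>m. m \<ge> N \<Longrightarrow> up n (m - n) g = up n (m - n) h"
    by (auto simp: lim_def germ_of_eq)
  from N[of "n + N"] have "up n N g = up n N h" by simp
  then show "g = h" using inj_onD[OF embedsD(2)[OF up_embeds]] gh by blast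
qed

lemma lim_step: "lim (Suc n) (\<phi> n g) = lim n g"
  unfolding lim_def germ_of_eq
proof (intro exI allI impI)
  fix m assume "m \<ge> Suc n"
  then have "m - n = Suc (m - Suc n)" by simp
  then show "up (Suc n) (m - Suc n) (\<phi> n g) = up n (m - n) g" by (simp only: up_shift)
qed

lemma lim_embeds: "embeds (S n) (lim n) limit"
  using lim_hom lim_inj by (auto simp: embeds_def limit_def)

lemma lim_mono: "n \<le> m \<Longrightarrow> lim n ` S n \<subseteq> lim m ` S m"
proof (induction rule: dec_induct)
  case (step m)
  have "lim m ` S m \<subseteq> lim (Suc m) ` S (Suc m)"
  proof
    fix y assume "y \<in> lim m ` S m"
    then obtain x where x: "x \<in> S m" "y = lim (Suc m) (\<phi> m x)" by (auto simp: lim_step)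
    then show "y \<in> lim (Suc m) ` S (Suc m)" using embedsD(3)[OF emb x(1)] by blast
  qed
  then show ?case using step by blast
qed simp

lemma limit_common:
  assumes "x \<in> limit" "y \<in> limit"
  obtains n a b where "a \<in> S n" "b \<in> S n" "x = lim n a" "y = lim n b"
proof -
  obtain n m where "x \<in> lim n ` S n" "y \<in> lim m ` S m" using assms by (auto simp: limit_def)
  then have "x \<in> lim (max n m) ` S (max n m)" "y \<in> lim (max n m) ` S (max n m)"
    using lim_mono[of n "max n m"] lim_mono[of m "max n m"] by auto
  then show thesis using that by blast
qed

lemma subgrp_limit: "subgrp limit"
  unfolding subgrp_def
proof (intro conjI ballI)
  show "1 \<in> limit"
    using embedsD(3)[OF lim_embeds subgrp_one[OF S[of 0]]] hom_on_one[OF lim_hom S[of 0]] by simp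
  fix x assume x: "x \<in> limit"
  then obtain n a where a: "a \<in> S n" "x = lim n a" by (auto simp: limit_def)
  then show "inverse x \<in> limit"
    using embedsD(3)[OF lim_embeds subgrp_inverse[OF S a(1)]] hom_on_inverse[OF lim_hom S a(1)] by simp
  fix y assume "y \<in> limit"
  then obtain n a b where ab: "a \<in> S n" "b \<in> S n" "x = lim n a" "y = lim n b" using limit_common x by blast
  then show "x * y \<in> limit"
    using embedsD(3)[OF lim_embeds subgrp_mult[OF S ab(1,2)]] hom_on_mult[OF lim_hom ab(1,2)] by simp
qed

lemma limit_Invs_common:
  assumes "r \<in> Invs limit" "s \<in> Invs limit"
  obtains n a b where "a \<in> Invs (S n)" "b \<in> Invs (S n)" "r = lim n a" "s = lim n b"
proof -
  obtain n a b where ab: "a \<in> S n" "b \<in> S n" "r = lim n a" "s = lim n b"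
    using limit_common[OF InvsD(1)[OF assms(1)] InvsD(1)[OF assms(2)]] .
  have "r \<in> Invs (lim n ` S n)" "s \<in> Invs (lim n ` S n)" using ab assms by (auto simp: Invs_def)
  then have "r \<in> lim n ` Invs (S n)" "s \<in> lim n ` Invs (S n)"
    unfolding Invs_image[OF lim_hom lim_inj S] .
  then show thesis using that by blast
qed

end

text
  \<open>Every pair of involutions and every element of the limit comes from some stage of the chain, and the following stage provides what is needed. Centralisers are trivial at every stage.\<close>

lemma limit_exists:
  fixes S :: "'a sym set" and X :: "'a set"
  assumes A: "admissible S i j" and X: "infinite X" and SX: "S \<lesssim> X"
  obtains \<Gamma> :: "'a sym germ set" and f where "subgrp \<Gamma>" "embeds S f \<Gamma>" "\<Gamma> \<lesssim> X"
    "\<And>r s. r \<in> Invs \<Gamma> \<Longrightarrow> s \<in> Invs \<Gamma> \<Longrightarrow> r \<noteq> s \<Longrightarrow> conj_pair \<Gamma> (f i) (f j) r s"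
    "\<And>g. g \<in> \<Gamma> \<Longrightarrow> g * f i = f i * g \<Longrightarrow> g * f j = f j * g \<Longrightarrow> g = 1"
    "\<And>g. g \<in> \<Gamma> \<Longrightarrow> \<exists>a\<in>Invs \<Gamma>. \<exists>b\<in>Invs \<Gamma>. \<exists>c\<in>Invs \<Gamma>. \<exists>d\<in>Invs \<Gamma>. g = a * b * c * d"
proof -
  \<comment> \<open>A stage of the chain is a group with its two chosen involutions; \<open>Q\<close> relates successive stages.\<close>
  define P :: "'a sym set \<times> 'a sym \<times> 'a sym \<Rightarrow> bool" where
    "P = (\<lambda>(S, i, j). admissible S i j \<and> S \<lesssim> X)"
  define Q :: "'a sym set \<times> 'a sym \<times> 'a sym \<Rightarrow> 'a sym set \<times> 'a sym \<times> 'a sym \<Rightarrow> ('a sym \<Rightarrow> 'a sym) \<Rightarrow> bool" where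
    "Q = (\<lambda>(S, i, j) (S', i', j') f. embeds S f S' \<and> i' = f i \<and> j' = f j \<and>
      (\<forall>r\<in>Invs S. \<forall>s\<in>Invs S. r \<noteq> s \<longrightarrow> conj_pair S' (f i) (f j) (f r) (f s)) \<and>
      (\<forall>g\<in>S. \<exists>a\<in>Invs S'. \<exists>b\<in>Invs S'. \<exists>c\<in>Invs S'. \<exists>d\<in>Invs S'. f g = a * b * c * d))"
  have step: "\<exists>y. P y \<and> (\<exists>f. Q x y f)" if Px: "P x" for x
  proof -
    obtain T k l where x: "x = (T, k, l)" by (metis surj_pair)
    have "admissible T k l" "T \<lesssim> X" using Px by (simp_all add: P_def x)
    from one_round[OF this(1) X this(2)]
    obtain S' :: "'a sym set" and f where "embeds T f S'" "admissible S' (f k) (f l)" "S' \<lesssim> X"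
      "\<forall>r\<in>Invs T. \<forall>s\<in>Invs T. r \<noteq> s \<longrightarrow> conj_pair S' (f k) (f l) (f r) (f s)"
      "\<forall>g\<in>T. \<exists>a\<in>Invs S'. \<exists>b\<in>Invs S'. \<exists>c\<in>Invs S'. \<exists>d\<in>Invs S'. f g = a * b * c * d"
      by blast
    then have "P (S', f k, f l) \<and> Q x (S', f k, f l) f" by (simp add: P_def Q_def x)
    then show ?thesis by blast
  qed
  have "\<exists>F. \<forall>n. (P (F n) \<and> (n = 0 \<longrightarrow> F n = (S, i, j))) \<and> (\<exists>f. Q (F n) (F (Suc n)) f)"
  proof (rule dependent_nat_choice)
    show "\<exists>x. P x \<and> ((0::nat) = 0 \<longrightarrow> x = (S, i, j))" using A SX by (auto simp: P_def)
    show "\<exists>y. (P y \<and> (Suc n = 0 \<longrightarrow> y = (S, i, j))) \<and> (\<exists>f. Q x y f)"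
      if "P x \<and> (n = 0 \<longrightarrow> x = (S, i, j))" for x n
      using step[of x] that by auto
  qed
  then obtain F where F: "\<And>n. P (F n)" "F 0 = (S, i, j)" "\<And>n. \<exists>f. Q (F n) (F (Suc n)) f" by blast
  obtain \<phi> where \<phi>: "\<And>n. Q (F n) (F (Suc n)) (\<phi> n)" using F(3) by metis
  define T k l where "T n = fst (F n)" and "k n = fst (snd (F n))" and "l n = snd (snd (F n))" for n
  have Fn: "F n = (T n, k n, l n)" for n by (simp add: T_def k_def l_def)
  have adm: "admissible (T n) (k n) (l n)" and card: "T n \<lesssim> X" for n using F(1)[of n] by (simp_all add: P_def Fn)
  have q: "embeds (T n) (\<phi> n) (T (Suc n))" "k (Suc n) = \<phi> n (k n)" "l (Suc n) = \<phi> n (l n)"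
    "\<And>r s. r \<in> Invs (T n) \<Longrightarrow> s \<in> Invs (T n) \<Longrightarrow> r \<noteq> s \<Longrightarrow> conj_pair (T (Suc n)) (\<phi> n (k n)) (\<phi> n (l n)) (\<phi> n r) (\<phi> n s)"
    "\<And>g. g \<in> T n \<Longrightarrow> \<exists>a\<in>Invs (T (Suc n)). \<exists>b\<in>Invs (T (Suc n)). \<exists>c\<in>Invs (T (Suc n)). \<exists>d\<in>Invs (T (Suc n)). \<phi> n g = a * b * c * d"
    for n using \<phi>[of n] by (auto simp: Q_def Fn)
  have sT: "subgrp (T n)" for n using adm[of n] by (rule admissible.S)
  interpret C: embedding_chain T \<phi> by (unfold_locales) (rule sT, rule q(1))
  have 0: "T 0 = S" "k 0 = i" "l 0 = j" using F(2) Fn[of 0] by auto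
  have kl: "C.lim n (k n) = C.lim 0 i \<and> C.lim n (l n) = C.lim 0 j" for n
    by (induction n) (simp_all add: 0 q(2,3) C.lim_step)
  show thesis
  proof (rule that[of C.limit "C.lim 0"])
    show "subgrp C.limit" by (rule C.subgrp_limit)
    show "embeds S (C.lim 0) C.limit" using C.lim_embeds[of 0] by (simp add: 0)
    show "C.limit \<lesssim> X"
      unfolding C.limit_def by (rule infinite_UN_lepoll[OF X]) (rule lepoll_trans[OF image_lepoll card])
    show "conj_pair C.limit (C.lim 0 i) (C.lim 0 j) r s" if rs: "r \<in> Invs C.limit" "s \<in> Invs C.limit" "r \<noteq> s" for r s
    proof -
      obtain n a b where ab: "a \<in> Invs (T n)" "b \<in> Invs (T n)" "r = C.lim n a" "s = C.lim n b"
        using C.limit_Invs_common[OF rs(1,2)] .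
      have ne: "a \<noteq> b" using ab rs by blast
      note adS = admissible.i[OF adm[of n]] admissible.j[OF adm[of n]]
      have m: "\<phi> n (k n) \<in> T (Suc n)" "\<phi> n (l n) \<in> T (Suc n)"
        using embedsD(3)[OF q(1)] adS by (auto simp: Invs_def)
      from conj_pair_image[OF C.lim_hom sT m q(4)[OF ab(1,2) ne]]
      have "conj_pair (C.lim (Suc n) ` T (Suc n)) (C.lim 0 i) (C.lim 0 j) r s"
        unfolding C.lim_step ab(3,4)[symmetric] using kl[of n] by simp
      moreover have "C.lim (Suc n) ` T (Suc n) \<subseteq> C.limit" by (auto simp: C.limit_def)
      ultimately show ?thesis using conj_pair_mono by blast
    qed
    show "g = 1" if g: "g \<in> C.limit" "g * C.lim 0 i = C.lim 0 i * g" "g * C.lim 0 j = C.lim 0 j * g" for g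
    proof -
      obtain n a where a: "a \<in> T n" "g = C.lim n a" using g(1) by (auto simp: C.limit_def)
      have comm: "a * z = z * a" if "z \<in> T n" "g * C.lim n z = C.lim n z * g" for z
      proof -
        have "C.lim n (a * z) = C.lim n (z * a)" using that a hom_on_mult[OF C.lim_hom] by simp
        then show ?thesis using inj_on_eq_iff[OF C.lim_inj] a that subgrp_mult[OF sT] by blast
      qed
      have m: "k n \<in> T n" "l n \<in> T n"
        using admissible.i[OF adm[of n]] admissible.j[OF adm[of n]] by (auto simp: Invs_def)
      have "a = 1"
        by (rule admissible.cent[OF adm a(1) comm[OF m(1)] comm[OF m(2)]]) (use g kl[of n] in simp_all)
      then show ?thesis using a hom_on_one[OF C.lim_hom sT] by simp
    qed
    show "\<exists>a\<in>Invs C.limit. \<exists>b\<in>Invs C.limit. \<exists>c\<in>Invs C.limit. \<exists>d\<in>Invs C.limit. g = a * b * c * d"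
      if g: "g \<in> C.limit" for g
    proof -
      obtain n x where x: "x \<in> T n" "g = C.lim n x" using g(1) by (auto simp: C.limit_def)
      obtain a b c d where abcd: "a \<in> Invs (T (Suc n))" "b \<in> Invs (T (Suc n))" "c \<in> Invs (T (Suc n))"
        "d \<in> Invs (T (Suc n))" "\<phi> n x = a * b * c * d" using q(5)[OF x(1)] by blast
      let ?f = "C.lim (Suc n)"
      have "g = ?f (\<phi> n x)" by (simp add: C.lim_step x)
      also have "\<dots> = ?f a * ?f b * ?f c * ?f d"
        using abcd hom_on_mult[OF C.lim_hom] subgrp_mult[OF sT] by (simp add: Invs_def)
      finally show ?thesis using embeds_Invs[OF C.lim_embeds sT] abcd by blast
    qed
  qed
qed

section \<open>Groups acting on their involutions\<close>

context group
begin

lemma involutions_iff: "a \<in> involutions G \<longleftrightarrow> a \<in> carrier G \<and> a \<noteq> \<one> \<and> a \<otimes> a = \<one>"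
proof -
  have "ord a = 2 \<longleftrightarrow> a \<noteq> \<one> \<and> a \<otimes> a = \<one>" if a: "a \<in> carrier G"
  proof -
    have sq: "a [^] (2::nat) = a \<otimes> a" using a by (simp add: numeral_2_eq_2)
    have "a \<otimes> a = \<one> \<longleftrightarrow> ord a dvd 2" using pow_eq_id[OF a, of 2] sq by simp
    moreover have "ord a dvd 2 \<longleftrightarrow> ord a = 1 \<or> ord a = 2"
    proof
      assume d: "ord a dvd 2"
      then have "ord a \<le> 2" by (rule dvd_imp_le) simp
      moreover have "ord a \<noteq> 0" using d by (metis dvd_0_left_iff zero_neq_numeral)
      ultimately show "ord a = 1 \<or> ord a = 2" by linarith
    qed auto
    ultimately show ?thesis using ord_eq_1[OF a] by auto
  qed
  then show ?thesis by (auto simp: involutions_def)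
qed

lemma inv_cancel:
  assumes "g \<in> carrier G" "x \<in> carrier G"
  shows "inv g \<otimes> (g \<otimes> x) = x" "g \<otimes> (inv g \<otimes> x) = x"
  using assms by (simp_all add: m_assoc[symmetric])

lemma conj_involution:
  assumes "g \<in> carrier G" "a \<in> involutions G"
  shows "g \<otimes> a \<otimes> inv g \<in> involutions G"
proof -
  have a: "a \<in> carrier G" "a \<noteq> \<one>" "a \<otimes> a = \<one>" using assms(2) by (auto simp: involutions_iff)
  have "g \<otimes> a \<otimes> inv g \<otimes> (g \<otimes> a \<otimes> inv g) = g \<otimes> (a \<otimes> a) \<otimes> inv g"
    using assms(1) a(1) by (simp add: m_assoc inv_cancel)
  moreover have "g \<otimes> a \<otimes> inv g \<noteq> \<one>"
  proof
    assume "g \<otimes> a \<otimes> inv g = \<one>"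
    then have "g \<otimes> a = g" using assms(1) a(1) by (metis inv_closed inv_inv inv_equality m_closed)
    then show False using assms(1) a by (simp add: l_cancel_one)
  qed
  ultimately show ?thesis using assms(1) a by (simp add: involutions_iff)
qed

end

text \<open>The limit group has these properties, and they imply what is claimed about it.\<close>

locale two_transitive_on_involutions = group +
  fixes i j
  assumes ij: "i \<in> involutions G" "j \<in> involutions G" "i \<noteq> j"
    and conj: "\<And>r s. r \<in> involutions G \<Longrightarrow> s \<in> involutions G \<Longrightarrow> r \<noteq> s
      \<Longrightarrow> \<exists>g\<in>carrier G. g \<otimes> i \<otimes> inv g = r \<and> g \<otimes> j \<otimes> inv g = s"
    and cent: "\<And>g. g \<in> carrier G \<Longrightarrow> g \<otimes> i = i \<otimes> g \<Longrightarrow> g \<otimes> j = j \<otimes> g \<Longrightarrow> g = \<one>"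
    and four: "\<And>g. g \<in> carrier G \<Longrightarrow> \<exists>a\<in>involutions G. \<exists>b\<in>involutions G. \<exists>c\<in>involutions G.
      \<exists>d\<in>involutions G. g = a \<otimes> b \<otimes> c \<otimes> d"
begin

lemma invol_carrier: "a \<in> involutions G \<Longrightarrow> a \<in> carrier G"
  by (simp add: involutions_iff)

lemma conj_eq_iff: "g \<in> carrier G \<Longrightarrow> x \<in> carrier G \<Longrightarrow> y \<in> carrier G \<Longrightarrow> g \<otimes> x \<otimes> inv g = y \<longleftrightarrow> g \<otimes> x = y \<otimes> g"
  using inv_solve_right'[of y "g \<otimes> x" g] by auto

lemma conj_comp: "g \<in> carrier G \<Longrightarrow> h \<in> carrier G \<Longrightarrow> x \<in> carrier G
    \<Longrightarrow> g \<otimes> h \<otimes> x \<otimes> inv (g \<otimes> h) = g \<otimes> (h \<otimes> x \<otimes> inv h) \<otimes> inv g"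
  by (simp add: inv_mult_group m_assoc)

lemma conj_pairs_unique:
  assumes rs: "r \<in> involutions G" "s \<in> involutions G" "r \<noteq> s"
    and rs': "r' \<in> involutions G" "s' \<in> involutions G" "r' \<noteq> s'"
  shows "\<exists>!g. g \<in> carrier G \<and> g \<otimes> r \<otimes> inv g = r' \<and> g \<otimes> s \<otimes> inv g = s'"
proof -
  obtain g where g: "g \<in> carrier G" "g \<otimes> i \<otimes> inv g = r" "g \<otimes> j \<otimes> inv g = s" using conj[OF rs] by blast
  obtain h where h: "h \<in> carrier G" "h \<otimes> i \<otimes> inv h = r'" "h \<otimes> j \<otimes> inv h = s'" using conj[OF rs'] by blast
  note c = invol_carrier[OF ij(1)] invol_carrier[OF ij(2)]
  have gi: "inv g \<otimes> r \<otimes> inv (inv g) = i" "inv g \<otimes> s \<otimes> inv (inv g) = j"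
    unfolding g(2,3)[symmetric] using g(1) c by (simp_all add: m_assoc inv_cancel)
  have uniq: "k = h \<otimes> inv g" if k: "k \<in> carrier G" "k \<otimes> r \<otimes> inv k = r'" "k \<otimes> s \<otimes> inv k = s'" for k
  proof -
    let ?z = "inv h \<otimes> (k \<otimes> g)"
    have z: "?z \<in> carrier G" using k g h by simp
    have hi: "inv h \<otimes> r' \<otimes> inv (inv h) = i" "inv h \<otimes> s' \<otimes> inv (inv h) = j"
      unfolding h(2,3)[symmetric] using h(1) c by (simp_all add: m_assoc inv_cancel)
    have "?z \<otimes> i \<otimes> inv ?z = i" "?z \<otimes> j \<otimes> inv ?z = j"
      using conj_comp[of "inv h" "k \<otimes> g"] conj_comp[of k g] k g h c hi by simp_all
    then have "?z = \<one>" using cent[OF z] conj_eq_iff[OF z] c by simp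
    then have "k \<otimes> g = h" using k g h by (metis inv_closed inv_inv inv_equality m_closed inv_comm)
    then show ?thesis using k g h inv_solve_right by auto
  qed
  have "h \<otimes> inv g \<otimes> r \<otimes> inv (h \<otimes> inv g) = r'" "h \<otimes> inv g \<otimes> s \<otimes> inv (h \<otimes> inv g) = s'"
    using conj_comp[of h "inv g"] g h gi invol_carrier rs by simp_all
  then show ?thesis using uniq g h by (intro ex1I[of _ "h \<otimes> inv g"]) auto
qed

lemma sharply_2_transitive_on_involutions: "sharply_2_transitive_group G"
proof (rule sharply_2_transitive_groupI)
  define I where "I = involutions G"
  define \<psi> where "\<psi> g = (\<lambda>x\<in>I. g \<otimes> x \<otimes> inv g)" for g
  have IG: "x \<in> carrier G" if "x \<in> I" for x using that by (simp add: I_def invol_carrier)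
  have im: "\<psi> g x \<in> I" if "g \<in> carrier G" "x \<in> I" for g x
    using that conj_involution by (simp add: \<psi>_def I_def)
  have comp: "\<psi> (g \<otimes> h) x = \<psi> g (\<psi> h x)" if "g \<in> carrier G" "h \<in> carrier G" "x \<in> I" for g h x
    using that im[OF that(2,3)] conj_comp[of g h x] IG by (simp add: \<psi>_def)
  have one: "\<psi> \<one> x = x" if "x \<in> I" for x using that IG by (simp add: \<psi>_def)
  have bij: "\<psi> g \<in> Bij I" if g: "g \<in> carrier G" for g
  proof -
    have "bij_betw (\<psi> g) I I"
    proof (rule bij_betw_byWitness[where f' = "\<psi> (inv g)"])
      show "\<forall>x\<in>I. \<psi> (inv g) (\<psi> g x) = x" "\<forall>x\<in>I. \<psi> g (\<psi> (inv g) x) = x"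
        using g by (simp_all add: comp[symmetric] one)
    qed (use g im in auto)
    then show ?thesis by (simp add: Bij_def \<psi>_def)
  qed
  have "\<psi> \<in> hom G (BijGroup I)"
  proof (rule homI)
    fix g h assume g: "g \<in> carrier G" and h: "h \<in> carrier G"
    have "\<psi> (g \<otimes> h) = compose I (\<psi> g) (\<psi> h)"
    proof (rule extensionalityI[of _ I])
      show "\<psi> (g \<otimes> h) \<in> extensional I" by (simp add: \<psi>_def)
      show "\<psi> (g \<otimes> h) x = compose I (\<psi> g) (\<psi> h) x" if "x \<in> I" for x
        using that g h by (simp add: compose_def comp)
    qed simp
    then show "\<psi> (g \<otimes> h) = \<psi> g \<otimes>\<^bsub>BijGroup I\<^esub> \<psi> h" using g h by (simp add: BijGroup_def bij)
  qed (simp add: BijGroup_def bij)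
  then have "group_action G I \<psi>"
    by (simp add: group_action_def group_hom_def group_hom_axioms_def group_BijGroup)
  then show "sharply_2_transitive G I \<psi>"
  proof (intro sharply_2_transitive.intro sharply_2_transitive_axioms.intro)
    show "\<exists>x\<in>I. \<exists>y\<in>I. x \<noteq> y" using ij by (auto simp: I_def)
    fix x1 x2 y1 y2 assume x: "x1 \<in> I" "x2 \<in> I" "y1 \<in> I" "y2 \<in> I" "x1 \<noteq> x2" "y1 \<noteq> y2"
    show "\<exists>!g. g \<in> carrier G \<and> \<psi> g x1 = y1 \<and> \<psi> g x2 = y2"
      using conj_pairs_unique[of x1 x2 y1 y2] x by (simp add: \<psi>_def I_def)
  qed
qed

text \<open>Bracket the four involutions in pairs; a pair with product \<open>1\<close> can be
  dropped.\<close>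

lemma translation_or_product:
  assumes g: "g \<in> carrier G"
  shows "g \<in> translation_set G \<or> (\<exists>s\<in>translation_set G. \<exists>t\<in>translation_set G. g = s \<otimes> t)"
proof -
  obtain a b c d where abcd: "a \<in> involutions G" "b \<in> involutions G" "c \<in> involutions G" "d \<in> involutions G"
    "g = a \<otimes> b \<otimes> c \<otimes> d" using four[OF g] by blast
  note C = invol_carrier[OF abcd(1)] invol_carrier[OF abcd(2)] invol_carrier[OF abcd(3)] invol_carrier[OF abcd(4)]
    invol_carrier[OF ij(1)] invol_carrier[OF ij(2)]
  have T: "x \<otimes> y \<in> translation_set G" if "x \<in> involutions G" "y \<in> involutions G" "x \<otimes> y \<noteq> \<one>" for x y
    using that by (auto simp: translation_set_def)
  have g': "g = a \<otimes> b \<otimes> (c \<otimes> d)" using abcd(5) C by (simp add: m_assoc)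
  show ?thesis
  proof (cases "g = \<one>")
    case True
    have i: "i \<otimes> i = \<one>" "j \<otimes> j = \<one>" using ij by (simp_all add: involutions_iff)
    have "i \<otimes> j \<otimes> (j \<otimes> i) = i \<otimes> (j \<otimes> j) \<otimes> i" using C by (simp add: m_assoc)
    then have e: "i \<otimes> j \<otimes> (j \<otimes> i) = \<one>" using i C by simp
    have "x \<otimes> y \<noteq> \<one>" if "x \<in> involutions G" "y \<in> involutions G" "x \<noteq> y" for x y
      using that by (metis involutions_iff inv_equality)
    then have "i \<otimes> j \<in> translation_set G" "j \<otimes> i \<in> translation_set G" using T ij by auto
    then show ?thesis using e True by metis
  next
    case False
    show ?thesis
    proof (cases "a \<otimes> b = \<one> \<or> c \<otimes> d = \<one>")
      case True
      then have "g = a \<otimes> b \<or> g = c \<otimes> d" using g' C by auto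
      then show ?thesis using T abcd False by auto
    next
      case False
      then show ?thesis using T[OF abcd(1,2)] T[OF abcd(3,4)] g' by blast
    qed
  qed
qed

text \<open>Some involution \<open>r\<close> does not commute with a given non-trivial element
  \<open>n\<close> of the normal subgroup. The commutator of \<open>n\<close> and \<open>r\<close> is a
  product of two distinct involutions in the normal subgroup. As pairs of distinct involutions are
  conjugate, all such products belong to it.\<close>

lemma simple_from_involutions: "simple G"
  unfolding simple_def
proof (intro conjI allI impI)
  show "group G" by (rule is_group)
  show "carrier G \<noteq> {\<one>}" using ij by (auto simp: involutions_iff)
  fix N assume N: "N \<lhd> G"
  then have sN: "subgroup N G" and nN: "\<And>x h. x \<in> carrier G \<Longrightarrow> h \<in> N \<Longrightarrow> x \<otimes> h \<otimes> inv x \<in> N"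
    by (auto simp: normal_inv_iff)
  have NG: "N \<subseteq> carrier G" by (rule subgroup.subset[OF sN])
  show "N = carrier G \<or> N = {\<one>}"
  proof (rule disjCI)
    assume "N \<noteq> {\<one>}"
    then obtain n where n: "n \<in> N" "n \<noteq> \<one>" using subgroup.one_closed[OF sN] by blast
    have nG: "n \<in> carrier G" using n NG by blast
    have "\<not> (n \<otimes> i \<otimes> inv n = i \<and> n \<otimes> j \<otimes> inv n = j)"
      using cent[OF nG] conj_eq_iff[OF nG] ij invol_carrier n(2) by metis
    then obtain r where r: "r \<in> involutions G" "n \<otimes> r \<otimes> inv n \<noteq> r" using ij by blast
    define a where "a = n \<otimes> r \<otimes> inv n"
    have a: "a \<in> involutions G" "a \<noteq> r" using conj_involution[OF nG r(1)] r by (simp_all add: a_def)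
    have rG: "r \<in> carrier G" "r \<otimes> r = \<one>" using r by (simp_all add: involutions_iff)
    then have ir: "inv r = r" by (simp add: inv_equality)
    have "a \<otimes> r = n \<otimes> (r \<otimes> inv n \<otimes> inv r)" using nG rG by (simp add: a_def ir m_assoc)
    then have arN: "a \<otimes> r \<in> N"
      using nN[OF rG(1) subgroup.m_inv_closed[OF sN n(1)]] n subgroup.m_closed[OF sN] by simp
    have prod: "b \<otimes> c \<in> N" if b: "b \<in> involutions G" "c \<in> involutions G" for b c
    proof (cases "b = c")
      case True
      then show ?thesis using b subgroup.one_closed[OF sN] by (simp add: involutions_iff)
    next
      case False
      obtain g where g: "g \<in> carrier G" "g \<otimes> a \<otimes> inv g = b" "g \<otimes> r \<otimes> inv g = c"
        using conj_pairs_unique[OF a(1) r(1) a(2) b False] by blast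
      have "g \<otimes> (a \<otimes> r) \<otimes> inv g = b \<otimes> c"
        unfolding g(2,3)[symmetric] using g(1) invol_carrier[OF a(1)] rG by (simp add: m_assoc inv_cancel)
      then show ?thesis using nN[OF g(1) arN] by simp
    qed
    have "g \<in> N" if gG: "g \<in> carrier G" for g
    proof -
      obtain a b c d where abcd: "a \<in> involutions G" "b \<in> involutions G" "c \<in> involutions G" "d \<in> involutions G"
        "g = a \<otimes> b \<otimes> c \<otimes> d" using four[OF gG] by blast
      have "g = a \<otimes> b \<otimes> (c \<otimes> d)" using abcd invol_carrier by (simp add: m_assoc)
      then show ?thesis using prod abcd subgroup.m_closed[OF sN] by simp
    qed
    then show "N = carrier G" using NG by blast
  qed
qed

end

section \<open>Sharply 2-transitive groups of characteristic 0\<close>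

context sharply_2_transitive_char_0
begin

sublocale G: group G
  using group_hom by (simp add: group_hom_def)

lemma act: "g \<in> carrier G \<Longrightarrow> x \<in> S \<Longrightarrow> \<phi> g x \<in> S"
  using element_image[of g x "\<phi> g x"] by simp

lemma act_mult: "g \<in> carrier G \<Longrightarrow> h \<in> carrier G \<Longrightarrow> x \<in> S \<Longrightarrow> \<phi> (g \<otimes> h) x = \<phi> g (\<phi> h x)"
  by (rule composition_rule[rotated])

lemma act_one: "x \<in> S \<Longrightarrow> \<phi> \<one> x = x"
  using id_eq_one by (metis restrict_apply')

lemma act_inv: "g \<in> carrier G \<Longrightarrow> x \<in> S \<Longrightarrow> \<phi> (inv g) (\<phi> g x) = x"
  using act_mult[of "inv g" g x] act_one by simp

lemma fixes_two: "g \<in> carrier G \<Longrightarrow> x \<in> S \<Longrightarrow> y \<in> S \<Longrightarrow> x \<noteq> y \<Longrightarrow> \<phi> g x = x \<Longrightarrow> \<phi> g y = y \<Longrightarrow> g = \<one>"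
  using sharp[of x y x y] act_one G.one_closed by metis

lemma conj_fixes:
  assumes "g \<in> carrier G" "r \<in> carrier G" "x \<in> S" "\<phi> r x = x"
  shows "\<phi> (g \<otimes> r \<otimes> inv g) (\<phi> g x) = \<phi> g x"
  using assms by (simp add: act_mult act act_inv)

text \<open>The square fixes two points.\<close>

lemma swap_involution:
  assumes "g \<in> carrier G" "x \<in> S" "y \<in> S" "x \<noteq> y" "\<phi> g x = y" "\<phi> g y = x"
  shows "g \<in> involutions G"
proof -
  have "g \<otimes> g = \<one>" using fixes_two[of "g \<otimes> g" x y] assms by (simp add: act_mult)
  moreover have "g \<noteq> \<one>" using assms act_one by auto
  ultimately show ?thesis using assms(1) by (simp add: G.involutions_iff)
qed

text \<open>Let \<open>r\<close>, \<open>s\<close> fix \<open>x\<close>. Pick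
  \<open>y \<noteq> x\<close> and \<open>g\<close> fixing \<open>y\<close> and sending
  \<open>r y\<close> to \<open>s y\<close>. Then \<open>g r g\<inverse>\<close> and \<open>s\<close>
  both swap \<open>y\<close> and \<open>s y\<close>, so they are equal, and \<open>g\<close> fixes
  their only fixed point \<open>x\<close>. As \<open>g\<close> also fixes \<open>y\<close>, it is
  trivial.\<close>

lemma involution_eqI:
  assumes r: "r \<in> involutions G" and s: "s \<in> involutions G" and x: "x \<in> S" "\<phi> r x = x" "\<phi> s x = x"
  shows "r = s"
proof -
  have R: "r \<in> carrier G" "r \<noteq> \<one>" "r \<otimes> r = \<one>" using r by (simp_all add: G.involutions_iff)
  have Q: "s \<in> carrier G" "s \<noteq> \<one>" "s \<otimes> s = \<one>" using s by (simp_all add: G.involutions_iff)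
  obtain y where y: "y \<in> S" "y \<noteq> x" using two_points by metis
  have ry: "\<phi> r y \<noteq> y" "\<phi> s y \<noteq> y" using fixes_two[of _ x y] R Q x y by auto
  have rr: "\<phi> r (\<phi> r y) = y" "\<phi> s (\<phi> s y) = y"
    using act_mult[of r r y] act_mult[of s s y] R Q y act_one by simp_all
  have yS: "\<phi> r y \<in> S" "\<phi> s y \<in> S" using act R Q y by auto
  obtain g where g: "g \<in> carrier G" "\<phi> g y = y" "\<phi> g (\<phi> r y) = \<phi> s y"
    using sharp[of y "\<phi> r y" y "\<phi> s y"] y yS ry by metis
  define c where "c = g \<otimes> r \<otimes> inv g"
  have c: "c \<in> carrier G" using g R by (simp add: c_def)
  have gy: "\<phi> (inv g) y = y" "\<phi> (inv g) (\<phi> s y) = \<phi> r y"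
    using act_inv[OF g(1) y(1)] act_inv[OF g(1) yS(1)] g by auto
  have "\<phi> c y = \<phi> s y" "\<phi> c (\<phi> s y) = y"
    using g gy R y yS rr by (simp_all add: c_def act_mult act)
  then have cs: "c = s" using sharp[of y "\<phi> s y" "\<phi> s y" y] c Q rr y yS ry by metis
  have "\<phi> s (\<phi> g x) = \<phi> g x" using conj_fixes[OF g(1) R(1) x(1,2)] cs by (simp add: c_def)
  then have "\<phi> g x = x" using fixes_two[of s x "\<phi> g x"] Q x act g by metis
  then have "g = \<one>" using fixes_two[of g x y] g x y by metis
  then show "r = s" using cs R by (simp add: c_def)
qed

text \<open>Move the fixed points; by \<open>involution_eqI\<close> the involutions follow.\<close>

lemma conjugate_involutions:
  assumes rs: "r \<in> involutions G" "s \<in> involutions G" "r \<noteq> s"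
    and rs': "r' \<in> involutions G" "s' \<in> involutions G" "r' \<noteq> s'"
  shows "\<exists>g\<in>carrier G. g \<otimes> r \<otimes> inv g = r' \<and> g \<otimes> s \<otimes> inv g = s'"
proof -
  note c = G.involutions_iff
  obtain x y x' y' where f: "x \<in> S" "\<phi> r x = x" "y \<in> S" "\<phi> s y = y" "x' \<in> S" "\<phi> r' x' = x'" "y' \<in> S" "\<phi> s' y' = y'"
    using involution_fixed_point rs rs' by metis
  have "x \<noteq> y" "x' \<noteq> y'" using involution_eqI rs rs' f by metis+
  then obtain g where g: "g \<in> carrier G" "\<phi> g x = x'" "\<phi> g y = y'" using sharp f by metis
  have "g \<otimes> r \<otimes> inv g = r'"
    using involution_eqI[OF G.conj_involution[OF g(1) rs(1)] rs'(1) f(5)] conj_fixes[OF g(1) _ f(1,2)] rs(1) c g f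
    by auto
  moreover have "g \<otimes> s \<otimes> inv g = s'"
    using involution_eqI[OF G.conj_involution[OF g(1) rs(2)] rs'(2) f(7)] conj_fixes[OF g(1) _ f(3,4)] rs(2) c g f
    by auto
  ultimately show ?thesis using g(1) by blast
qed

lemma two_involutions: "\<exists>i\<in>involutions G. \<exists>j\<in>involutions G. i \<noteq> j"
proof -
  obtain x y where xy: "x \<in> S" "y \<in> S" "x \<noteq> y" using two_points by blast
  obtain i where i: "i \<in> carrier G" "\<phi> i x = y" "\<phi> i y = x" using sharp[of x y y x] xy by metis
  have iI: "i \<in> involutions G" using swap_involution i xy by blast
  then obtain z where z: "z \<in> S" "\<phi> i z = z" using involution_fixed_point by blast
  have zx: "z \<noteq> x" using z i xy by auto
  obtain g where g: "g \<in> carrier G" "\<phi> g z = x" "\<phi> g x = z" using sharp[of z x x z] z xy zx by metis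
  have "\<phi> (g \<otimes> i \<otimes> inv g) x = x" using conj_fixes[OF g(1) i(1) z] g by simp
  then have "g \<otimes> i \<otimes> inv g \<noteq> i" using i xy by auto
  then show ?thesis using G.conj_involution[OF g(1) iI] iI by blast
qed

lemma commutes_trivial:
  assumes ij: "i \<in> involutions G" "j \<in> involutions G" "i \<noteq> j"
    and g: "g \<in> carrier G" "g \<otimes> i = i \<otimes> g" "g \<otimes> j = j \<otimes> g"
  shows "g = \<one>"
proof -
  note c = G.involutions_iff
  obtain x y where f: "x \<in> S" "\<phi> i x = x" "y \<in> S" "\<phi> j y = y" using involution_fixed_point ij by metis
  have xy: "x \<noteq> y" using involution_eqI ij f by metis
  have *: "\<phi> g z = z" if "k \<in> involutions G" "g \<otimes> k = k \<otimes> g" "z \<in> S" "\<phi> k z = z" for k z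
  proof -
    have k: "k \<in> carrier G" "k \<noteq> \<one>" using that c by auto
    have "\<phi> k (\<phi> g z) = \<phi> g z"
      using act_mult[OF k(1) g(1) that(3)] act_mult[OF g(1) k(1) that(3)] that by simp
    then show ?thesis using fixes_two[of k z "\<phi> g z"] k that act[OF g(1)] by metis
  qed
  show ?thesis using fixes_two[OF g(1) f(1,3) xy] * ij g f by blast
qed

text \<open>If \<open>r s\<close> had finite order, \<open>r\<close> and \<open>s\<close> would
  generate a finite group, which is not isomorphic to the infinite dihedral group.\<close>

lemma infinite_order_product:
  assumes rs: "r \<in> involutions G" "s \<in> involutions G" "r \<noteq> s"
    and \<psi>: "inj_on \<psi> (carrier G)" "\<And>x y. x \<in> carrier G \<Longrightarrow> y \<in> carrier G \<Longrightarrow> \<psi> (x \<otimes> y) = \<psi> x * \<psi> y"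
  shows "inf_ord (\<psi> r * \<psi> s :: 'g::grp)"
proof (rule ccontr)
  assume "\<not> inf_ord (\<psi> r * \<psi> s)"
  then obtain n where n: "n > 0" "(\<psi> r * \<psi> s) ^ n = 1" by (auto simp: inf_ord_def)
  define p where "p = \<psi> r * \<psi> s"
  have 1: "\<psi> \<one> = 1" using \<psi>(2)[of \<one> \<one>] grp_left_cancel[of "\<psi> \<one>" "\<psi> \<one>" 1] by simp
  have R: "r \<in> carrier G" "r \<otimes> r = \<one>" "s \<in> carrier G" "s \<otimes> s = \<one>" using rs by (simp_all add: G.involutions_iff)
  have sq: "\<psi> r * \<psi> r = 1" "\<psi> s * \<psi> s = 1" using \<psi>(2)[OF R(1,1)] \<psi>(2)[OF R(3,3)] R 1 by auto
  note D = subgrp_dih[OF sq] and DG = dih_gens[OF sq]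
  have pk: "p powi k \<in> (\<lambda>m. p ^ m) ` {..<n}" for k
  proof -
    have "p powi k = p powi (int n * (k div int n) + k mod int n)" by simp
    also have "\<dots> = (p powi int n) powi (k div int n) * p powi (k mod int n)" by (simp only: powi_add powi_mult)
    also have "\<dots> = p powi (k mod int n)" using n by (simp add: p_def powi_of_nat)
    also have "\<dots> = p ^ nat (k mod int n)" using n powi_of_nat[of p "nat (k mod int n)"] by simp
    finally show ?thesis using n by (auto intro!: imageI simp: nat_less_iff)
  qed
  have "p powi k * \<psi> r \<in> (\<lambda>m. p ^ m * \<psi> r) ` {..<n}" for k using pk[of k] by auto
  then have "dih (\<psi> r) (\<psi> s) \<subseteq> (\<lambda>m. p ^ m) ` {..<n} \<union> (\<lambda>m. p ^ m * \<psi> r) ` {..<n}"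
    unfolding dih_def p_def[symmetric] using pk by blast
  then have fin: "finite (dih (\<psi> r) (\<psi> s))" by (rule finite_subset) simp
  have \<psi>inv: "\<psi> (inv x) = inverse (\<psi> x)" if "x \<in> carrier G" for x
    using \<psi>(2)[of x "inv x"] that 1 grp_inverse_unique[of "\<psi> x" "\<psi> (inv x)"] by simp
  have sub: "{r, s} \<subseteq> carrier G" using R by simp
  have "\<psi> x \<in> dih (\<psi> r) (\<psi> s)" if "x \<in> generate G {r, s}" for x
    using that
  proof induction
    case one
    then show ?case using D 1 by simp
  next
    case (incl h)
    then show ?case using DG by auto
  next
    case (inv h)
    then show ?case using D DG \<psi>inv sub by auto
  next
    case (eng h1 h2)
    then show ?case
      using \<psi>(2) G.generate_in_carrier[OF sub] D by simp
  qed
  then have "\<psi> ` generate G {r, s} \<subseteq> dih (\<psi> r) (\<psi> s)" by blast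
  then have "finite (\<psi> ` generate G {r, s})" using fin finite_subset by blast
  moreover have "inj_on \<psi> (generate G {r, s})"
    using inj_on_subset[OF \<psi>(1)] G.generate_in_carrier[OF sub] by blast
  ultimately have "finite (generate G {r, s})" by (simp add: finite_image_iff)
  moreover have "carrier (subgroup_generated G {r, s}) = generate G {r, s}"
    using sub by (simp add: carrier_subgroup_generated Int_absorb1)
  moreover obtain h where "bij_betw h (carrier (subgroup_generated G {r, s})) (carrier infinite_dihedral_group)"
    using infinite_dihedral[OF rs] by (auto simp: is_iso_def iso_def)
  ultimately have "finite (carrier infinite_dihedral_group)" using bij_betw_finite by metis
  then show False by (simp add: infinite_dihedral_group_def finite_cartesian_product_iff)
qed

text
  \<open>All pairs of distinct involutions are conjugate here, so the alternative of lying in a malnormal dihedral group does not arise yet.\<close>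

theorem admissible_cayley:
  fixes \<psi> :: "'a \<Rightarrow> 'g::grp"
  assumes \<psi>: "inj_on \<psi> (carrier G)" "\<And>x y. x \<in> carrier G \<Longrightarrow> y \<in> carrier G \<Longrightarrow> \<psi> (x \<otimes> y) = \<psi> x * \<psi> y"
    and ij: "i \<in> involutions G" "j \<in> involutions G" "i \<noteq> j"
  shows "admissible (\<psi> ` carrier G) (\<psi> i) (\<psi> j)"
proof -
  have 1: "\<psi> \<one> = 1" using \<psi>(2)[of \<one> \<one>] grp_left_cancel[of "\<psi> \<one>" "\<psi> \<one>" 1] by simp
  have inv: "\<psi> (inv x) = inverse (\<psi> x)" if "x \<in> carrier G" for x
    using \<psi>(2)[of x "inv x"] that 1 grp_inverse_unique[of "\<psi> x" "\<psi> (inv x)"] by simp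
  have eq: "\<psi> x = \<psi> y \<longleftrightarrow> x = y" if "x \<in> carrier G" "y \<in> carrier G" for x y
    using inj_on_eq_iff[OF \<psi>(1) that] .
  have sub: "subgrp (\<psi> ` carrier G)"
    unfolding subgrp_def
  proof (intro conjI ballI)
    show "1 \<in> \<psi> ` carrier G" using 1 by (metis G.one_closed imageI)
    fix x assume "x \<in> \<psi> ` carrier G"
    then obtain a where a: "a \<in> carrier G" "x = \<psi> a" by blast
    show "inverse x \<in> \<psi> ` carrier G" using inv[OF a(1)] a G.inv_closed by (metis imageI)
    fix y assume "y \<in> \<psi> ` carrier G"
    then obtain b where b: "b \<in> carrier G" "y = \<psi> b" by blast
    show "x * y \<in> \<psi> ` carrier G" using \<psi>(2)[OF a(1) b(1)] a b G.m_closed by (metis imageI)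
  qed
  have I: "Invs (\<psi> ` carrier G) = \<psi> ` involutions G"
  proof -
    have *: "\<psi> x \<in> Invs (\<psi> ` carrier G) \<longleftrightarrow> x \<in> involutions G" if "x \<in> carrier G" for x
      using eq[OF that G.one_closed] eq[OF G.m_closed[OF that that] G.one_closed] \<psi>(2)[OF that that] 1 that
      by (simp add: G.involutions_iff Invs_def)
    show ?thesis
    proof (intro equalityI subsetI)
      fix y assume y: "y \<in> Invs (\<psi> ` carrier G)"
      then obtain x where "x \<in> carrier G" "y = \<psi> x" by (auto simp: Invs_def)
      then show "y \<in> \<psi> ` involutions G" using * y by blast
    next
      fix y assume "y \<in> \<psi> ` involutions G"
      then show "y \<in> Invs (\<psi> ` carrier G)" using * by (auto simp: involutions_def)
    qed
  qed
  have C: "a \<in> carrier G" if "a \<in> involutions G" for a using that by (simp add: G.involutions_iff)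
  have pair: "conj_pair (\<psi> ` carrier G) (\<psi> i) (\<psi> j) r s"
    if rs: "r \<in> Invs (\<psi> ` carrier G)" "s \<in> Invs (\<psi> ` carrier G)" "r \<noteq> s" for r s
  proof -
    obtain a b where ab: "a \<in> involutions G" "b \<in> involutions G" "r = \<psi> a" "s = \<psi> b" "a \<noteq> b"
      using rs unfolding I by blast
    obtain g where g: "g \<in> carrier G" "g \<otimes> i \<otimes> inv g = a" "g \<otimes> j \<otimes> inv g = b"
      using conjugate_involutions[OF ij ab(1,2,5)] by blast
    have "\<psi> (g \<otimes> k \<otimes> inv g) = \<psi> g * \<psi> k * inverse (\<psi> g)" if "k \<in> carrier G" for k
      using g(1) that by (simp add: \<psi>(2) inv)
    then show ?thesis
      using conj_pairI[of "\<psi> g" "\<psi> ` carrier G" "\<psi> i" "\<psi> j"] g ab C ij by force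
  qed
  show ?thesis
  proof
    show "subgrp (\<psi> ` carrier G)" by (rule sub)
    show "\<psi> i \<in> Invs (\<psi> ` carrier G)" "\<psi> j \<in> Invs (\<psi> ` carrier G)" unfolding I using ij by auto
    show "\<psi> i \<noteq> \<psi> j" using eq C ij by simp
    show "inf_ord (r * s)" if rs: "r \<in> Invs (\<psi> ` carrier G)" "s \<in> Invs (\<psi> ` carrier G)" "r \<noteq> s" for r s
    proof -
      obtain a b where ab: "a \<in> involutions G" "b \<in> involutions G" "r = \<psi> a" "s = \<psi> b" "a \<noteq> b"
        using rs unfolding I by blast
      show ?thesis unfolding ab(3,4) by (rule infinite_order_product[OF ab(1,2,5) \<psi>])
    qed
    show "g = 1" if g: "g \<in> \<psi> ` carrier G" "g * \<psi> i = \<psi> i * g" "g * \<psi> j = \<psi> j * g" for g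
    proof -
      obtain a where a: "a \<in> carrier G" "g = \<psi> a" using g by blast
      have "a \<otimes> k = k \<otimes> a" if "k \<in> carrier G" "g * \<psi> k = \<psi> k * g" for k
        using that a eq[of "a \<otimes> k" "k \<otimes> a"] by (simp add: \<psi>(2))
      then have "a = \<one>" using commutes_trivial[OF ij a(1)] g C ij by blast
      then show ?thesis using a 1 by simp
    qed
    show "conj_pair (\<psi> ` carrier G) (\<psi> i) (\<psi> j) r s \<or> malnormal_pair (\<psi> ` carrier G) r s"
      if "r \<in> Invs (\<psi> ` carrier G)" "s \<in> Invs (\<psi> ` carrier G)" "r \<noteq> s" for r s
      using pair[OF that] by blast
    show "conj_pair (\<psi> ` carrier G) (\<psi> i) (\<psi> j) r s"
      if "r \<in> Invs (dih (\<psi> i) (\<psi> j))" "s \<in> Invs (dih (\<psi> i) (\<psi> j))" "r \<noteq> s" for r s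
    proof -
      have "\<psi> i \<in> Invs (\<psi> ` carrier G)" "\<psi> j \<in> Invs (\<psi> ` carrier G)" unfolding I using ij by auto
      then have "dih (\<psi> i) (\<psi> j) \<subseteq> \<psi> ` carrier G"
        by (intro dih_least[OF _ _ sub]) (auto simp: Invs_def)
      then have "r \<in> Invs (\<psi> ` carrier G)" "s \<in> Invs (\<psi> ` carrier G)"
        using that by (auto simp: Invs_def)
      then show ?thesis using pair that(3) by blast
    qed
  qed
qed

end

theorem theorem1p7:
  fixes G :: "('a, 'm) monoid_scheme" and S :: "'x set" and \<phi> :: "'a \<Rightarrow> 'x \<Rightarrow> 'x"
  assumes "sharply_2_transitive_char_0 G S \<phi>"
  shows "\<exists>\<Gamma> :: 'a monoid.
    simple \<Gamma> \<and>
    sharply_2_transitive_group \<Gamma> \<and>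
    (\<exists>h. h \<in> mon G \<Gamma>) \<and>
    carrier \<Gamma> \<approx> carrier G \<and>
    (\<forall>g\<in>carrier \<Gamma>. g \<in> translation_set \<Gamma> \<or>
      (\<exists>s\<in>translation_set \<Gamma>. \<exists>t\<in>translation_set \<Gamma>. g = s \<otimes>\<^bsub>\<Gamma>\<^esub> t)) \<and>
    (\<forall>g\<in>carrier \<Gamma>. \<exists>a\<in>involutions \<Gamma>. \<exists>b\<in>involutions \<Gamma>. \<exists>c\<in>involutions \<Gamma>. \<exists>d\<in>involutions \<Gamma>.
      g = a \<otimes>\<^bsub>\<Gamma>\<^esub> b \<otimes>\<^bsub>\<Gamma>\<^esub> c \<otimes>\<^bsub>\<Gamma>\<^esub> d)"
proof -
  interpret sharply_2_transitive_char_0 G S \<phi> by fact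
  define X where "X = carrier G"
  obtain i j where ij: "i \<in> involutions G" "j \<in> involutions G" "i \<noteq> j" using two_involutions by blast
  obtain \<psi> :: "'a \<Rightarrow> 'a sym" where \<psi>: "inj_on \<psi> (carrier G)"
    "\<And>x y. x \<in> carrier G \<Longrightarrow> y \<in> carrier G \<Longrightarrow> \<psi> (x \<otimes>\<^bsub>G\<^esub> y) = \<psi> x * \<psi> y"
  proof (rule cayley[OF G.is_group])
    show "carrier G \<lesssim> (UNIV :: 'a set)" by (simp add: subset_imp_lepoll)
  qed blast
  define G' where "G' = \<psi> ` carrier G"
  have adm: "admissible G' (\<psi> i) (\<psi> j)" unfolding G'_def by (rule admissible_cayley[OF \<psi> ij])
  interpret A: admissible G' "\<psi> i" "\<psi> j" by (rule adm)
  have G'X: "G' \<approx> X" unfolding G'_def X_def using \<psi>(1) by (simp add: inj_on_image_eqpoll_self)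
  have infX: "infinite X"
  proof
    assume "finite X"
    then have "finite G'" by (simp add: G'_def X_def)
    moreover have "range (\<lambda>k. (\<psi> i * \<psi> j) powi k) \<subseteq> G'"
      using A.i A.j by (auto simp: Invs_def)
    moreover have "inj (\<lambda>k. (\<psi> i * \<psi> j) powi k)"
      using inf_ord_powi_inj[OF A.inf[OF A.i A.j A.ij]] by (simp add: inj_on_def)
    ultimately have "finite (UNIV :: int set)" using finite_subset finite_image_iff by blast
    then show False by simp
  qed
  have "G' \<lesssim> X" using G'X by (rule eqpoll_imp_lepoll)
  obtain \<Gamma>0 :: "'a sym germ set" and f where \<Gamma>0: "subgrp \<Gamma>0" "embeds G' f \<Gamma>0" "\<Gamma>0 \<lesssim> X"
    "\<And>r s. r \<in> Invs \<Gamma>0 \<Longrightarrow> s \<in> Invs \<Gamma>0 \<Longrightarrow> r \<noteq> s \<Longrightarrow> conj_pair \<Gamma>0 (f (\<psi> i)) (f (\<psi> j)) r s"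
    "\<And>g. g \<in> \<Gamma>0 \<Longrightarrow> g * f (\<psi> i) = f (\<psi> i) * g \<Longrightarrow> g * f (\<psi> j) = f (\<psi> j) * g \<Longrightarrow> g = 1"
    "\<And>g. g \<in> \<Gamma>0 \<Longrightarrow> \<exists>a\<in>Invs \<Gamma>0. \<exists>b\<in>Invs \<Gamma>0. \<exists>c\<in>Invs \<Gamma>0. \<exists>d\<in>Invs \<Gamma>0. g = a * b * c * d"
    by (rule limit_exists[OF adm infX \<open>G' \<lesssim> X\<close>]) blast
  note sub [simp] = subgrp_one[OF \<Gamma>0(1)] subgrp_mult[OF \<Gamma>0(1)] subgrp_inverse[OF \<Gamma>0(1)]
  have "X \<lesssim> G'" using G'X by (rule eqpoll_imp_lepoll[OF eqpoll_sym])
  moreover have "G' \<lesssim> \<Gamma>0" using \<Gamma>0(2) by (auto simp: embeds_def lepoll_def)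
  ultimately have "\<Gamma>0 \<approx> X" using lepoll_antisym[OF \<Gamma>0(3)] lepoll_trans by blast
  then obtain \<beta> where \<beta>: "bij_betw \<beta> \<Gamma>0 X" by (auto simp: eqpoll_def)
  \<comment> \<open>The multiplication of the limit, carried over to the carrier of \<open>G\<close>.\<close>
  define \<alpha> where "\<alpha> = inv_into \<Gamma>0 \<beta>"
  have \<beta>X: "\<beta> g \<in> X" and \<alpha>\<beta>: "\<alpha> (\<beta> g) = g" if "g \<in> \<Gamma>0" for g
    using \<beta> that by (auto simp: \<alpha>_def bij_betw_def)
  have \<alpha>\<Gamma>: "\<alpha> x \<in> \<Gamma>0" and \<beta>\<alpha>: "\<beta> (\<alpha> x) = x" if "x \<in> X" for x
    using \<beta> that by (auto simp: \<alpha>_def bij_betw_def inv_into_into f_inv_into_f)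
  define \<Gamma> :: "'a monoid" where "\<Gamma> = \<lparr>carrier = X, mult = (\<lambda>x y. \<beta> (\<alpha> x * \<alpha> y)), one = \<beta> 1\<rparr>"
  have car: "carrier \<Gamma> = X" and mlt: "x \<otimes>\<^bsub>\<Gamma>\<^esub> y = \<beta> (\<alpha> x * \<alpha> y)" and one: "\<one>\<^bsub>\<Gamma>\<^esub> = \<beta> 1" for x y
    by (simp_all add: \<Gamma>_def)
  interpret \<Gamma>: group \<Gamma>
  proof (rule groupI)
    show "\<exists>y\<in>carrier \<Gamma>. y \<otimes>\<^bsub>\<Gamma>\<^esub> x = \<one>\<^bsub>\<Gamma>\<^esub>" if "x \<in> carrier \<Gamma>" for x
      using that by (intro bexI[of _ "\<beta> (inverse (\<alpha> x))"])
        (simp_all add: car mlt one \<alpha>\<Gamma> \<beta>X \<alpha>\<beta> grp_left_inverse)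
  qed (simp_all add: car mlt one \<alpha>\<Gamma> \<beta>X \<alpha>\<beta> \<beta>\<alpha> mult.assoc)
  have \<beta>m: "\<beta> g \<otimes>\<^bsub>\<Gamma>\<^esub> \<beta> h = \<beta> (g * h)" if "g \<in> \<Gamma>0" "h \<in> \<Gamma>0" for g h
    using that by (simp add: mlt \<alpha>\<beta>)
  have \<beta>eq: "\<beta> g = \<beta> h \<longleftrightarrow> g = h" if "g \<in> \<Gamma>0" "h \<in> \<Gamma>0" for g h
    using \<alpha>\<beta> that by metis
  have \<beta>inv: "inv\<^bsub>\<Gamma>\<^esub> (\<beta> g) = \<beta> (inverse g)" if "g \<in> \<Gamma>0" for g
    by (rule \<Gamma>.inv_equality) (use that in \<open>simp_all add: \<beta>m one car \<beta>X grp_left_inverse\<close>)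
  have InvG: "x \<in> \<Gamma>0" if "x \<in> Invs \<Gamma>0" for x using that by (simp add: Invs_def)
  have I: "involutions \<Gamma> = \<beta> ` Invs \<Gamma>0"
  proof (intro equalityI subsetI)
    fix x assume "x \<in> involutions \<Gamma>"
    then have x: "x \<in> X" "x \<noteq> \<beta> 1" "\<beta> (\<alpha> x * \<alpha> x) = \<beta> 1" by (auto simp: \<Gamma>.involutions_iff car one mlt)
    have "\<alpha> x \<noteq> 1" using x(2) \<beta>\<alpha>[OF x(1)] by auto
    then have "\<alpha> x \<in> Invs \<Gamma>0" using x(3) \<alpha>\<Gamma>[OF x(1)] \<beta>eq by (simp add: Invs_def)
    then show "x \<in> \<beta> ` Invs \<Gamma>0" using \<beta>\<alpha>[OF x(1)] by (metis imageI)
  next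
    fix x assume "x \<in> \<beta> ` Invs \<Gamma>0"
    then show "x \<in> involutions \<Gamma>" by (auto simp: Invs_def \<Gamma>.involutions_iff car one \<beta>X \<beta>m \<beta>eq)
  qed
  define i' j' where "i' = f (\<psi> i)" and "j' = f (\<psi> j)"
  have ij': "i' \<in> Invs \<Gamma>0" "j' \<in> Invs \<Gamma>0" "i' \<noteq> j'"
    using embeds_Invs[OF \<Gamma>0(2) A.S] A.i A.j A.ij inj_on_eq_iff[OF embedsD(2)[OF \<Gamma>0(2)]]
    by (auto simp: i'_def j'_def Invs_def)
  have 1: "\<beta> i' \<in> involutions \<Gamma>" "\<beta> j' \<in> involutions \<Gamma>" "\<beta> i' \<noteq> \<beta> j'"
    using ij' InvG \<beta>eq by (auto simp: I)
  have 2: "\<exists>g\<in>carrier \<Gamma>. g \<otimes>\<^bsub>\<Gamma>\<^esub> \<beta> i' \<otimes>\<^bsub>\<Gamma>\<^esub> inv\<^bsub>\<Gamma>\<^esub> g = r \<and> g \<otimes>\<^bsub>\<Gamma>\<^esub> \<beta> j' \<otimes>\<^bsub>\<Gamma>\<^esub> inv\<^bsub>\<Gamma>\<^esub> g = s"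
    if rs: "r \<in> involutions \<Gamma>" "s \<in> involutions \<Gamma>" "r \<noteq> s" for r s
  proof -
    obtain a b where ab: "a \<in> Invs \<Gamma>0" "b \<in> Invs \<Gamma>0" "r = \<beta> a" "s = \<beta> b" "a \<noteq> b" using rs unfolding I by blast
    obtain g where g: "g \<in> \<Gamma>0" "g * i' * inverse g = a" "g * j' * inverse g = b"
      using \<Gamma>0(4)[OF ab(1,2,5)] by (auto simp: conj_pair_def i'_def j'_def)
    have "\<beta> g \<otimes>\<^bsub>\<Gamma>\<^esub> \<beta> k \<otimes>\<^bsub>\<Gamma>\<^esub> inv\<^bsub>\<Gamma>\<^esub> (\<beta> g) = \<beta> (g * k * inverse g)" if "k \<in> \<Gamma>0" for k
      using g(1) that by (simp add: \<beta>inv \<beta>m)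
    then show ?thesis
      using g ab ij' InvG \<beta>X[OF g(1)] by (intro bexI[of _ "\<beta> g"]) (simp_all add: car)
  qed
  have 3: "g = \<one>\<^bsub>\<Gamma>\<^esub>"
    if g: "g \<in> carrier \<Gamma>" "g \<otimes>\<^bsub>\<Gamma>\<^esub> \<beta> i' = \<beta> i' \<otimes>\<^bsub>\<Gamma>\<^esub> g" "g \<otimes>\<^bsub>\<Gamma>\<^esub> \<beta> j' = \<beta> j' \<otimes>\<^bsub>\<Gamma>\<^esub> g" for g
  proof -
    have gX: "g \<in> X" using g by (simp add: car)
    have m: "i' \<in> \<Gamma>0" "j' \<in> \<Gamma>0" using ij' InvG by auto
    have "\<alpha> g * i' = i' * \<alpha> g" "\<alpha> g * j' = j' * \<alpha> g"
      using g(2,3) \<alpha>\<Gamma>[OF gX] m by (simp_all add: mlt \<alpha>\<beta> \<beta>eq)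
    then have "\<alpha> g = 1" using \<Gamma>0(5)[OF \<alpha>\<Gamma>[OF gX]] by (simp add: i'_def j'_def)
    then show ?thesis using \<beta>\<alpha>[OF gX] by (simp add: one)
  qed
  have 4: "\<exists>a\<in>involutions \<Gamma>. \<exists>b\<in>involutions \<Gamma>. \<exists>c\<in>involutions \<Gamma>. \<exists>d\<in>involutions \<Gamma>.
      g = a \<otimes>\<^bsub>\<Gamma>\<^esub> b \<otimes>\<^bsub>\<Gamma>\<^esub> c \<otimes>\<^bsub>\<Gamma>\<^esub> d" if g: "g \<in> carrier \<Gamma>" for g
  proof -
    have gX: "g \<in> X" using g by (simp add: car)
    obtain a b c d where abcd: "a \<in> Invs \<Gamma>0" "b \<in> Invs \<Gamma>0" "c \<in> Invs \<Gamma>0" "d \<in> Invs \<Gamma>0" "\<alpha> g = a * b * c * d"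
      using \<Gamma>0(6)[OF \<alpha>\<Gamma>[OF gX]] by blast
    have "g = \<beta> (a * b * c * d)" using \<beta>\<alpha>[OF gX] abcd by simp
    also have "\<dots> = \<beta> a \<otimes>\<^bsub>\<Gamma>\<^esub> \<beta> b \<otimes>\<^bsub>\<Gamma>\<^esub> \<beta> c \<otimes>\<^bsub>\<Gamma>\<^esub> \<beta> d" using abcd InvG by (simp add: \<beta>m)
    finally show ?thesis using abcd unfolding I by blast
  qed
  interpret T: two_transitive_on_involutions \<Gamma> "\<beta> i'" "\<beta> j'"
    by unfold_locales (use 1 2 3 4 in blast)+
  have "(\<lambda>x. \<beta> (f (\<psi> x))) \<in> mon G \<Gamma>"
  proof -
    have e: "f (\<psi> x) \<in> \<Gamma>0" if "x \<in> carrier G" for x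
      using embedsD(3)[OF \<Gamma>0(2)] that by (simp add: G'_def)
    have "f (\<psi> (x \<otimes>\<^bsub>G\<^esub> y)) = f (\<psi> x) * f (\<psi> y)" if "x \<in> carrier G" "y \<in> carrier G" for x y
      using \<psi>(2)[OF that] hom_on_mult[OF embedsD(1)[OF \<Gamma>0(2)]] that by (simp add: G'_def)
    then have "(\<lambda>x. \<beta> (f (\<psi> x))) \<in> hom G \<Gamma>"
      by (intro homI) (simp_all add: car \<beta>X e \<beta>m)
    moreover have "inj_on (\<lambda>x. \<beta> (f (\<psi> x))) (carrier G)"
    proof (rule inj_onI)
      fix x y assume xy: "x \<in> carrier G" "y \<in> carrier G" "\<beta> (f (\<psi> x)) = \<beta> (f (\<psi> y))"
      then have "f (\<psi> x) = f (\<psi> y)" using \<beta>eq e by blast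
      then have "\<psi> x = \<psi> y" using inj_on_eq_iff[OF embedsD(2)[OF \<Gamma>0(2)]] xy by (simp add: G'_def)
      then show "x = y" using \<psi>(1) xy by (simp add: inj_on_eq_iff)
    qed
    ultimately show ?thesis by (simp add: mon_def)
  qed
  moreover have "simple \<Gamma>" by (rule T.simple_from_involutions)
  moreover have "sharply_2_transitive_group \<Gamma>" by (rule T.sharply_2_transitive_on_involutions)
  moreover have "carrier \<Gamma> \<approx> carrier G" by (simp add: car X_def)
  ultimately show ?thesis using T.translation_or_product 4 by blast
qed

end
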